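(* Consider the two-dimensional scheme $\mathcal M^\delta_\Delta$, $\Delta=(\Delta t,h)$, described in the context, built from an $s$-stage IMEX partitioned Runge-Kutta pair ($\tilde\alpha_{i,j}=0$ for $j\ge i$; $\alpha_{i,j}=0$ for $j>i$ and $\alpha_{i,i}\ne0$) with $\tilde\beta=\beta$ that is Stiffly Accurate, i.e. $\alpha_{s,j}=\beta_j$ for $j=1,\dots,s$. Assume that $U^n$ and every stage $\tilde U^{(l)}$, $U^{(l)}$, $l=1,\dots,s$, admit the expansion in powers of the squared Mach number $\delta$ given in the context (density, velocity, concentration and pressure). If $U^n$ is well-prepared, i.e. $\nabla_h\rho^n_{(0)}=0$ and $\operatorname{div}_h\mathbf v^n_{(0)}=0$, then so is every $U^{(l)}$, $l=1,\dots,s$, i.e. $\nabla_h\rho^{(l)}_{(0)}=0$ and $\operatorname{div}_h\mathbf v^{(l)}_{(0)}=0$. Furthermore, if $U^{n+1}$ admits the expansion, then $U^{n+1}$ is well-prepared and the scheme $\mathcal M^\delta_\Delta$ is asymptotic preserving (AP) in the sense defined in the context.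
   Context: **Continuous models.** Constants: $\nu,\lambda,\varepsilon>0$, $\gamma>1$, $g\in\mathbb R$, $\mathbf g=(0,g)$, $C_p>0$, squared Mach number $\delta=C_p^{-1}$. The pressure $C_p\rho^\gamma$ is split as $p_1(\rho)+p_2(\rho)$, $p_1(\rho)=C_{p,1}\rho^\gamma$, $p_2(\rho)=C_{p,2}\rho^\gamma$, with $C_{p,1}>0$, $C_{p,1}+C_{p,2}=C_p$ and $C_{p,2}\gg C_{p,1}$, so $C_{p,2}=(1-C_{p,1}\delta)/\delta$; no further condition is imposed on $C_{p,1}$ (in particular none on whether it depends on $\delta$). Write $p(\rho)=\rho^\gamma$. Let $\psi(c)=\frac14(c^2-1)^2$, $\psi'=\psi_1'+\psi_2'$ with $\psi_1'(c)=2c$, $\psi_2'(c)=c^3-3c$. On $\Omega=(0,1)^2$, with boundary conditions $\mathbf v=0$, $\nabla c\cdot\mathbf n=0$, $\nabla\mu\cdot\mathbf n=0$ on $\partial\Omega$ ($\mathbf n$ the outward unit normal), the model $\mathcal M^\delta$ is $$\rho_t+\operatorname{div}(\rho\mathbf v)=0,$$ $$(\rho\mathbf v)_t+\operatorname{div}(\rho\mathbf v\otimes\mathbf v)+\nabla(p_1+p_2)(\rho)=\rho\mathbf g+\operatorname{div}(\mathbb T_1+\mathbb T_2),$$ $$(\rho c)_t+\operatorname{div}(\rho c\mathbf v)=\Delta\mu,\qquad \mu=\psi'(c)-\tfrac{\varepsilon}{\rho}\Delta c,$$ with $\mathbb T_1=\nu(\nabla\mathbf v+\nabla\mathbf v^T)+\lambda(\operatorname{div}\mathbf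 v)\mathbb I$, $\mathbb T_2=\frac\varepsilon2|\nabla c|^2\mathbb I-\varepsilon\nabla c\otimes\nabla c$. The limit model $\mathcal M^0$ (constant density $\rho_0>0$, scalar pressure $p_{(1)}$, a Lagrange multiplier for incompressibility) is $$\operatorname{div}\mathbf v=0,\ \rho=\rho_0,\quad \mathbf v_t+\operatorname{div}(\mathbf v\otimes\mathbf v)+\nabla p_{(1)}=\mathbf g+\tfrac1{\rho_0}(\nu\Delta\mathbf v+\operatorname{div}\mathbb T_2(c)),\quad c_t+\operatorname{div}(\mathbf vc)=\tfrac1{\rho_0}\Delta\mu .$$ **Grid and difference matrices.** $h=1/M$, $x_i=(i-\frac12)h$, $y_j=(j-\frac12)h$. Unknowns: $\rho,c\in\mathbb R^{M\times M}$ at centers $(x_i,y_j)$; $v_1\in\mathbb R^{(M-1)\times M}$ at $(x_{i+1/2},y_j)$, $v_2\in\mathbb R^{M\times(M-1)}$ at $(x_i,y_{j+1/2})$, $x_{i+1/2}=ih$, $y_{j+1/2}=jh$. $*$ is the entrywise product. $D_M\in\mathbb R^{M\times(M-1)}$ has $(D_M)_{k,k}=1/h$, $(D_M)_{k+1,k}=-1/h$, other entries $0$. $D_M^\ast$ equals $D_M$ except that its $(1,1)$ entry is $2/h$ and its $(M,M-1)$ entry is $-2/h$. $D^c_M\in\mathbb R^{M\times M}$ is $\frac1{2h}$ times the matrix with first row $(-1,1,0,\dots)$, last row $(\dots,0,-1,1)$ and row $k$ ($1<k<M$) with $-1$ in column $k-1$ and $1$ in column $k+1$. $A_M\in\mathbb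 R^{(M-1)\times M}$ has entries $\frac12$ at $(k,k)$ and $(k,k+1)$. Put $\rho_{*,x}=A_M\rho$, $\rho_{*,y}=\rho A_M^T$. Discrete operators: $\nabla_hf=(-D_M^Tf,\,-fD_M)$; $\operatorname{div}_h(w_1,w_2)=D_Mw_1+w_2D_M^T$; for centered data $\Delta_h=\operatorname{div}_h\nabla_h$ (five-point Laplacian with homogeneous Neumann conditions); for velocities $\Delta_h\mathbf v=-\big(D_M^TD_Mv_1+v_1(D^\ast_{M+1})^TD_{M+1},\ v_2D_M^TD_M+D_{M+1}^TD^\ast_{M+1}v_2\big)$. State: $U=(\rho,\ \rho_{*,x}*v_1,\ \rho_{*,y}*v_2,\ \rho*c)$; $\rho$, $\mathbf v=(v_1,v_2)$, $c$ are recovered from $U$. All densities (of $U^n$, of stages, and their leading-order coefficients) are assumed positive, so that everything is well defined. **Convective operator $\mathcal C_2(U)$** (components 2,3,4): $$\mathcal C_2(U)_{2,i+\frac12,j}=-\tfrac1h(\hat F^{\rho v_1}_{i+1,j}-\hat F^{\rho v_1}_{i,j})-\tfrac1h(\hat G^{\rho v_1}_{i+\frac12,j+\frac12}-\hat G^{\rho v_1}_{i+\frac12,j-\frac12}),$$ $$\mathcal C_2(U)_{3,i,j+\frac12}=-\tfrac1h(\hat F^{\rho v_2}_{i+\frac12,j+\frac12}-\hat F^{\rho v_2}_{i-\frac12,j+\frac12})-\tfrac1h(\hat G^{\rho v_2}_{i,j+1}-\hat G^{\rho v_2}_{i,j}),$$ $$\mathcal C_2(U)_{4,i,j}=-\tfrac1h(\hat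 F^{c}_{i+\frac12,j}-\hat F^{c}_{i-\frac12,j})-\tfrac1h(\hat G^{c}_{i,j+\frac12}-\hat G^{c}_{i,j-\frac12}),$$ with Rusanov fluxes $$\hat F^{\rho v_1}_{i,j}=\tfrac12\big[(\rho v_1^2+p_1)^+_{i+\frac12,j}+(\rho v_1^2+p_1)^-_{i-\frac12,j}\big]-\tfrac12\lambda^{\rho v_1}_{i,j}\big[(\rho v_1)^+_{i+\frac12,j}-(\rho v_1)^-_{i-\frac12,j}\big],$$ $$\hat F^{\rho v_2}_{i+\frac12,j+\frac12}=\tfrac12\big[(\rho v_1v_2)^+_{i+1,j+\frac12}+(\rho v_1v_2)^-_{i,j+\frac12}\big]-\tfrac12\lambda^{\rho v_2}_{i+\frac12,j+\frac12}\big[(\rho v_2)^+_{i+1,j+\frac12}-(\rho v_2)^-_{i,j+\frac12}\big],$$ $$\hat F^{c}_{i+\frac12,j}=\tfrac12\big[(\rho cv_1)^+_{i+1,j}+(\rho cv_1)^-_{i,j}\big]-\tfrac12\lambda^{c}_{i+\frac12,j}\big[(\rho c)^+_{i+1,j}-(\rho c)^-_{i,j}\big],$$ and $\hat G$ obtained by exchanging the roles of $x,y$ and $v_1,v_2$. In the $x$-direction, at any (integer or half-integer) index $a$, $f^-_{a}=\mathcal W(f_{a-2},\dots,f_{a+2})$ and $f^+_{a}=\mathcal W(f_{a+2},\dots,f_{a-2})$, where $\mathcal W:\mathbb R^5\to\mathbb R$ is the fifth-order WENO (WENO5) reconstruction operator. Each viscosity $\lambda^{\cdot}$ in an $x$-flux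 is $\max\{|v_1^+|+s(\rho^+),|v_1^-|+s(\rho^-)\}$ at the two reconstructed states entering that flux, $s(\rho)=\sqrt{p_1'(\rho)}$; in $y$-fluxes $v_2$ replaces $v_1$. Further, $\lambda^{\rho}=\lambda^c$. In these fluxes, density on the dual grid and velocity at centers are obtained by the centered six-point transfer with coefficients $\frac1{256}(3,-25,150,150,-25,3)$; $v_{1,i,j+\frac12}$ is obtained by first averaging $v_{1,i+\frac12,j+\frac12}=\frac12(v_{1,i+\frac12,j+1}+v_{1,i+\frac12,j})$ and then applying the transfer in $x$ (analogously for $v_2$). Values outside $\Omega$ are given by even reflection of $\rho,c$ and odd reflection of $v_1,v_2$ across the walls; the normal velocity is zero on walls. **Other operators.** With $X=D^c_Mc$, $Y=c(D^c_M)^T$, $W=(D_M^TcA_M^T)*(A_McD_M)$: $$\mathcal L_2(c)_2=\varepsilon\big(-\tfrac12D_M^T(Y*Y)+\tfrac12D_M^T(X*X)-WD_M^T\big),\quad \mathcal L_2(c)_3=\varepsilon\big(-\tfrac12(X*X)D_M+\tfrac12(Y*Y)D_M-D_MW\big),$$ which discretize the two components of $\operatorname{div}\mathbb T_2(c)$. $$\mathcal L_4(\mathbf v)_2=-\big((2\nu+\lambda)D_M^TD_Mv_1+\nu v_1(D^\ast_{M+1})^TD_{M+1}+(\nu+\lambda)D_M^Tv_2D_M^T\big),$$ $$\mathcal L_4(\mathbf v)_3=-\big((2\nu+\lambda)v_2D_M^TD_M+\nu D_{M+1}^TD^\ast_{M+1}v_2+(\nu+\lambda)D_Mv_1D_M\big).$$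 $Q_h(c)=\operatorname{div}_h\big((A_M\psi_2''(c))*(-D_M^Tc),\ (\psi_2''(c)A_M^T)*(-cD_M)\big)$, discretizing $\Delta\psi_2'(c)$. **Scheme $\mathcal M^\delta_\Delta$.** Let $\tilde{\mathcal L}(\tilde U,U)$ have components (tilded quantities come from $\tilde U$, untilded from $U$; $\tilde\lambda^x\in\mathbb R^{(M-1)\times M}$ and $\tilde\lambda^y\in\mathbb R^{M\times(M-1)}$ are the viscosities $\lambda^\rho$ of the $x$- and $y$-fluxes evaluated at $\tilde U$) $$\tilde{\mathcal L}_{1}=-\operatorname{div}_h(\rho_{*,x}*v_1,\rho_{*,y}*v_2)-h\big[D_M(\tilde\lambda^x*(D_M^T\tilde\rho))+(\tilde\lambda^y*(\tilde\rho D_M))D_M^T\big],$$ $$\tilde{\mathcal L}_{2}=\mathcal C_2(\tilde U)_2+D_M^Tp_2(\rho)+\mathcal L_2(\tilde c)_2+\mathcal L_4(\mathbf v)_2,$$ $$\tilde{\mathcal L}_{3}=\mathcal C_2(\tilde U)_3+g\,\tilde\rho A_M^T+p_2(\rho)D_M+\mathcal L_2(\tilde c)_3+\mathcal L_4(\mathbf v)_3,$$ $$\tilde{\mathcal L}_{4}=\mathcal C_2(\tilde U)_4+2\Delta_hc+Q_h(\tilde c)-\varepsilon\Delta_h(\rho^{-1}*\Delta_hc)$$ (entrywise inverse). One step from $U^n$ is $$\tilde U^{(i)}=U^n+\Delta t\sum_{j<i}\tilde\alpha_{i,j}\tilde{\mathcal L}(\tilde U^{(j)},U^{(j)}),\quad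 U^{(i)}=U^n+\Delta t\sum_{j\le i}\alpha_{i,j}\tilde{\mathcal L}(\tilde U^{(j)},U^{(j)}),\quad U^{n+1}=U^n+\Delta t\sum_{j=1}^s\beta_j\tilde{\mathcal L}(\tilde U^{(j)},U^{(j)}),$$ $i=1,\dots,s$. Its stability condition is the CFL condition of the explicitly treated convective part, $\Delta t=\mathrm{CFL}^*\,h/cs$, with a constant $\mathrm{CFL}^*<1$ and $cs=\max\{|v_k^{(i)}|+\sqrt{p_1'(\rho^{(i)})}\}$ over stages $i$, velocity components $k=1,2$ and grid points; $C_{p,2}$ does not enter it. **Expansion.** A state admits the expansion if, as $\delta\to0$, $\rho=\rho_{(0)}+\delta\rho_{(1)}+\dots$, $\mathbf v=\mathbf v_{(0)}+\delta\mathbf v_{(1)}+\dots$, $c=c_{(0)}+\delta c_{(1)}+\dots$, $p=p_{(0)}+\delta p_{(1)}+\dots$, where by Taylor expansion around $\rho_{(0)}$, $p_{(0)}=p(\rho_{(0)})$, $p_{(1)}=p'(\rho_{(0)})\rho_{(1)}$, etc. A state is well-prepared if $\nabla_h\rho_{(0)}=0$ and $\operatorname{div}_h\mathbf v_{(0)}=0$. **Asymptotic preserving.** A scheme $\mathcal M^\delta_\Delta$ for $\mathcal M^\delta$ is AP if (i) its stability condition is independent of $\delta$, and (ii) in the limit $\delta\to0$, it converges to a consistent discretization $\mathcal M^0_\Delta$ of the limiting model $\mathcal M^0$. Here $\mathcal M^0_\Delta$ is the discretization of $\mathcal M^0$ by the same Runge-Kutta pair and the same spatial discretization. Explicitly,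 with $\rho_0=\rho^n_{(0)}$ (the constant leading-order density of all stages), with $\operatorname{div}_h(\mathbf v\otimes\mathbf v)$ and $\operatorname{div}_h(\mathbf vc)$ denoting the scheme's discretization of these convective terms at constant density, $\operatorname{div}_h\mathbb T_2(c)=(\mathcal L_2(c)_2,\mathcal L_2(c)_3)$, and stage pressures $\pi^{(j)}=p^{(j)}_{(1)}/\rho_0$, the leading-order coefficients satisfy, for $l=1,\dots,s$ (subscripts $(0)$ dropped), $$\operatorname{div}_h\mathbf v^{(l)}=0,\quad \tilde{\mathbf v}^{(l)}=\mathbf v^n+\Delta t\sum_{j<l}\tilde\alpha_{l,j}K^{(j)},\quad \mathbf v^{(l)}=\mathbf v^n+\Delta t\sum_{j\le l}\alpha_{l,j}K^{(j)},$$ $$K^{(j)}=\mathbf g-\operatorname{div}_h(\tilde{\mathbf v}^{(j)}\otimes\tilde{\mathbf v}^{(j)})+\tfrac1{\rho_0}\big[\operatorname{div}_h\mathbb T_2(\tilde c^{(j)})+\nu\Delta_h\mathbf v^{(j)}\big]-\nabla_h\pi^{(j)},$$ $$\tilde c^{(l)}=c^n+\Delta t\sum_{j<l}\tilde\alpha_{l,j}J^{(j)},\quad c^{(l)}=c^n+\Delta t\sum_{j\le l}\alpha_{l,j}J^{(j)},$$ $$J^{(j)}=-\operatorname{div}_h(\tilde{\mathbf v}^{(j)}\tilde c^{(j)})+\tfrac1{\rho_0}\big[2\Delta_hc^{(j)}+Q_h(\tilde c^{(j)})-\tfrac{\varepsilon}{\rho_0}\Delta_h\Delta_hc^{(j)}\big],$$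 and $\mathbf v^{n+1}=\mathbf v^{(s)}$, $c^{n+1}=c^{(s)}$, $\rho^{n+1}=\rho_0$. *)

theory Defs
  imports
    Complex_Main
    "HOL-Library.Landau_Symbols"
    "Jordan_Normal_Form.Matrix"
begin

text \<open>
  All matrices are \<^typ>\<open>real mat\<close>, so entry \<open>(i, j)\<close> of the usual one-based notation is
  \<open>A $$ (i - 1, j - 1)\<close>. Grid indices of the extended grid functions below are integers and keep
  the one-based numbering; the half-integer index \<open>i + 1/2\<close> is represented by \<open>i\<close>.

  \<open>cells\<close> is the number \<open>M\<close> of cells per direction, \<open>delta\<close> the squared Mach number, \<open>cp1\<close> the
  constant of the explicit pressure, and \<open>weno_eps\<close> the positive regularization constant in the
  denominators of the WENO weights.
\<close>

record params =
  cells :: nat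
  nu :: real
  lame :: real
  epsi :: real
  gam :: real
  grav :: real
  weno_eps :: real
  cp1 :: real
  delta :: real

definition valid_params :: "params \<Rightarrow> bool" where
  "valid_params P \<longleftrightarrow> 2 \<le> cells P \<and> 0 < nu P \<and> 0 < lame P \<and> 0 < epsi P \<and> 1 < gam P \<and> 0 < weno_eps P"

definition mesh :: "params \<Rightarrow> real" where
  "mesh P = 1 / real (cells P)"

definition cp2 :: "params \<Rightarrow> real" where
  "cp2 P = (1 - cp1 P * delta P) / delta P"

definition pres :: "params \<Rightarrow> real \<Rightarrow> real" where
  "pres P r = r powr gam P"

definition pres_deriv :: "params \<Rightarrow> real \<Rightarrow> real" where
  "pres_deriv P r = gam P * r powr (gam P - 1)"

definition pres1 :: "params \<Rightarrow> real \<Rightarrow> real" where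
  "pres1 P r = cp1 P * pres P r"

definition pres2 :: "params \<Rightarrow> real \<Rightarrow> real" where
  "pres2 P r = cp2 P * pres P r"

definition sound :: "params \<Rightarrow> real \<Rightarrow> real" where
  "sound P r = sqrt (cp1 P * pres_deriv P r)"

text \<open>
  A state is given by its primitive variables; the evolved quantities \<open>U\<close> are the components of
  \<open>conserved\<close> below. For positive density the two descriptions determine each other.
\<close>

record state =
  dens :: "real mat"
  velx :: "real mat"
  vely :: "real mat"
  conc :: "real mat"

definition valid_state :: "params \<Rightarrow> state \<Rightarrow> bool" where
  "valid_state P S \<longleftrightarrow>
     dens S \<in> carrier_mat (cells P) (cells P) \<and>
     velx S \<in> carrier_mat (cells P - 1) (cells P) \<and>
     vely S \<in> carrier_mat (cells P) (cells P - 1) \<and>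
     conc S \<in> carrier_mat (cells P) (cells P)"

definition pos_dens :: "params \<Rightarrow> state \<Rightarrow> bool" where
  "pos_dens P S \<longleftrightarrow> (\<forall>i < cells P. \<forall>j < cells P. 0 < dens S $$ (i, j))"

definition swap_state :: "state \<Rightarrow> state" where
  "swap_state S = \<lparr>dens = transpose_mat (dens S), velx = transpose_mat (vely S),
     vely = transpose_mat (velx S), conc = transpose_mat (conc S)\<rparr>"

definition hprod :: "real mat \<Rightarrow> real mat \<Rightarrow> real mat" (infixl "\<star>" 70) where
  "A \<star> B = mat (dim_row A) (dim_col A) (\<lambda>ij. A $$ ij * B $$ ij)"

definition const_mat :: "nat \<Rightarrow> nat \<Rightarrow> real \<Rightarrow> real mat" where
  "const_mat r c x = mat r c (\<lambda>_. x)"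

text \<open>The mesh size is that of \<open>P\<close> also when the dimension \<open>n\<close> is not \<open>cells P\<close>.\<close>

definition Dmat :: "params \<Rightarrow> nat \<Rightarrow> real mat" where
  "Dmat P n = mat n (n - 1) (\<lambda>(i, j).
     if i = j then 1 / mesh P else if i = j + 1 then - 1 / mesh P else 0)"

definition Dstar :: "params \<Rightarrow> nat \<Rightarrow> real mat" where
  "Dstar P n = mat n (n - 1) (\<lambda>(i, j).
     if i = 0 \<and> j = 0 then 2 / mesh P
     else if i + 1 = n \<and> j + 2 = n then - 2 / mesh P
     else Dmat P n $$ (i, j))"

definition Dcen :: "params \<Rightarrow> nat \<Rightarrow> real mat" where
  "Dcen P n = mat n n (\<lambda>(i, j).
     (if j = i + 1 \<or> (i + 1 = n \<and> j + 1 = n) then 1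
      else if i = j + 1 \<or> (i = 0 \<and> j = 0) then - 1
      else 0) / (2 * mesh P))"

definition Amat :: "nat \<Rightarrow> real mat" where
  "Amat n = mat (n - 1) n (\<lambda>(i, j). if j = i \<or> j = i + 1 then 1 / 2 else 0)"

abbreviation DM :: "params \<Rightarrow> real mat" where "DM P \<equiv> Dmat P (cells P)"
abbreviation DMT :: "params \<Rightarrow> real mat" where "DMT P \<equiv> transpose_mat (DM P)"
abbreviation DM1 :: "params \<Rightarrow> real mat" where "DM1 P \<equiv> Dmat P (cells P + 1)"
abbreviation DS1 :: "params \<Rightarrow> real mat" where "DS1 P \<equiv> Dstar P (cells P + 1)"
abbreviation AM :: "params \<Rightarrow> real mat" where "AM P \<equiv> Amat (cells P)"
abbreviation AMT :: "params \<Rightarrow> real mat" where "AMT P \<equiv> transpose_mat (AM P)"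

definition dens_x :: "params \<Rightarrow> state \<Rightarrow> real mat" where
  "dens_x P S = AM P * dens S"

definition dens_y :: "params \<Rightarrow> state \<Rightarrow> real mat" where
  "dens_y P S = dens S * AMT P"

definition grad_x :: "params \<Rightarrow> real mat \<Rightarrow> real mat" where
  "grad_x P f = - (DMT P * f)"

definition grad_y :: "params \<Rightarrow> real mat \<Rightarrow> real mat" where
  "grad_y P f = - (f * DM P)"

definition divh :: "params \<Rightarrow> real mat \<Rightarrow> real mat \<Rightarrow> real mat" where
  "divh P w1 w2 = DM P * w1 + w2 * DMT P"

definition laph :: "params \<Rightarrow> real mat \<Rightarrow> real mat" where
  "laph P f = divh P (grad_x P f) (grad_y P f)"

definition lap_velx :: "params \<Rightarrow> state \<Rightarrow> real mat" where
  "lap_velx P S = - (DMT P * DM P * velx S + velx S * transpose_mat (DS1 P) * DM1 P)"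

definition lap_vely :: "params \<Rightarrow> state \<Rightarrow> real mat" where
  "lap_vely P S = - (vely S * DMT P * DM P + transpose_mat (DM1 P) * DS1 P * vely S)"

definition well_prepared :: "params \<Rightarrow> state \<Rightarrow> bool" where
  "well_prepared P S \<longleftrightarrow>
     grad_x P (dens S) = 0\<^sub>m (cells P - 1) (cells P) \<and>
     grad_y P (dens S) = 0\<^sub>m (cells P) (cells P - 1) \<and>
     divh P (velx S) (vely S) = 0\<^sub>m (cells P) (cells P)"

text \<open>Jiang--Shu weights and smoothness indicators.\<close>

definition weno5 :: "params \<Rightarrow> real \<Rightarrow> real \<Rightarrow> real \<Rightarrow> real \<Rightarrow> real \<Rightarrow> real" where
  "weno5 P a b c d e =
    (let q0 = (2 * a - 7 * b + 11 * c) / 6;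
         q1 = (- b + 5 * c + 2 * d) / 6;
         q2 = (2 * c + 5 * d - e) / 6;
         b0 = 13 / 12 * (a - 2 * b + c)\<^sup>2 + 1 / 4 * (a - 4 * b + 3 * c)\<^sup>2;
         b1 = 13 / 12 * (b - 2 * c + d)\<^sup>2 + 1 / 4 * (b - d)\<^sup>2;
         b2 = 13 / 12 * (c - 2 * d + e)\<^sup>2 + 1 / 4 * (3 * c - 4 * d + e)\<^sup>2;
         w0 = (1 / 10) / (weno_eps P + b0)\<^sup>2;
         w1 = (6 / 10) / (weno_eps P + b1)\<^sup>2;
         w2 = (3 / 10) / (weno_eps P + b2)\<^sup>2
     in (w0 * q0 + w1 * q1 + w2 * q2) / (w0 + w1 + w2))"

definition rec_minus :: "params \<Rightarrow> (int \<Rightarrow> real) \<Rightarrow> int \<Rightarrow> real" where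
  "rec_minus P f a = weno5 P (f (a - 2)) (f (a - 1)) (f a) (f (a + 1)) (f (a + 2))"

definition rec_plus :: "params \<Rightarrow> (int \<Rightarrow> real) \<Rightarrow> int \<Rightarrow> real" where
  "rec_plus P f a = weno5 P (f (a + 2)) (f (a + 1)) (f a) (f (a - 1)) (f (a - 2))"

text \<open>Value half way between the positions \<open>a\<close> and \<open>a + 1\<close>.\<close>

definition transfer :: "(int \<Rightarrow> real) \<Rightarrow> int \<Rightarrow> real" where
  "transfer f a =
     (3 * f (a - 2) - 25 * f (a - 1) + 150 * f a + 150 * f (a + 1) - 25 * f (a + 2) + 3 * f (a + 3)) / 256"

text \<open>
  The walls are at the positions \<open>1/2\<close> and \<open>M + 1/2\<close>. Reflection across both of them, repeated if
  necessary, gives a \<open>2 M\<close>-periodic extension, which is defined for all integers and every \<open>M\<close>.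
  A list of cell values \<open>f 0, \<dots>, f (M - 1)\<close> sits at the positions \<open>1, \<dots>, M\<close>; a list of face
  values \<open>f 0, \<dots>, f (M - 2)\<close> sits at \<open>3/2, \<dots>, M - 1/2\<close>, that is at the integer codes
  \<open>1, \<dots>, M - 1\<close>, with the walls at the codes \<open>0\<close> and \<open>M\<close>.
\<close>

definition cell_even :: "nat \<Rightarrow> (nat \<Rightarrow> real) \<Rightarrow> int \<Rightarrow> real" where
  "cell_even m f i = (let k = (i - 1) mod (2 * int m) in
     if k < int m then f (nat k) else f (nat (2 * int m - 1 - k)))"

definition cell_odd :: "nat \<Rightarrow> (nat \<Rightarrow> real) \<Rightarrow> int \<Rightarrow> real" where
  "cell_odd m f i = (let k = (i - 1) mod (2 * int m) in
     if k < int m then f (nat k) else - f (nat (2 * int m - 1 - k)))"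

definition face_odd :: "nat \<Rightarrow> (nat \<Rightarrow> real) \<Rightarrow> int \<Rightarrow> real" where
  "face_odd m f i = (let k = i mod (2 * int m) in
     if k = 0 \<or> k = int m then 0
     else if k < int m then f (nat (k - 1)) else - f (nat (2 * int m - k - 1)))"

definition rho_at :: "params \<Rightarrow> state \<Rightarrow> int \<Rightarrow> int \<Rightarrow> real" where
  "rho_at P S i j = cell_even (cells P) (\<lambda>a. cell_even (cells P) (\<lambda>b. dens S $$ (a, b)) j) i"

definition c_at :: "params \<Rightarrow> state \<Rightarrow> int \<Rightarrow> int \<Rightarrow> real" where
  "c_at P S i j = cell_even (cells P) (\<lambda>a. cell_even (cells P) (\<lambda>b. conc S $$ (a, b)) j) i"

text \<open>\<open>v1_at P S i j\<close> is \<open>v\<^sub>1\<close> at \<open>(i + 1/2, j)\<close> and \<open>v2_at P S i j\<close> is \<open>v\<^sub>2\<close> at \<open>(i, j + 1/2)\<close>.\<close>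

definition v1_at :: "params \<Rightarrow> state \<Rightarrow> int \<Rightarrow> int \<Rightarrow> real" where
  "v1_at P S i j = face_odd (cells P) (\<lambda>a. cell_odd (cells P) (\<lambda>b. velx S $$ (a, b)) j) i"

definition v2_at :: "params \<Rightarrow> state \<Rightarrow> int \<Rightarrow> int \<Rightarrow> real" where
  "v2_at P S i j = cell_odd (cells P) (\<lambda>a. face_odd (cells P) (\<lambda>b. vely S $$ (a, b)) j) i"

text \<open>
  Transferred quantities: density at \<open>(i + 1/2, j)\<close> and at \<open>(i, j + 1/2)\<close>, \<open>v\<^sub>1\<close> at \<open>(i, j)\<close> and
  at \<open>(i, j + 1/2)\<close>. Position \<open>i\<close> lies between the faces with codes \<open>i - 1\<close> and \<open>i\<close>.
\<close>

definition rho_fx :: "params \<Rightarrow> state \<Rightarrow> int \<Rightarrow> int \<Rightarrow> real" where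
  "rho_fx P S i j = transfer (\<lambda>k. rho_at P S k j) i"

definition rho_fy :: "params \<Rightarrow> state \<Rightarrow> int \<Rightarrow> int \<Rightarrow> real" where
  "rho_fy P S i j = transfer (\<lambda>k. rho_at P S i k) j"

definition v1_cen :: "params \<Rightarrow> state \<Rightarrow> int \<Rightarrow> int \<Rightarrow> real" where
  "v1_cen P S i j = transfer (\<lambda>k. v1_at P S k j) (i - 1)"

definition v1_fy :: "params \<Rightarrow> state \<Rightarrow> int \<Rightarrow> int \<Rightarrow> real" where
  "v1_fy P S i j = transfer (\<lambda>k. (v1_at P S k (j + 1) + v1_at P S k j) / 2) (i - 1)"

text \<open>
  Rusanov flux and its viscosity between the positions \<open>a\<close> and \<open>a + 1\<close> of one grid line, for the
  physical flux \<open>q\<close>, the transported quantity \<open>m\<close>, the transporting velocity \<open>u\<close> and density \<open>r\<close>.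
\<close>

definition viscosity :: "params \<Rightarrow> (int \<Rightarrow> real) \<Rightarrow> (int \<Rightarrow> real) \<Rightarrow> int \<Rightarrow> real" where
  "viscosity P u r a =
     max (\<bar>rec_plus P u (a + 1)\<bar> + sound P (rec_plus P r (a + 1)))
         (\<bar>rec_minus P u a\<bar> + sound P (rec_minus P r a))"

definition rusanov ::
  "params \<Rightarrow> (int \<Rightarrow> real) \<Rightarrow> (int \<Rightarrow> real) \<Rightarrow> (int \<Rightarrow> real) \<Rightarrow> (int \<Rightarrow> real) \<Rightarrow> int \<Rightarrow> real" where
  "rusanov P q m u r a =
     (rec_plus P q (a + 1) + rec_minus P q a) / 2
     - viscosity P u r a * (rec_plus P m (a + 1) - rec_minus P m a) / 2"

text \<open>Position \<open>(i, j)\<close>; it lies between the faces with codes \<open>i - 1\<close> and \<open>i\<close>.\<close>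

definition F_mx :: "params \<Rightarrow> state \<Rightarrow> int \<Rightarrow> int \<Rightarrow> real" where
  "F_mx P S i j = rusanov P
     (\<lambda>k. rho_fx P S k j * (v1_at P S k j)\<^sup>2 + pres1 P (rho_fx P S k j))
     (\<lambda>k. rho_fx P S k j * v1_at P S k j)
     (\<lambda>k. v1_at P S k j) (\<lambda>k. rho_fx P S k j) (i - 1)"

text \<open>Position \<open>(i + 1/2, j + 1/2)\<close>.\<close>

definition F_my :: "params \<Rightarrow> state \<Rightarrow> int \<Rightarrow> int \<Rightarrow> real" where
  "F_my P S i j = rusanov P
     (\<lambda>k. rho_fy P S k j * v1_fy P S k j * v2_at P S k j)
     (\<lambda>k. rho_fy P S k j * v2_at P S k j)
     (\<lambda>k. v1_fy P S k j) (\<lambda>k. rho_fy P S k j) i"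

text \<open>Position \<open>(i + 1/2, j)\<close>.\<close>

definition F_c :: "params \<Rightarrow> state \<Rightarrow> int \<Rightarrow> int \<Rightarrow> real" where
  "F_c P S i j = rusanov P
     (\<lambda>k. rho_at P S k j * c_at P S k j * v1_cen P S k j)
     (\<lambda>k. rho_at P S k j * c_at P S k j)
     (\<lambda>k. v1_cen P S k j) (\<lambda>k. rho_at P S k j) i"

text \<open>
  Fluxes in the second direction, at \<open>(i + 1/2, j + 1/2)\<close>, \<open>(i, j)\<close> and \<open>(i, j + 1/2)\<close>.
\<close>

definition G_mx :: "params \<Rightarrow> state \<Rightarrow> int \<Rightarrow> int \<Rightarrow> real" where
  "G_mx P S i j = F_my P (swap_state S) j i"

definition G_my :: "params \<Rightarrow> state \<Rightarrow> int \<Rightarrow> int \<Rightarrow> real" where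
  "G_my P S i j = F_mx P (swap_state S) j i"

definition G_c :: "params \<Rightarrow> state \<Rightarrow> int \<Rightarrow> int \<Rightarrow> real" where
  "G_c P S i j = F_c P (swap_state S) j i"

definition conv_mx :: "params \<Rightarrow> state \<Rightarrow> real mat" where
  "conv_mx P S = mat (cells P - 1) (cells P) (\<lambda>(a, b). let i = int a + 1; j = int b + 1 in
     - (F_mx P S (i + 1) j - F_mx P S i j) / mesh P
     - (G_mx P S i j - G_mx P S i (j - 1)) / mesh P)"

definition conv_my :: "params \<Rightarrow> state \<Rightarrow> real mat" where
  "conv_my P S = mat (cells P) (cells P - 1) (\<lambda>(a, b). let i = int a + 1; j = int b + 1 in
     - (F_my P S i j - F_my P S (i - 1) j) / mesh P
     - (G_my P S i (j + 1) - G_my P S i j) / mesh P)"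

definition conv_c :: "params \<Rightarrow> state \<Rightarrow> real mat" where
  "conv_c P S = mat (cells P) (cells P) (\<lambda>(a, b). let i = int a + 1; j = int b + 1 in
     - (F_c P S i j - F_c P S (i - 1) j) / mesh P
     - (G_c P S i j - G_c P S i (j - 1)) / mesh P)"

text \<open>The viscosity of the mass equation, which equals the one in \<open>F_c\<close> and \<open>G_c\<close>.\<close>

definition visc_x :: "params \<Rightarrow> state \<Rightarrow> real mat" where
  "visc_x P S = mat (cells P - 1) (cells P) (\<lambda>(a, b). let i = int a + 1; j = int b + 1 in
     viscosity P (\<lambda>k. v1_cen P S k j) (\<lambda>k. rho_at P S k j) i)"

definition visc_y :: "params \<Rightarrow> state \<Rightarrow> real mat" where
  "visc_y P S = transpose_mat (visc_x P (swap_state S))"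

definition capX :: "params \<Rightarrow> real mat \<Rightarrow> real mat" where
  "capX P c = Dcen P (cells P) * c"

definition capY :: "params \<Rightarrow> real mat \<Rightarrow> real mat" where
  "capY P c = c * transpose_mat (Dcen P (cells P))"

definition capW :: "params \<Rightarrow> real mat \<Rightarrow> real mat" where
  "capW P c = (DMT P * c * AMT P) \<star> (AM P * c * DM P)"

definition cap_mx :: "params \<Rightarrow> real mat \<Rightarrow> real mat" where
  "cap_mx P c = epsi P \<cdot>\<^sub>m
     ((- (1 / 2)) \<cdot>\<^sub>m (DMT P * (capY P c \<star> capY P c))
      + (1 / 2) \<cdot>\<^sub>m (DMT P * (capX P c \<star> capX P c))
      - capW P c * DMT P)"

definition cap_my :: "params \<Rightarrow> real mat \<Rightarrow> real mat" where
  "cap_my P c = epsi P \<cdot>\<^sub>m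
     ((- (1 / 2)) \<cdot>\<^sub>m ((capX P c \<star> capX P c) * DM P)
      + (1 / 2) \<cdot>\<^sub>m ((capY P c \<star> capY P c) * DM P)
      - DM P * capW P c)"

definition visc_mx :: "params \<Rightarrow> state \<Rightarrow> real mat" where
  "visc_mx P S = -
     ((2 * nu P + lame P) \<cdot>\<^sub>m (DMT P * DM P * velx S)
      + nu P \<cdot>\<^sub>m (velx S * transpose_mat (DS1 P) * DM1 P)
      + (nu P + lame P) \<cdot>\<^sub>m (DMT P * vely S * DMT P))"

definition visc_my :: "params \<Rightarrow> state \<Rightarrow> real mat" where
  "visc_my P S = -
     ((2 * nu P + lame P) \<cdot>\<^sub>m (vely S * DMT P * DM P)
      + nu P \<cdot>\<^sub>m (transpose_mat (DM1 P) * DS1 P * vely S)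
      + (nu P + lame P) \<cdot>\<^sub>m (DM P * velx S * DM P))"

text \<open>The second derivative of \<open>\<psi>\<^sub>2\<close>, where \<open>\<psi>\<^sub>2' c = c ^ 3 - 3 * c\<close>.\<close>

definition psi2'' :: "real \<Rightarrow> real" where
  "psi2'' c = 3 * c\<^sup>2 - 3"

definition Qh :: "params \<Rightarrow> real mat \<Rightarrow> real mat" where
  "Qh P c = divh P
     ((AM P * map_mat psi2'' c) \<star> grad_x P c)
     ((map_mat psi2'' c * AMT P) \<star> grad_y P c)"

datatype component = Mass | MomX | MomY | Conc

fun conserved :: "params \<Rightarrow> state \<Rightarrow> component \<Rightarrow> real mat" where
  "conserved P S Mass = dens S"
| "conserved P S MomX = dens_x P S \<star> velx S"
| "conserved P S MomY = dens_y P S \<star> vely S"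
| "conserved P S Conc = dens S \<star> conc S"

text \<open>\<open>rhs P T S\<close>: the state \<open>T\<close> enters explicitly, the state \<open>S\<close> implicitly.\<close>

fun rhs :: "params \<Rightarrow> state \<Rightarrow> state \<Rightarrow> component \<Rightarrow> real mat" where
  "rhs P T S Mass =
     - divh P (dens_x P S \<star> velx S) (dens_y P S \<star> vely S)
     - mesh P \<cdot>\<^sub>m (DM P * (visc_x P T \<star> (DMT P * dens T))
                   + (visc_y P T \<star> (dens T * DM P)) * DMT P)"
| "rhs P T S MomX =
     conv_mx P T + DMT P * map_mat (pres2 P) (dens S) + cap_mx P (conc T) + visc_mx P S"
| "rhs P T S MomY =
     conv_my P T + grav P \<cdot>\<^sub>m (dens T * AMT P) + map_mat (pres2 P) (dens S) * DM P
     + cap_my P (conc T) + visc_my P S"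
| "rhs P T S Conc =
     conv_c P T + 2 \<cdot>\<^sub>m laph P (conc S) + Qh P (conc T)
     - epsi P \<cdot>\<^sub>m laph P (map_mat inverse (dens S) \<star> laph P (conc S))"

text \<open>\<open>rk_comb X \<tau> w J L\<close> is \<open>X + \<tau> * (\<Sum>j\<in>J. w j * L j)\<close>.\<close>

definition rk_comb ::
  "real mat \<Rightarrow> real \<Rightarrow> (nat \<Rightarrow> real) \<Rightarrow> nat set \<Rightarrow> (nat \<Rightarrow> real mat) \<Rightarrow> real mat" where
  "rk_comb X \<tau> w J L =
     mat (dim_row X) (dim_col X) (\<lambda>ij. X $$ ij + \<tau> * (\<Sum>j\<in>J. w j * L j $$ ij))"

text \<open>
  Stages are indexed by \<open>1, \<dots>, s\<close>; \<open>aE, bE\<close> are the coefficients of the explicit and \<open>aI, bI\<close> those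
  of the implicit method. Both methods have the same weights, so the update below only uses \<open>bI\<close>.
\<close>

definition imex_pair ::
  "nat \<Rightarrow> (nat \<Rightarrow> nat \<Rightarrow> real) \<Rightarrow> (nat \<Rightarrow> nat \<Rightarrow> real) \<Rightarrow> (nat \<Rightarrow> real) \<Rightarrow> (nat \<Rightarrow> real) \<Rightarrow> bool" where
  "imex_pair s aE aI bE bI \<longleftrightarrow> 1 \<le> s \<and>
     (\<forall>i\<in>{1..s}. \<forall>j\<in>{1..s}. i \<le> j \<longrightarrow> aE i j = 0) \<and>
     (\<forall>i\<in>{1..s}. \<forall>j\<in>{1..s}. i < j \<longrightarrow> aI i j = 0) \<and>
     (\<forall>i\<in>{1..s}. aI i i \<noteq> 0) \<and>
     (\<forall>j\<in>{1..s}. bE j = bI j)"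

definition stiffly_accurate :: "nat \<Rightarrow> (nat \<Rightarrow> nat \<Rightarrow> real) \<Rightarrow> (nat \<Rightarrow> real) \<Rightarrow> bool" where
  "stiffly_accurate s aI bI \<longleftrightarrow> (\<forall>j\<in>{1..s}. aI s j = bI j)"

definition imex_stages ::
  "params \<Rightarrow> nat \<Rightarrow> (nat \<Rightarrow> nat \<Rightarrow> real) \<Rightarrow> (nat \<Rightarrow> nat \<Rightarrow> real) \<Rightarrow> real \<Rightarrow>
   state \<Rightarrow> (nat \<Rightarrow> state) \<Rightarrow> (nat \<Rightarrow> state) \<Rightarrow> bool" where
  "imex_stages P s aE aI \<tau> Unow Ut U \<longleftrightarrow>
     (\<forall>i\<in>{1..s}. \<forall>k.
        conserved P (Ut i) k =
          rk_comb (conserved P Unow k) \<tau> (aE i) {1..<i} (\<lambda>j. rhs P (Ut j) (U j) k) \<and>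
        conserved P (U i) k =
          rk_comb (conserved P Unow k) \<tau> (aI i) {1..i} (\<lambda>j. rhs P (Ut j) (U j) k))"

definition imex_update ::
  "params \<Rightarrow> nat \<Rightarrow> (nat \<Rightarrow> real) \<Rightarrow> real \<Rightarrow>
   state \<Rightarrow> (nat \<Rightarrow> state) \<Rightarrow> (nat \<Rightarrow> state) \<Rightarrow> state \<Rightarrow> bool" where
  "imex_update P s bI \<tau> Unow Ut U Unew \<longleftrightarrow>
     (\<forall>k. conserved P Unew k =
        rk_comb (conserved P Unow k) \<tau> bI {1..s} (\<lambda>j. rhs P (Ut j) (U j) k))"

text \<open>
  The characteristic speed of the stability condition; the density at a velocity point is the
  average of the two neighbouring cells.
\<close>

definition char_speed :: "params \<Rightarrow> nat \<Rightarrow> (nat \<Rightarrow> state) \<Rightarrow> real" where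
  "char_speed P s U = Max
     ({\<bar>velx (U l) $$ (i, j)\<bar> + sound P (dens_x P (U l) $$ (i, j)) | l i j.
         l \<in> {1..s} \<and> i < cells P - 1 \<and> j < cells P} \<union>
      {\<bar>vely (U l) $$ (i, j)\<bar> + sound P (dens_y P (U l) $$ (i, j)) | l i j.
         l \<in> {1..s} \<and> i < cells P \<and> j < cells P - 1})"

definition stability_condition :: "params \<Rightarrow> nat \<Rightarrow> real \<Rightarrow> real \<Rightarrow> (nat \<Rightarrow> state) \<Rightarrow> bool" where
  "stability_condition P s CFL \<tau> U \<longleftrightarrow> \<tau> = CFL * mesh P / char_speed P s U"

text \<open>
  Only the first two terms are required, with remainder \<open>o(\<delta>)\<close>; this is implied by an expansion
  to any higher order.
\<close>

definition expands :: "nat \<Rightarrow> nat \<Rightarrow> (real \<Rightarrow> real mat) \<Rightarrow> real mat \<Rightarrow> real mat \<Rightarrow> bool" where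
  "expands r c A A0 A1 \<longleftrightarrow> A0 \<in> carrier_mat r c \<and> A1 \<in> carrier_mat r c \<and>
     (\<forall>i<r. \<forall>j<c.
        (\<lambda>\<delta>. A \<delta> $$ (i, j) - (A0 $$ (i, j) + \<delta> * A1 $$ (i, j))) \<in> o[at_right 0](\<lambda>\<delta>. \<delta>))"

definition pres_first_order :: "params \<Rightarrow> state \<Rightarrow> state \<Rightarrow> real mat" where
  "pres_first_order P U0 U1 = map_mat (pres_deriv P) (dens U0) \<star> dens U1"

definition admits_expansion :: "params \<Rightarrow> (real \<Rightarrow> state) \<Rightarrow> state \<Rightarrow> state \<Rightarrow> bool" where
  "admits_expansion P U U0 U1 \<longleftrightarrow>
     expands (cells P) (cells P) (\<lambda>\<delta>. dens (U \<delta>)) (dens U0) (dens U1) \<and>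
     expands (cells P - 1) (cells P) (\<lambda>\<delta>. velx (U \<delta>)) (velx U0) (velx U1) \<and>
     expands (cells P) (cells P - 1) (\<lambda>\<delta>. vely (U \<delta>)) (vely U0) (vely U1) \<and>
     expands (cells P) (cells P) (\<lambda>\<delta>. conc (U \<delta>)) (conc U0) (conc U1) \<and>
     expands (cells P) (cells P) (\<lambda>\<delta>. map_mat (pres P) (dens (U \<delta>)))
       (map_mat (pres P) (dens U0)) (pres_first_order P U0 U1)"

definition at_mach :: "params \<Rightarrow> (real \<Rightarrow> real) \<Rightarrow> real \<Rightarrow> params" where
  "at_mach P C \<delta> = P\<lparr>cp1 := C \<delta>, delta := \<delta>\<rparr>"

text \<open>
  Convective terms of the scheme at constant density \<open>r0\<close>: the operator \<open>\<C>\<^sub>2\<close> discretizes minus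
  the divergence of the fluxes multiplied by the density.
\<close>

definition at_density :: "params \<Rightarrow> real \<Rightarrow> state \<Rightarrow> state" where
  "at_density P r0 S = S\<lparr>dens := const_mat (cells P) (cells P) r0\<rparr>"

definition div_vv_x :: "params \<Rightarrow> real \<Rightarrow> state \<Rightarrow> real mat" where
  "div_vv_x P r0 S = (- 1 / r0) \<cdot>\<^sub>m conv_mx P (at_density P r0 S)"

definition div_vv_y :: "params \<Rightarrow> real \<Rightarrow> state \<Rightarrow> real mat" where
  "div_vv_y P r0 S = (- 1 / r0) \<cdot>\<^sub>m conv_my P (at_density P r0 S)"

definition div_vc :: "params \<Rightarrow> real \<Rightarrow> state \<Rightarrow> real mat" where
  "div_vc P r0 S = (- 1 / r0) \<cdot>\<^sub>m conv_c P (at_density P r0 S)"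

definition limit_Kx :: "params \<Rightarrow> real \<Rightarrow> state \<Rightarrow> state \<Rightarrow> real mat \<Rightarrow> real mat" where
  "limit_Kx P r0 T S q =
     - div_vv_x P r0 T
     + (1 / r0) \<cdot>\<^sub>m (cap_mx P (conc T) + nu P \<cdot>\<^sub>m lap_velx P S) - grad_x P q"

definition limit_Ky :: "params \<Rightarrow> real \<Rightarrow> state \<Rightarrow> state \<Rightarrow> real mat \<Rightarrow> real mat" where
  "limit_Ky P r0 T S q =
     const_mat (cells P) (cells P - 1) (grav P) - div_vv_y P r0 T
     + (1 / r0) \<cdot>\<^sub>m (cap_my P (conc T) + nu P \<cdot>\<^sub>m lap_vely P S) - grad_y P q"

definition limit_J :: "params \<Rightarrow> real \<Rightarrow> state \<Rightarrow> state \<Rightarrow> real mat" where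
  "limit_J P r0 T S =
     - div_vc P r0 T
     + (1 / r0) \<cdot>\<^sub>m (2 \<cdot>\<^sub>m laph P (conc S) + Qh P (conc T)
         - (epsi P / r0) \<cdot>\<^sub>m laph P (laph P (conc S)))"

text \<open>
  One step of the scheme for the incompressible model with density \<open>r0\<close>, step size \<open>\<tau>\<close> and stage
  pressures \<open>q\<close>. Neither \<open>delta P\<close> nor \<open>cp2 P\<close> occurs; \<open>cp1 P\<close> enters through the numerical
  viscosity of the convective terms.
\<close>

definition limit_scheme ::
  "params \<Rightarrow> nat \<Rightarrow> (nat \<Rightarrow> nat \<Rightarrow> real) \<Rightarrow> (nat \<Rightarrow> nat \<Rightarrow> real) \<Rightarrow> real \<Rightarrow> real \<Rightarrow>
   state \<Rightarrow> (nat \<Rightarrow> state) \<Rightarrow> (nat \<Rightarrow> state) \<Rightarrow> (nat \<Rightarrow> real mat) \<Rightarrow> state \<Rightarrow> bool" where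
  "limit_scheme P s aE aI \<tau> r0 Unow Ut U q Unew \<longleftrightarrow>
     (let R = const_mat (cells P) (cells P) r0;
          Kx = (\<lambda>j. limit_Kx P r0 (Ut j) (U j) (q j));
          Ky = (\<lambda>j. limit_Ky P r0 (Ut j) (U j) (q j));
          J = (\<lambda>j. limit_J P r0 (Ut j) (U j))
      in dens Unow = R \<and>
         (\<forall>l\<in>{1..s}.
            dens (Ut l) = R \<and> dens (U l) = R \<and>
            divh P (velx (U l)) (vely (U l)) = 0\<^sub>m (cells P) (cells P) \<and>
            velx (Ut l) = rk_comb (velx Unow) \<tau> (aE l) {1..<l} Kx \<and>
            vely (Ut l) = rk_comb (vely Unow) \<tau> (aE l) {1..<l} Ky \<and>
            conc (Ut l) = rk_comb (conc Unow) \<tau> (aE l) {1..<l} J \<and>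
            velx (U l) = rk_comb (velx Unow) \<tau> (aI l) {1..l} Kx \<and>
            vely (U l) = rk_comb (vely Unow) \<tau> (aI l) {1..l} Ky \<and>
            conc (U l) = rk_comb (conc Unow) \<tau> (aI l) {1..l} J) \<and>
         dens Unew = R \<and> velx Unew = velx (U s) \<and> vely Unew = vely (U s) \<and>
         conc Unew = conc (U s))"

definition stability_independent :: "params \<Rightarrow> nat \<Rightarrow> bool" where
  "stability_independent P s \<longleftrightarrow>
     (\<forall>\<delta>>0. \<forall>\<delta>'>0. \<forall>c>0. \<forall>CFL \<tau> U.
        stability_condition (P\<lparr>cp1 := c, delta := \<delta>\<rparr>) s CFL \<tau> U \<longleftrightarrow>
        stability_condition (P\<lparr>cp1 := c, delta := \<delta>'\<rparr>) s CFL \<tau> U)"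

text \<open>
  \<open>C \<delta>\<close> is the value of \<open>cp1\<close> at \<open>\<delta>\<close> and \<open>\<tau>\<close> the limit of the step sizes; \<open>Unow\<close>, \<open>Ut\<close>, \<open>U\<close>
  and \<open>Unew\<close> are leading-order coefficients and \<open>p1\<close> the first-order coefficients of the stage
  pressures. The value \<open>c0\<close> of \<open>cp1\<close> in the limit scheme is the limit of \<open>C\<close> whenever that
  exists, in particular it is the constant itself if \<open>C\<close> is constant; convergence of \<open>C\<close> is not
  required.
\<close>

definition asymptotic_preserving ::
  "params \<Rightarrow> (real \<Rightarrow> real) \<Rightarrow> nat \<Rightarrow> (nat \<Rightarrow> nat \<Rightarrow> real) \<Rightarrow> (nat \<Rightarrow> nat \<Rightarrow> real) \<Rightarrow> real \<Rightarrow>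
   state \<Rightarrow> (nat \<Rightarrow> state) \<Rightarrow> (nat \<Rightarrow> state) \<Rightarrow> (nat \<Rightarrow> real mat) \<Rightarrow> state \<Rightarrow> bool" where
  "asymptotic_preserving P C s aE aI \<tau> Unow Ut U p1 Unew \<longleftrightarrow>
     stability_independent P s \<and>
     (\<exists>c0\<ge>0. (\<forall>c. (C \<longlongrightarrow> c) (at_right 0) \<longrightarrow> c0 = c) \<and>
        (let r0 = dens Unow $$ (0, 0) in
           limit_scheme (P\<lparr>cp1 := c0\<rparr>) s aE aI \<tau> r0 Unow Ut U (\<lambda>j. (1 / r0) \<cdot>\<^sub>m p1 j) Unew))"

end

theory Submission
  imports Defs
begin

text \<open>
  The two sources of difficulty as \<open>\<delta> \<rightarrow> 0\<close> are the stiff pressure gradient, whose coefficient \<open>cp2\<close>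
  behaves like \<open>1 / \<delta>\<close>, and the explicit pressure constant \<open>C\<close>, which may be unbounded or oscillate: all
  that the assumption \<open>C = o(cp2)\<close> gives is \<open>C * \<delta> \<rightarrow> 0\<close> (\<open>low_mach_if_smallo\<close>).

  The stiff gradient preserves well-prepared states (\<open>all_stages_incompressible\<close>, by induction on the
  stages). Multiplying the momentum equations by \<open>\<delta>\<close> leaves only the gradient of the leading-order pressure;
  since the implicit diagonal coefficients are nonzero, it vanishes, and so the leading-order density is
  constant. The discrete divergence has zero sum over the grid, so summing the mass equation shows
  that this constant is the initial density. The mass equation then reduces to the divergence constraint.

  The explicit terms are compared with their values at the limit state for the same \<open>C\<close>. The WENO
  reconstruction commutes with adding constants, so the large background pressure \<open>C * p(r\<^sub>0)\<close> drops
  out of flux differences; the deviations of the densities from \<open>r\<^sub>0\<close> are \<open>O(\<delta>)\<close>, so what remains of the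
  pressure is \<open>O(C * \<delta>)\<close> and the errors in the numerical viscosity are \<open>sqrt C * O(\<delta>)\<close>. At the limit
  state the convective terms have the form \<open>X + sqrt C * Y\<close>. Now the stages converge by assumption, the
  stage equations can be solved for the increments (\<open>increments_converge\<close>), and all other terms converge,
  so \<open>X + sqrt C * Y\<close> converges as well: either \<open>C\<close> converges or every \<open>Y\<close> is zero. In both cases one
  number \<open>c\<^sub>0\<close> serves for all entries, equations and stages (\<open>limit_coefficient_exists\<close>).

  The limits of the right-hand sides are then those of the incompressible scheme multiplied by \<open>r\<^sub>0\<close>
  (\<open>rhs_limits\<close>, \<open>limit_operators\<close>), the first-order pressure being what is left of the stiff gradient. As the
  implicit method is stiffly accurate, the update is the last stage.
\<close>

section \<open>Limits through the WENO reconstruction\<close>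

text \<open>
  The reconstruction is a rational function of its arguments whose denominators never vanish, so
  any notion of limit that respects field operations passes through it. Two such notions are
  needed: plain convergence as \<open>\<delta> \<rightarrow> 0\<close>, and convergence with error \<open>O(\<delta>)\<close>. The second one controls
  the quantities that are multiplied by a coefficient growing as the Mach number decreases.
\<close>

locale limit_notion =
  fixes T :: "(real \<Rightarrow> real) \<Rightarrow> real \<Rightarrow> bool"
  assumes const: "T (\<lambda>_. c) c"
    and add: "T f a \<Longrightarrow> T g b \<Longrightarrow> T (\<lambda>x. f x + g x) (a + b)"
    and mult: "T f a \<Longrightarrow> T g b \<Longrightarrow> T (\<lambda>x. f x * g x) (a * b)"
    and inverse: "T f a \<Longrightarrow> a \<noteq> 0 \<Longrightarrow> T (\<lambda>x. inverse (f x)) (inverse a)"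
begin

lemma minus: "T f a \<Longrightarrow> T (\<lambda>x. - f x) (- a)"
  using mult[OF const[of "- 1"]] by simp

lemma diff: "T f a \<Longrightarrow> T g b \<Longrightarrow> T (\<lambda>x. f x - g x) (a - b)"
  using add[OF _ minus] by simp

lemma divide: "T f a \<Longrightarrow> T g b \<Longrightarrow> b \<noteq> 0 \<Longrightarrow> T (\<lambda>x. f x / g x) (a / b)"
  using mult[OF _ inverse] by (simp add: divide_inverse)

lemma square: "T f a \<Longrightarrow> T (\<lambda>x. (f x)\<^sup>2) (a\<^sup>2)"
  using mult by (simp add: power2_eq_square)

lemmas arith_intros = const add diff minus mult divide square

lemma weno5:
  assumes "0 < weno_eps P"
    and "T a a0" "T b b0" "T c c0" "T d d0" "T e e0"
  shows "T (\<lambda>x. weno5 P (a x) (b x) (c x) (d x) (e x)) (weno5 P a0 b0 c0 d0 e0)"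
proof -
  have pos: "0 < weno_eps P + (13 / 12 * u\<^sup>2 + 1 / 4 * v\<^sup>2)" for u v
    using assms(1) by (intro add_pos_nonneg) auto
  have nz: "(weno_eps P + (13 / 12 * u\<^sup>2 + 1 / 4 * v\<^sup>2))\<^sup>2 \<noteq> 0" for u v
    using pos[of u v] by simp
  have w: "0 < k / (weno_eps P + (13 / 12 * u\<^sup>2 + 1 / 4 * v\<^sup>2))\<^sup>2" if "0 < k" for k u v
    using pos[of u v] that by simp
  show ?thesis
    unfolding weno5_def Let_def
    by (intro arith_intros assms(2-) nz less_imp_neq[OF add_pos_pos[OF add_pos_pos], symmetric] w) simp_all
qed

lemma rec_minus:
  assumes "0 < weno_eps P" "\<And>k. T (\<lambda>x. f x k) (f0 k)"
  shows "T (\<lambda>x. rec_minus P (f x) a) (rec_minus P f0 a)"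
  unfolding rec_minus_def by (intro weno5 assms)

lemma rec_plus:
  assumes "0 < weno_eps P" "\<And>k. T (\<lambda>x. f x k) (f0 k)"
  shows "T (\<lambda>x. rec_plus P (f x) a) (rec_plus P f0 a)"
  unfolding rec_plus_def by (intro weno5 assms)

lemma transfer:
  assumes "\<And>k. T (\<lambda>x. f x k) (f0 k)"
  shows "T (\<lambda>x. transfer (f x) a) (transfer f0 a)"
  unfolding transfer_def by (intro arith_intros assms) simp_all

end

interpretation tendsto: limit_notion "\<lambda>f a. (f \<longlongrightarrow> a) (at_right 0)"
  by unfold_locales (auto intro!: tendsto_intros)

lemma bigo_tendsto_0:
  fixes f g :: "real \<Rightarrow> real"
  assumes "f \<in> O[F](g)" "(g \<longlongrightarrow> 0) F"
  shows "(f \<longlongrightarrow> 0) F"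
proof -
  from assms(1) obtain K where "\<forall>\<^sub>F x in F. norm (f x) \<le> K * norm (g x)"
    by (auto elim: landau_o.bigE)
  then show ?thesis
    by (intro tendsto_0_le[OF assms(2), of f K]) (simp add: mult.commute)
qed

definition near :: "(real \<Rightarrow> real) \<Rightarrow> real \<Rightarrow> bool" where
  "near f a \<longleftrightarrow> (\<lambda>\<delta>. f \<delta> - a) \<in> O[at_right 0](\<lambda>\<delta>. \<delta>)"

lemma id_tendsto_at_right: "((\<lambda>\<delta>::real. \<delta>) \<longlongrightarrow> 0) (at_right 0)"
  by (rule tendsto_ident_at)

lemma near_imp_tendsto: "near f a \<Longrightarrow> (f \<longlongrightarrow> a) (at_right 0)"
proof -
  assume "near f a"
  then have "((\<lambda>\<delta>. f \<delta> - a) \<longlongrightarrow> 0) (at_right 0)"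
    unfolding near_def by (rule bigo_tendsto_0[OF _ id_tendsto_at_right])
  then show ?thesis by (simp add: LIM_zero_iff)
qed

lemma near_compose:
  assumes f: "near f a" and g: "(g has_field_derivative D) (at a)"
  shows "near (\<lambda>\<delta>. g (f \<delta>)) (g a)"
proof -
  have "(\<lambda>x. g x - g a) \<in> O[at a](\<lambda>x. x - a)"
  proof -
    have "((\<lambda>x. (g x - g a) / (x - a)) \<longlongrightarrow> D) (at a)"
      using g by (simp add: has_field_derivative_iff)
    then show ?thesis
      by (rule bigoI_tendsto) (auto simp: eventually_at_filter)
  qed
  then obtain K where K: "\<forall>\<^sub>F x in at a. norm (g x - g a) \<le> K * norm (x - a)"
    by (auto elim: landau_o.bigE)
  then have "\<forall>\<^sub>F x in nhds a. norm (g x - g a) \<le> K * norm (x - a)"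
    by (auto simp: eventually_at_filter elim!: eventually_mono)
  then have "\<forall>\<^sub>F \<delta> in at_right 0. norm (g (f \<delta>) - g a) \<le> K * norm (f \<delta> - a)"
    by (rule eventually_compose_filterlim) (rule near_imp_tendsto[OF f])
  then have "(\<lambda>\<delta>. g (f \<delta>) - g a) \<in> O[at_right 0](\<lambda>\<delta>. f \<delta> - a)"
    by (rule bigoI)
  then show ?thesis
    using f unfolding near_def by (rule landau_o.big_trans)
qed

interpretation near: limit_notion near
proof
  show "near (\<lambda>_. c) c" for c
    by (simp add: near_def)
  show "near (\<lambda>x. f x + g x) (a + b)" if "near f a" "near g b" for f g a b
    using sum_in_bigo(1)[OF that[unfolded near_def]] by (simp add: near_def algebra_simps)
  show "near (\<lambda>x. f x * g x) (a * b)" if f: "near f a" and g: "near g b" for f g a b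
  proof -
    have "f \<in> O[at_right 0](\<lambda>_. 1)"
      by (rule bigoI_tendsto[where c=a]) (use near_imp_tendsto[OF f] in auto)
    from landau_o.big_mult[OF this g[unfolded near_def]]
    have "(\<lambda>x. f x * (g x - b)) \<in> O[at_right 0](\<lambda>\<delta>. \<delta>)" by simp
    moreover have "(\<lambda>x. b * (f x - a)) \<in> O[at_right 0](\<lambda>\<delta>. \<delta>)"
      using f unfolding near_def by (simp add: landau_o.big.cmult_in_iff')
    ultimately have "(\<lambda>x. f x * (g x - b) + b * (f x - a)) \<in> O[at_right 0](\<lambda>\<delta>. \<delta>)"
      by (rule sum_in_bigo)
    then show ?thesis by (simp add: near_def algebra_simps)
  qed
  show "near (\<lambda>x. inverse (f x)) (inverse a)" if "near f a" "a \<noteq> 0" for f a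
    using near_compose[OF that(1) DERIV_inverse[OF that(2)]] .
qed

lemma near_cong:
  assumes "near f a" "\<forall>\<^sub>F \<delta> in at_right 0. f \<delta> = g \<delta>"
  shows "near g a"
  using assms unfolding near_def
  by (elim landau_o.big.in_cong[THEN iffD1, rotated]) (auto elim: eventually_mono)

text \<open>
  This is why the linear rate matters: it absorbs any factor \<open>K = o(1 / \<delta>)\<close>, in particular the explicit
  pressure constant and its square root.
\<close>

lemma scaled_near_tendsto_0:
  assumes "near f a" "((\<lambda>\<delta>. K \<delta> * \<delta>) \<longlongrightarrow> 0) (at_right 0)"
  shows "((\<lambda>\<delta>. K \<delta> * (f \<delta> - a)) \<longlongrightarrow> 0) (at_right 0)"
proof -
  have "(\<lambda>\<delta>. K \<delta> * (f \<delta> - a)) \<in> O[at_right 0](\<lambda>\<delta>. K \<delta> * \<delta>)"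
    using assms(1) unfolding near_def by (intro landau_o.big_mult) auto
  then show ?thesis by (rule bigo_tendsto_0) (rule assms(2))
qed

text \<open>
  The smoothness indicators only see differences of the arguments, and the candidate values are
  averages with coefficients of sum one; so the reconstruction commutes with adding a constant. In
  the fluxes this constant will be the large background pressure.
\<close>

lemma weno5_shift:
  "weno_eps P > 0 \<Longrightarrow> weno5 P (a + k) (b + k) (c + k) (d + k) (e + k) = weno5 P a b c d e + k"
proof -
  assume eps: "weno_eps P > 0"
  have pos: "0 < weno_eps P + (13 / 12 * u\<^sup>2 + 1 / 4 * v\<^sup>2)" for u v
    using eps by (intro add_pos_nonneg) auto
  have w: "0 < l / (weno_eps P + (13 / 12 * u\<^sup>2 + 1 / 4 * v\<^sup>2))\<^sup>2" if "0 < l" for l u v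
    using pos[of u v] that by simp
  define w0 where "w0 = (1 / 10) / (weno_eps P + (13 / 12 * (a - 2 * b + c)\<^sup>2 + 1 / 4 * (a - 4 * b + 3 * c)\<^sup>2))\<^sup>2"
  define w1 where "w1 = (6 / 10) / (weno_eps P + (13 / 12 * (b - 2 * c + d)\<^sup>2 + 1 / 4 * (b - d)\<^sup>2))\<^sup>2"
  define w2 where "w2 = (3 / 10) / (weno_eps P + (13 / 12 * (c - 2 * d + e)\<^sup>2 + 1 / 4 * (3 * c - 4 * d + e)\<^sup>2))\<^sup>2"
  have W: "w0 + w1 + w2 > 0"
    unfolding w0_def w1_def w2_def by (intro add_pos_pos w) auto
  have s: "a + k - 2 * (b + k) + (c + k) = a - 2 * b + c"
    "a + k - 4 * (b + k) + 3 * (c + k) = a - 4 * b + 3 * c"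
    "b + k - 2 * (c + k) + (d + k) = b - 2 * c + d"
    "b + k - (d + k) = b - d"
    "c + k - 2 * (d + k) + (e + k) = c - 2 * d + e"
    "3 * (c + k) - 4 * (d + k) + (e + k) = 3 * c - 4 * d + e"
    by (auto simp: algebra_simps)
  have "weno5 P a b c d e = (w0 * ((2 * a - 7 * b + 11 * c) / 6) + w1 * ((- b + 5 * c + 2 * d) / 6)
      + w2 * ((2 * c + 5 * d - e) / 6)) / (w0 + w1 + w2)"
    by (simp add: weno5_def Let_def w0_def w1_def w2_def)
  moreover have "weno5 P (a + k) (b + k) (c + k) (d + k) (e + k) =
     (w0 * ((2 * a - 7 * b + 11 * c) / 6 + k) + w1 * ((- b + 5 * c + 2 * d) / 6 + k)
      + w2 * ((2 * c + 5 * d - e) / 6 + k)) / (w0 + w1 + w2)"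
    unfolding weno5_def Let_def s w0_def[symmetric] w1_def[symmetric] w2_def[symmetric]
    by (simp add: field_simps)
  moreover have "(w0 * (x + k) + w1 * (y + k) + w2 * (z + k)) / (w0 + w1 + w2)
      = (w0 * x + w1 * y + w2 * z) / (w0 + w1 + w2) + k" for x y z
  proof -
    have "w0 * (x + k) + w1 * (y + k) + w2 * (z + k) = (w0 * x + w1 * y + w2 * z) + k * (w0 + w1 + w2)"
      by (simp add: algebra_simps)
    then show ?thesis using W by (simp add: add_divide_distrib)
  qed
  ultimately show ?thesis by simp
qed

lemma rec_minus_shift: "0 < weno_eps P \<Longrightarrow> rec_minus P (\<lambda>i. f i + k) a = rec_minus P f a + k"
  by (simp add: rec_minus_def weno5_shift)

lemma rec_plus_shift: "0 < weno_eps P \<Longrightarrow> rec_plus P (\<lambda>i. f i + k) a = rec_plus P f a + k"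
  by (simp add: rec_plus_def weno5_shift)

lemma weno5_zero: "weno5 P 0 0 0 0 0 = 0"
  by (simp add: weno5_def)

lemma rec_minus_const: "0 < weno_eps P \<Longrightarrow> rec_minus P (\<lambda>i. k) a = k"
  using rec_minus_shift[of P "\<lambda>_. 0" k a] by (simp add: rec_minus_def weno5_zero)

lemma rec_plus_const: "0 < weno_eps P \<Longrightarrow> rec_plus P (\<lambda>i. k) a = k"
  using rec_plus_shift[of P "\<lambda>_. 0" k a] by (simp add: rec_plus_def weno5_zero)

lemma transfer_const: "transfer (\<lambda>_. k) a = k"
  by (simp add: transfer_def)

section \<open>Grid functions near a state of constant density\<close>

context limit_notion
begin

lemma cell_even:
  assumes "0 < m" "\<And>k. k < m \<Longrightarrow> T (\<lambda>x. f x k) (f0 k)"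
  shows "T (\<lambda>x. cell_even m (f x) i) (cell_even m f0 i)"
proof -
  have "0 \<le> (i - 1) mod (2 * int m)" "(i - 1) mod (2 * int m) < 2 * int m"
    using assms(1) by simp_all
  then show ?thesis
    unfolding cell_even_def Let_def by (auto intro!: assms(2))
qed

lemma cell_odd:
  assumes "0 < m" "\<And>k. k < m \<Longrightarrow> T (\<lambda>x. f x k) (f0 k)"
  shows "T (\<lambda>x. cell_odd m (f x) i) (cell_odd m f0 i)"
proof -
  have "0 \<le> (i - 1) mod (2 * int m)" "(i - 1) mod (2 * int m) < 2 * int m"
    using assms(1) by simp_all
  then show ?thesis
    unfolding cell_odd_def Let_def by (auto intro!: assms(2) minus)
qed

lemma face_odd:
  assumes "0 < m" "\<And>k. k < m - 1 \<Longrightarrow> T (\<lambda>x. f x k) (f0 k)"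
  shows "T (\<lambda>x. face_odd m (f x) i) (face_odd m f0 i)"
proof -
  have "0 \<le> i mod (2 * int m)" "i mod (2 * int m) < 2 * int m"
    using assms(1) by simp_all
  then show ?thesis
    unfolding face_odd_def Let_def by (auto intro!: assms(2) minus const)
qed

end

lemma cell_even_const:
  assumes "0 < m" "\<And>k. k < m \<Longrightarrow> f k = r"
  shows "cell_even m f i = r"
proof -
  have "0 \<le> (i - 1) mod (2 * int m)" "(i - 1) mod (2 * int m) < 2 * int m"
    using assms(1) by simp_all
  then show ?thesis
    unfolding cell_even_def Let_def by (auto intro!: assms(2))
qed

definition near_state :: "params \<Rightarrow> (real \<Rightarrow> state) \<Rightarrow> state \<Rightarrow> bool" where
  "near_state P S S0 \<longleftrightarrow> valid_state P S0 \<and> (\<forall>\<^sub>F \<delta> in at_right 0. valid_state P (S \<delta>)) \<and>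
     (\<forall>i<cells P. \<forall>j<cells P. near (\<lambda>\<delta>. dens (S \<delta>) $$ (i, j)) (dens S0 $$ (i, j))) \<and>
     (\<forall>i<cells P - 1. \<forall>j<cells P. near (\<lambda>\<delta>. velx (S \<delta>) $$ (i, j)) (velx S0 $$ (i, j))) \<and>
     (\<forall>i<cells P. \<forall>j<cells P - 1. near (\<lambda>\<delta>. vely (S \<delta>) $$ (i, j)) (vely S0 $$ (i, j))) \<and>
     (\<forall>i<cells P. \<forall>j<cells P. near (\<lambda>\<delta>. conc (S \<delta>) $$ (i, j)) (conc S0 $$ (i, j)))"

definition uniform_density :: "params \<Rightarrow> state \<Rightarrow> real \<Rightarrow> bool" where
  "uniform_density P S r \<longleftrightarrow> 0 < r \<and> dens S = const_mat (cells P) (cells P) r"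

text \<open>
  The regime of the explicit pressure constant \<open>C\<close>. It may be unbounded, but is \<open>o(1 / \<delta>)\<close>.
\<close>

definition low_mach :: "(real \<Rightarrow> real) \<Rightarrow> bool" where
  "low_mach C \<longleftrightarrow> (\<forall>\<^sub>F \<delta> in at_right 0. 0 \<le> C \<delta>) \<and> ((\<lambda>\<delta>. C \<delta> * \<delta>) \<longlongrightarrow> 0) (at_right 0)"

lemma valid_state_swap: "valid_state P S \<Longrightarrow> valid_state P (swap_state S)"
  by (auto simp: valid_state_def swap_state_def)

lemma uniform_swap: "uniform_density P S r \<Longrightarrow> uniform_density P (swap_state S) r"
  by (auto simp: uniform_density_def swap_state_def const_mat_def)

text \<open>
  The fluxes in the second direction are those in the first one at the transposed state, so that
  everything shown for one direction carries over to the other.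
\<close>

lemma near_state_swap:
  assumes "near_state P S S0"
  shows "near_state P (\<lambda>\<delta>. swap_state (S \<delta>)) (swap_state S0)"
proof -
  have v0: "valid_state P S0" and v: "\<forall>\<^sub>F \<delta> in at_right 0. valid_state P (S \<delta>)"
    using assms by (auto simp: near_state_def)
  have tr: "near (\<lambda>\<delta>. transpose_mat (A \<delta>) $$ (i, j)) (transpose_mat A0 $$ (i, j))"
    if "near (\<lambda>\<delta>. A \<delta> $$ (j, i)) (A0 $$ (j, i))" "\<forall>\<^sub>F \<delta> in at_right 0. A \<delta> \<in> carrier_mat c r"
      "A0 \<in> carrier_mat c r" "i < r" "j < c" for A A0 i j r c
  proof -
    have "\<forall>\<^sub>F \<delta> in at_right 0. A \<delta> $$ (j, i) = transpose_mat (A \<delta>) $$ (i, j)"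
      using that(2) by eventually_elim (use that in auto)
    from near_cong[OF that(1) this] show ?thesis
      using that by auto
  qed
  have ev: "\<forall>\<^sub>F \<delta> in at_right 0. dens (S \<delta>) \<in> carrier_mat (cells P) (cells P)"
    "\<forall>\<^sub>F \<delta> in at_right 0. velx (S \<delta>) \<in> carrier_mat (cells P - 1) (cells P)"
    "\<forall>\<^sub>F \<delta> in at_right 0. vely (S \<delta>) \<in> carrier_mat (cells P) (cells P - 1)"
    "\<forall>\<^sub>F \<delta> in at_right 0. conc (S \<delta>) \<in> carrier_mat (cells P) (cells P)"
    using v by (auto simp: valid_state_def elim!: eventually_mono)
  show ?thesis
    unfolding near_state_def
  proof (intro conjI allI impI)
    show "valid_state P (swap_state S0)" by (rule valid_state_swap[OF v0])
    show "\<forall>\<^sub>F \<delta> in at_right 0. valid_state P (swap_state (S \<delta>))"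
      using v by (auto intro: valid_state_swap elim!: eventually_mono)
  next
    fix i j assume "i < cells P" "j < cells P"
    then show "near (\<lambda>\<delta>. dens (swap_state (S \<delta>)) $$ (i, j)) (dens (swap_state S0) $$ (i, j))"
      using assms v0 unfolding swap_state_def near_state_def valid_state_def
      by (auto intro!: tr[OF _ ev(1)])
  next
    fix i j assume "i < cells P" "j < cells P"
    then show "near (\<lambda>\<delta>. conc (swap_state (S \<delta>)) $$ (i, j)) (conc (swap_state S0) $$ (i, j))"
      using assms v0 unfolding swap_state_def near_state_def valid_state_def
      by (auto intro!: tr[OF _ ev(4)])
  next
    fix i j assume "i < cells P - 1" "j < cells P"
    then show "near (\<lambda>\<delta>. velx (swap_state (S \<delta>)) $$ (i, j)) (velx (swap_state S0) $$ (i, j))"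
      using assms v0 unfolding swap_state_def near_state_def valid_state_def
      by (auto intro!: tr[OF _ ev(3)])
  next
    fix i j assume "i < cells P" "j < cells P - 1"
    then show "near (\<lambda>\<delta>. vely (swap_state (S \<delta>)) $$ (i, j)) (vely (swap_state S0) $$ (i, j))"
      using assms v0 unfolding swap_state_def near_state_def valid_state_def
      by (auto intro!: tr[OF _ ev(2)])
  qed
qed

context
  fixes P :: params and S :: "real \<Rightarrow> state" and S0 :: state
  assumes P: "valid_params P" and near: "near_state P S S0"
begin

lemma cells_pos: "0 < cells P"
  using P by (simp add: valid_params_def)

lemma near_rho_at: "near (\<lambda>\<delta>. rho_at P (S \<delta>) i j) (rho_at P S0 i j)"
  unfolding rho_at_def using near
  by (intro near.cell_even cells_pos) (auto simp: near_state_def)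

lemma near_c_at: "near (\<lambda>\<delta>. c_at P (S \<delta>) i j) (c_at P S0 i j)"
  unfolding c_at_def using near
  by (intro near.cell_even cells_pos) (auto simp: near_state_def)

lemma near_v1_at: "near (\<lambda>\<delta>. v1_at P (S \<delta>) i j) (v1_at P S0 i j)"
  unfolding v1_at_def using near
  by (intro near.cell_odd near.face_odd cells_pos) (auto simp: near_state_def)

lemma near_v2_at: "near (\<lambda>\<delta>. v2_at P (S \<delta>) i j) (v2_at P S0 i j)"
  unfolding v2_at_def using near
  by (intro near.cell_odd near.face_odd cells_pos) (auto simp: near_state_def)

lemma near_rho_fx: "near (\<lambda>\<delta>. rho_fx P (S \<delta>) i j) (rho_fx P S0 i j)"
  unfolding rho_fx_def by (intro near.transfer near_rho_at)

lemma near_rho_fy: "near (\<lambda>\<delta>. rho_fy P (S \<delta>) i j) (rho_fy P S0 i j)"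
  unfolding rho_fy_def by (intro near.transfer near_rho_at)

lemma near_v1_cen: "near (\<lambda>\<delta>. v1_cen P (S \<delta>) i j) (v1_cen P S0 i j)"
  unfolding v1_cen_def by (intro near.transfer near_v1_at)

lemma near_v1_fy: "near (\<lambda>\<delta>. v1_fy P (S \<delta>) i j) (v1_fy P S0 i j)"
  unfolding v1_fy_def by (intro near.transfer near.arith_intros near_v1_at) simp_all

end

lemma uniform_rho:
  assumes "valid_params P" "uniform_density P S r"
  shows "rho_at P S i j = r" "rho_fx P S i j = r" "rho_fy P S i j = r"
proof -
  have n: "0 < cells P" using assms(1) by (simp add: valid_params_def)
  show *: "rho_at P S i j = r" for i j
    unfolding rho_at_def using assms(2) n
    by (intro cell_even_const) (auto simp: uniform_density_def const_mat_def)
  show "rho_fx P S i j = r" "rho_fy P S i j = r"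
    by (simp_all add: rho_fx_def rho_fy_def * transfer_const)
qed

section \<open>Rusanov fluxes\<close>

lemma cp1_update_simps [simp]:
  "rho_at (P\<lparr>cp1 := c\<rparr>) = rho_at P" "c_at (P\<lparr>cp1 := c\<rparr>) = c_at P"
  "v1_at (P\<lparr>cp1 := c\<rparr>) = v1_at P" "v2_at (P\<lparr>cp1 := c\<rparr>) = v2_at P"
  "rho_fx (P\<lparr>cp1 := c\<rparr>) = rho_fx P" "rho_fy (P\<lparr>cp1 := c\<rparr>) = rho_fy P"
  "v1_cen (P\<lparr>cp1 := c\<rparr>) = v1_cen P" "v1_fy (P\<lparr>cp1 := c\<rparr>) = v1_fy P"
  "rec_plus (P\<lparr>cp1 := c\<rparr>) = rec_plus P" "rec_minus (P\<lparr>cp1 := c\<rparr>) = rec_minus P"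
  "mesh (P\<lparr>cp1 := c\<rparr>) = mesh P"
  "pres (P\<lparr>cp1 := c\<rparr>) = pres P" "pres_deriv (P\<lparr>cp1 := c\<rparr>) = pres_deriv P"
  by (auto simp: fun_eq_iff rho_at_def c_at_def v1_at_def v2_at_def rho_fx_def rho_fy_def v1_cen_def
      v1_fy_def rec_plus_def rec_minus_def weno5_def mesh_def pres_def pres_deriv_def)

text \<open>
  The sound speed factors as \<open>sqrt C\<close> times the one for the unscaled pressure. The latter is smooth in the
  density, which keeps the rate \<open>O(\<delta>)\<close>.
\<close>

definition unit_sound :: "params \<Rightarrow> real \<Rightarrow> real" where
  "unit_sound P r = sqrt (pres_deriv P r)"

lemma sound_eq: "sound (P\<lparr>cp1 := c\<rparr>) r = sqrt c * unit_sound P r"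
  by (simp add: sound_def unit_sound_def real_sqrt_mult)

lemma near_unit_sound:
  assumes "valid_params P" "0 < r" "near f r"
  shows "near (\<lambda>\<delta>. unit_sound P (f \<delta>)) (unit_sound P r)"
proof -
  have "0 < gam P * r powr (gam P - 1)"
    using assms by (auto simp: valid_params_def)
  then have "\<exists>D. (unit_sound P has_field_derivative D) (at r)"
    unfolding unit_sound_def[abs_def] pres_deriv_def using assms(2)
    by (auto intro!: exI derivative_eq_intros)
  then show ?thesis using near_compose[OF assms(3)] by blast
qed

lemma near_pres:
  assumes "0 < r" "near f r"
  shows "near (\<lambda>\<delta>. pres P (f \<delta>)) (pres P r)"
proof -
  have "\<exists>D. (pres P has_field_derivative D) (at r)"
    unfolding pres_def[abs_def] using assms(1)
    by (auto intro!: exI derivative_eq_intros)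
  then show ?thesis using near_compose[OF assms(2)] by blast
qed

text \<open>
  From \<open>sqrt C * \<delta> = sqrt (C * \<delta>) * sqrt \<delta>\<close>.
\<close>

lemma low_mach_sqrt:
  assumes "low_mach C"
  shows "((\<lambda>\<delta>. sqrt (C \<delta>) * \<delta>) \<longlongrightarrow> 0) (at_right 0)"
proof -
  have "((\<lambda>\<delta>. sqrt (C \<delta> * \<delta>) * sqrt \<delta>) \<longlongrightarrow> sqrt 0 * sqrt 0) (at_right 0)"
    using assms unfolding low_mach_def by (intro tendsto_intros) auto
  moreover have "\<forall>\<^sub>F \<delta> in at_right 0. sqrt (C \<delta> * \<delta>) * sqrt \<delta> = sqrt (C \<delta>) * \<delta>"
    using eventually_at_right_less[of 0]
    by eventually_elim (simp add: real_sqrt_mult)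
  ultimately show ?thesis using Lim_transform_eventually by fastforce
qed

lemma viscosity_uniform:
  "viscosity (P\<lparr>cp1 := c\<rparr>) u (\<lambda>_. r) a =
     max \<bar>rec_plus P u (a + 1)\<bar> \<bar>rec_minus P u a\<bar> + sqrt c * unit_sound P r"
  if "0 < weno_eps P"
  using that by (simp add: viscosity_def sound_eq rec_plus_const rec_minus_const max_add_distrib_left)

context
  fixes P :: params and C :: "real \<Rightarrow> real" and r0 :: real
    and u r :: "real \<Rightarrow> int \<Rightarrow> real" and u0 :: "int \<Rightarrow> real"
  assumes P: "valid_params P" and C: "low_mach C" and r0: "0 < r0"
    and r: "\<And>k. near (\<lambda>\<delta>. r \<delta> k) r0"
    and u: "\<And>k. near (\<lambda>\<delta>. u \<delta> k) (u0 k)"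
begin

lemma eps: "0 < weno_eps P"
  using P by (simp add: valid_params_def)

text \<open>
  The maximum is Lipschitz, the velocities converge, and the sound speeds at a density \<open>r\<^sub>0 + O(\<delta>)\<close> and
  at \<open>r\<^sub>0\<close> differ by \<open>sqrt C * O(\<delta>)\<close>. Both viscosities may diverge; only their difference tends to zero.
\<close>

lemma viscosity_limit:
  "((\<lambda>\<delta>. viscosity (P\<lparr>cp1 := C \<delta>\<rparr>) (u \<delta>) (r \<delta>) a
       - viscosity (P\<lparr>cp1 := C \<delta>\<rparr>) u0 (\<lambda>_. r0) a) \<longlongrightarrow> 0) (at_right 0)"
proof -
  have one: "((\<lambda>\<delta>. (\<bar>v \<delta>\<bar> + sound (P\<lparr>cp1 := C \<delta>\<rparr>) (\<rho> \<delta>)) - (\<bar>v0\<bar> + sound (P\<lparr>cp1 := C \<delta>\<rparr>) r0))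
      \<longlongrightarrow> 0) (at_right 0)"
    if v: "near v v0" and \<rho>: "near \<rho> r0" for v v0 \<rho>
  proof -
    have "((\<lambda>\<delta>. (\<bar>v \<delta>\<bar> - \<bar>v0\<bar>) + sqrt (C \<delta>) * (unit_sound P (\<rho> \<delta>) - unit_sound P r0))
        \<longlongrightarrow> (\<bar>v0\<bar> - \<bar>v0\<bar>) + 0) (at_right 0)"
      by (intro tendsto_intros near_imp_tendsto[OF v] scaled_near_tendsto_0 near_unit_sound P r0 \<rho>
          low_mach_sqrt C)
    then show ?thesis by (simp add: sound_eq algebra_simps)
  qed
  have rp: "near (\<lambda>\<delta>. rec_plus P (r \<delta>) (a + 1)) r0"
    using near.rec_plus[OF eps r, where a = "a + 1"] eps by (simp add: rec_plus_const)
  have rm: "near (\<lambda>\<delta>. rec_minus P (r \<delta>) a) r0"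
    using near.rec_minus[OF eps r, where a = a] eps by (simp add: rec_minus_const)
  note p = one[OF near.rec_plus[OF eps u] rp]
  note m = one[OF near.rec_minus[OF eps u] rm]
  have bound: "norm (max x y - max x' y') \<le> norm (\<bar>x - x'\<bar> + \<bar>y - y'\<bar>) * 1" for x y x' y' :: real
    by (auto simp: max_def)
  show ?thesis
    unfolding viscosity_def cp1_update_simps rec_plus_const[OF eps] rec_minus_const[OF eps]
    by (rule tendsto_0_le[OF _ always_eventually[OF allI[OF bound]]])
      (intro tendsto_add_zero tendsto_rabs_zero p m)
qed

text \<open>
  The flux is compared with the one at the limit state for the \<^emph>\<open>same\<close> value of \<open>C\<close>, since neither need
  converge. The possibly unbounded background \<open>K\<close> is the same constant in both fluxes. The dissipative
  parts differ by (difference of viscosities) \<open>*\<close> (jump) \<open>+\<close> viscosity \<open>*\<close> (difference of jumps), and the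
  last product is \<open>sqrt C * O(\<delta>)\<close>.
\<close>

lemma rusanov_limit:
  fixes q m :: "real \<Rightarrow> int \<Rightarrow> real" and q0 m0 :: "int \<Rightarrow> real" and K :: "real \<Rightarrow> real"
  assumes q: "\<And>k. ((\<lambda>\<delta>. q \<delta> k - K \<delta>) \<longlongrightarrow> q0 k) (at_right 0)"
    and m: "\<And>k. near (\<lambda>\<delta>. m \<delta> k) (m0 k)"
  shows "((\<lambda>\<delta>. rusanov (P\<lparr>cp1 := C \<delta>\<rparr>) (q \<delta>) (m \<delta>) (u \<delta>) (r \<delta>) a
       - rusanov (P\<lparr>cp1 := C \<delta>\<rparr>) (\<lambda>k. q0 k + K \<delta>) m0 u0 (\<lambda>_. r0) a) \<longlongrightarrow> 0) (at_right 0)"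
proof -
  define V where "V \<delta> = viscosity (P\<lparr>cp1 := C \<delta>\<rparr>) (u \<delta>) (r \<delta>) a" for \<delta>
  define V0 where "V0 \<delta> = viscosity (P\<lparr>cp1 := C \<delta>\<rparr>) u0 (\<lambda>_. r0) a" for \<delta>
  define J where "J \<delta> = rec_plus P (m \<delta>) (a + 1) - rec_minus P (m \<delta>) a" for \<delta>
  define J0 where "J0 = rec_plus P m0 (a + 1) - rec_minus P m0 a"
  have J: "near J J0"
    unfolding J_def[abs_def] J0_def by (intro near.diff near.rec_plus near.rec_minus eps m)
  have Qp: "((\<lambda>\<delta>. rec_plus P (\<lambda>k. q \<delta> k - K \<delta>) (a + 1)) \<longlongrightarrow> rec_plus P q0 (a + 1)) (at_right 0)"
    by (intro tendsto.rec_plus eps q)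
  have Qm: "((\<lambda>\<delta>. rec_minus P (\<lambda>k. q \<delta> k - K \<delta>) a) \<longlongrightarrow> rec_minus P q0 a) (at_right 0)"
    by (intro tendsto.rec_minus eps q)
  have shift: "rec_plus P (\<lambda>k. q \<delta> k - K \<delta>) b = rec_plus P (q \<delta>) b - K \<delta>"
    "rec_minus P (\<lambda>k. q \<delta> k - K \<delta>) b = rec_minus P (q \<delta>) b - K \<delta>" for \<delta> b
    using rec_plus_shift[OF eps, of "q \<delta>" "- K \<delta>"] rec_minus_shift[OF eps, of "q \<delta>" "- K \<delta>"] by simp_all
  have v0J: "((\<lambda>\<delta>. V0 \<delta> * (J \<delta> - J0)) \<longlongrightarrow> 0) (at_right 0)"
  proof -
    let ?M = "max \<bar>rec_plus P u0 (a + 1)\<bar> \<bar>rec_minus P u0 a\<bar>"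
    have "((\<lambda>\<delta>. ?M * (J \<delta> - J0) + unit_sound P r0 * (sqrt (C \<delta>) * (J \<delta> - J0)))
        \<longlongrightarrow> ?M * (J0 - J0) + unit_sound P r0 * 0) (at_right 0)"
      by (intro tendsto_intros near_imp_tendsto[OF J] scaled_near_tendsto_0 low_mach_sqrt C J)
    then show ?thesis
      by (simp add: V0_def viscosity_uniform[OF eps] algebra_simps)
  qed
  have VJ: "((\<lambda>\<delta>. (V \<delta> - V0 \<delta>) * J \<delta>) \<longlongrightarrow> 0 * J0) (at_right 0)"
    unfolding V_def V0_def by (intro tendsto_mult viscosity_limit near_imp_tendsto J)
  have "((\<lambda>\<delta>. ((rec_plus P (q \<delta>) (a + 1) - K \<delta>) - rec_plus P q0 (a + 1)
        + ((rec_minus P (q \<delta>) a - K \<delta>) - rec_minus P q0 a)) / 2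
      - ((V \<delta> - V0 \<delta>) * J \<delta> + V0 \<delta> * (J \<delta> - J0)) / 2)
      \<longlongrightarrow> (rec_plus P q0 (a + 1) - rec_plus P q0 (a + 1) + (rec_minus P q0 a - rec_minus P q0 a)) / 2
        - (0 * J0 + 0) / 2) (at_right 0)"
    by (intro tendsto_intros Qp[unfolded shift] Qm[unfolded shift] VJ v0J) simp_all
  moreover have "((rec_plus P (q \<delta>) (a + 1) - K \<delta>) - rec_plus P q0 (a + 1)
        + ((rec_minus P (q \<delta>) a - K \<delta>) - rec_minus P q0 a)) / 2
      - ((V \<delta> - V0 \<delta>) * J \<delta> + V0 \<delta> * (J \<delta> - J0)) / 2 =
     rusanov (P\<lparr>cp1 := C \<delta>\<rparr>) (q \<delta>) (m \<delta>) (u \<delta>) (r \<delta>) a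
       - rusanov (P\<lparr>cp1 := C \<delta>\<rparr>) (\<lambda>k. q0 k + K \<delta>) m0 u0 (\<lambda>_. r0) a" for \<delta>
    unfolding rusanov_def cp1_update_simps rec_plus_shift[OF eps] rec_minus_shift[OF eps]
      V_def[symmetric] V0_def[symmetric] J_def[symmetric] J0_def[symmetric]
    by (simp add: field_simps)
  ultimately show ?thesis by simp
qed

end

lemma rusanov_uniform:
  assumes "0 < weno_eps P"
  shows "rusanov (P\<lparr>cp1 := c\<rparr>) (\<lambda>k. q k + K) m u (\<lambda>_. r) a =
    K + rusanov (P\<lparr>cp1 := 0\<rparr>) q m u (\<lambda>_. r) a
      - sqrt c * (unit_sound P r * (rec_plus P m (a + 1) - rec_minus P m a) / 2)"
  unfolding rusanov_def cp1_update_simps rec_plus_shift[OF assms] rec_minus_shift[OF assms]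
    viscosity_uniform[OF assms]
  by (simp add: field_simps)

section \<open>Convective terms\<close>

text \<open>
  At constant density the background pressure cancels in flux differences, so that \<open>C\<close> enters the
  convective terms only through the sound speed in the viscosity, that is affinely in \<open>sqrt C\<close>. So
  \<open>sqrt C\<close> alone can keep them from converging.
\<close>

definition affine_in_sqrt :: "(real \<Rightarrow> real) \<Rightarrow> bool" where
  "affine_in_sqrt f \<longleftrightarrow> (\<exists>X Y. \<forall>c. f c = X + sqrt c * Y)"

lemma affine_in_sqrt_diff:
  assumes "affine_in_sqrt f" "affine_in_sqrt g"
  shows "affine_in_sqrt (\<lambda>c. f c - g c)"
proof -
  obtain X Y X' Y' where "\<And>c. f c = X + sqrt c * Y" "\<And>c. g c = X' + sqrt c * Y'"
    using assms by (auto simp: affine_in_sqrt_def)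
  then have "f c - g c = (X - X') + sqrt c * (Y - Y')" for c
    by (simp add: algebra_simps)
  then show ?thesis unfolding affine_in_sqrt_def by blast
qed

lemma affine_in_sqrt_minus_divide:
  assumes "affine_in_sqrt f"
  shows "affine_in_sqrt (\<lambda>c. - f c / h)"
proof -
  obtain X Y where "\<And>c. f c = X + sqrt c * Y"
    using assms by (auto simp: affine_in_sqrt_def)
  then have "- f c / h = - X / h + sqrt c * (- Y / h)" for c
    by (simp add: diff_divide_distrib)
  then show ?thesis unfolding affine_in_sqrt_def by blast
qed

lemma affine_in_sqrt_divide:
  assumes "affine_in_sqrt f"
  shows "affine_in_sqrt (\<lambda>c. f c / h)"
  using affine_in_sqrt_minus_divide[OF assms, of "- h"] by simp

lemma affine_in_sqrt_rusanov:
  assumes "0 < weno_eps P"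
  shows "affine_in_sqrt (\<lambda>c. rusanov (P\<lparr>cp1 := c\<rparr>) (\<lambda>k. q k + K c) m u (\<lambda>_. r) a - K c)"
  unfolding affine_in_sqrt_def rusanov_uniform[OF assms]
  by (intro exI[of _ "rusanov (P\<lparr>cp1 := 0\<rparr>) q m u (\<lambda>_. r) a"]
      exI[of _ "- (unit_sound P r * (rec_plus P m (a + 1) - rec_minus P m a) / 2)"]) simp

lemma pres1_eq: "pres1 (P\<lparr>cp1 := c\<rparr>) r = c * pres P r"
  by (simp add: pres1_def)

lemma
  assumes P: "valid_params P" and S0: "uniform_density P S0 r0"
  shows affine_F_mx: "affine_in_sqrt (\<lambda>c. F_mx (P\<lparr>cp1 := c\<rparr>) S0 i j - c * pres P r0)"
    and affine_F_my: "affine_in_sqrt (\<lambda>c. F_my (P\<lparr>cp1 := c\<rparr>) S0 i j)"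
    and affine_F_c: "affine_in_sqrt (\<lambda>c. F_c (P\<lparr>cp1 := c\<rparr>) S0 i j)"
proof -
  have eps: "0 < weno_eps P" using P by (simp add: valid_params_def)
  show "affine_in_sqrt (\<lambda>c. F_mx (P\<lparr>cp1 := c\<rparr>) S0 i j - c * pres P r0)"
    unfolding F_mx_def cp1_update_simps uniform_rho[OF P S0] pres1_eq
    by (rule affine_in_sqrt_rusanov[OF eps])
  show "affine_in_sqrt (\<lambda>c. F_my (P\<lparr>cp1 := c\<rparr>) S0 i j)"
    unfolding F_my_def cp1_update_simps uniform_rho[OF P S0]
    using affine_in_sqrt_rusanov[OF eps, where K = "\<lambda>_. 0"] by simp
  show "affine_in_sqrt (\<lambda>c. F_c (P\<lparr>cp1 := c\<rparr>) S0 i j)"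
    unfolding F_c_def cp1_update_simps uniform_rho[OF P S0]
    using affine_in_sqrt_rusanov[OF eps, where K = "\<lambda>_. 0"] by simp
qed

lemma low_mach_scaled_near:
  assumes "low_mach C" "near f a"
  shows "((\<lambda>\<delta>. C \<delta> * (f \<delta> - a)) \<longlongrightarrow> 0) (at_right 0)"
  using assms by (intro scaled_near_tendsto_0) (auto simp: low_mach_def)

text \<open>
  The background is \<open>K = C * p(r\<^sub>0)\<close> in the flux of the parallel momentum and zero in the other two. In the
  former, \<open>C * (p(\<rho>) - p(r\<^sub>0))\<close> is \<open>C * O(\<delta>)\<close> and vanishes in the limit.
\<close>

lemma
  assumes P: "valid_params P" and C: "low_mach C" and S: "near_state P S S0" and S0: "uniform_density P S0 r0"
  shows F_mx_limit: "((\<lambda>\<delta>. F_mx (P\<lparr>cp1 := C \<delta>\<rparr>) (S \<delta>) i j - F_mx (P\<lparr>cp1 := C \<delta>\<rparr>) S0 i j)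
      \<longlongrightarrow> 0) (at_right 0)"
    and F_my_limit: "((\<lambda>\<delta>. F_my (P\<lparr>cp1 := C \<delta>\<rparr>) (S \<delta>) i j - F_my (P\<lparr>cp1 := C \<delta>\<rparr>) S0 i j)
      \<longlongrightarrow> 0) (at_right 0)"
    and F_c_limit: "((\<lambda>\<delta>. F_c (P\<lparr>cp1 := C \<delta>\<rparr>) (S \<delta>) i j - F_c (P\<lparr>cp1 := C \<delta>\<rparr>) S0 i j)
      \<longlongrightarrow> 0) (at_right 0)"
proof -
  note rho = uniform_rho[OF P S0]
  note near_rho = near_rho_at[OF P S, unfolded rho] near_rho_fx[OF P S, unfolded rho]
    near_rho_fy[OF P S, unfolded rho]
  note near_all = near_rho near_c_at[OF P S] near_v1_at[OF P S] near_v2_at[OF P S]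
    near_v1_cen[OF P S] near_v1_fy[OF P S]
  have r0: "0 < r0" using S0 by (simp add: uniform_density_def)
  show "((\<lambda>\<delta>. F_mx (P\<lparr>cp1 := C \<delta>\<rparr>) (S \<delta>) i j - F_mx (P\<lparr>cp1 := C \<delta>\<rparr>) S0 i j) \<longlongrightarrow> 0) (at_right 0)"
    unfolding F_mx_def cp1_update_simps rho pres1_eq
  proof (rule rusanov_limit[OF P C r0])
    fix k
    have "((\<lambda>\<delta>. rho_fx P (S \<delta>) k j * (v1_at P (S \<delta>) k j)\<^sup>2
        + C \<delta> * (pres P (rho_fx P (S \<delta>) k j) - pres P r0)) \<longlongrightarrow> r0 * (v1_at P S0 k j)\<^sup>2 + 0) (at_right 0)"
      by (intro tendsto_intros low_mach_scaled_near C near_pres r0 near_all near_imp_tendsto)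
    then show "((\<lambda>\<delta>. rho_fx P (S \<delta>) k j * (v1_at P (S \<delta>) k j)\<^sup>2
        + C \<delta> * pres P (rho_fx P (S \<delta>) k j) - C \<delta> * pres P r0) \<longlongrightarrow> r0 * (v1_at P S0 k j)\<^sup>2) (at_right 0)"
      by (simp add: algebra_simps)
  qed (intro near.arith_intros near_all)+
  show "((\<lambda>\<delta>. F_my (P\<lparr>cp1 := C \<delta>\<rparr>) (S \<delta>) i j - F_my (P\<lparr>cp1 := C \<delta>\<rparr>) S0 i j) \<longlongrightarrow> 0) (at_right 0)"
    unfolding F_my_def cp1_update_simps rho
    by (rule rusanov_limit[OF P C r0, where K = "\<lambda>_. 0", simplified])
      (intro near_imp_tendsto near.arith_intros near_all)+
  show "((\<lambda>\<delta>. F_c (P\<lparr>cp1 := C \<delta>\<rparr>) (S \<delta>) i j - F_c (P\<lparr>cp1 := C \<delta>\<rparr>) S0 i j) \<longlongrightarrow> 0) (at_right 0)"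
    unfolding F_c_def cp1_update_simps rho
    by (rule rusanov_limit[OF P C r0, where K = "\<lambda>_. 0", simplified])
      (intro near_imp_tendsto near.arith_intros near_all)+
qed

lemma conv_index:
  "a < cells P - 1 \<Longrightarrow> b < cells P \<Longrightarrow> conv_mx P S $$ (a, b) =
     - (F_mx P S (int a + 1 + 1) (int b + 1) - F_mx P S (int a + 1) (int b + 1)) / mesh P
     - (F_my P (swap_state S) (int b + 1) (int a + 1) - F_my P (swap_state S) (int b + 1 - 1) (int a + 1)) / mesh P"
  "a < cells P \<Longrightarrow> b < cells P - 1 \<Longrightarrow> conv_my P S $$ (a, b) =
     - (F_my P S (int a + 1) (int b + 1) - F_my P S (int a + 1 - 1) (int b + 1)) / mesh P
     - (F_mx P (swap_state S) (int b + 1 + 1) (int a + 1) - F_mx P (swap_state S) (int b + 1) (int a + 1)) / mesh P"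
  "a < cells P \<Longrightarrow> b < cells P \<Longrightarrow> conv_c P S $$ (a, b) =
     - (F_c P S (int a + 1) (int b + 1) - F_c P S (int a + 1 - 1) (int b + 1)) / mesh P
     - (F_c P (swap_state S) (int b + 1) (int a + 1) - F_c P (swap_state S) (int b + 1 - 1) (int a + 1)) / mesh P"
  by (simp_all add: conv_mx_def conv_my_def conv_c_def G_mx_def G_my_def G_c_def Let_def)

lemma cells_cp1 [simp]: "cells (P\<lparr>cp1 := c\<rparr>) = cells P"
  by simp

lemma
  assumes P: "valid_params P" and S0: "uniform_density P S0 r0"
  shows affine_conv_mx: "a < cells P - 1 \<Longrightarrow> b < cells P \<Longrightarrow>
      affine_in_sqrt (\<lambda>c. conv_mx (P\<lparr>cp1 := c\<rparr>) S0 $$ (a, b))"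
    and affine_conv_my: "a < cells P \<Longrightarrow> b < cells P - 1 \<Longrightarrow>
      affine_in_sqrt (\<lambda>c. conv_my (P\<lparr>cp1 := c\<rparr>) S0 $$ (a, b))"
    and affine_conv_c: "a < cells P \<Longrightarrow> b < cells P \<Longrightarrow>
      affine_in_sqrt (\<lambda>c. conv_c (P\<lparr>cp1 := c\<rparr>) S0 $$ (a, b))"
proof -
  note aff = affine_F_my[OF P S0] affine_F_c[OF P S0]
    affine_F_my[OF P uniform_swap[OF S0]] affine_F_c[OF P uniform_swap[OF S0]]
  have cancel: "affine_in_sqrt (\<lambda>c. F c - G c)"
    if "affine_in_sqrt (\<lambda>c. F c - c * p)" "affine_in_sqrt (\<lambda>c. G c - c * p)" for F G p
    using affine_in_sqrt_diff[OF that] by simp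
  note aff' = cancel[OF affine_F_mx[OF P S0] affine_F_mx[OF P S0]]
    cancel[OF affine_F_mx[OF P uniform_swap[OF S0]] affine_F_mx[OF P uniform_swap[OF S0]]]
  show "affine_in_sqrt (\<lambda>c. conv_mx (P\<lparr>cp1 := c\<rparr>) S0 $$ (a, b))" if "a < cells P - 1" "b < cells P"
    unfolding conv_index(1)[of a "P\<lparr>cp1 := _\<rparr>", unfolded cells_cp1, OF that] cp1_update_simps
    by (intro affine_in_sqrt_diff[OF affine_in_sqrt_minus_divide affine_in_sqrt_divide]
        affine_in_sqrt_diff[OF aff(3) aff(3)] aff')
  show "affine_in_sqrt (\<lambda>c. conv_my (P\<lparr>cp1 := c\<rparr>) S0 $$ (a, b))" if "a < cells P" "b < cells P - 1"
    unfolding conv_index(2)[of a "P\<lparr>cp1 := _\<rparr>", unfolded cells_cp1, OF that] cp1_update_simps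
    by (intro affine_in_sqrt_diff[OF affine_in_sqrt_minus_divide affine_in_sqrt_divide]
        affine_in_sqrt_diff[OF aff(1) aff(1)] aff')
  show "affine_in_sqrt (\<lambda>c. conv_c (P\<lparr>cp1 := c\<rparr>) S0 $$ (a, b))" if "a < cells P" "b < cells P"
    unfolding conv_index(3)[of a "P\<lparr>cp1 := _\<rparr>", unfolded cells_cp1, OF that] cp1_update_simps
    by (intro affine_in_sqrt_diff[OF affine_in_sqrt_minus_divide affine_in_sqrt_divide]
        affine_in_sqrt_diff[OF aff(2) aff(2)] affine_in_sqrt_diff[OF aff(4) aff(4)])
qed

lemma flux_difference_limit:
  fixes F G H K :: "real \<Rightarrow> real"
  assumes "((\<lambda>\<delta>. F \<delta> - F' \<delta>) \<longlongrightarrow> 0) A" "((\<lambda>\<delta>. G \<delta> - G' \<delta>) \<longlongrightarrow> 0) A"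
    "((\<lambda>\<delta>. H \<delta> - H' \<delta>) \<longlongrightarrow> 0) A" "((\<lambda>\<delta>. K \<delta> - K' \<delta>) \<longlongrightarrow> 0) A"
  shows "((\<lambda>\<delta>. (- (F \<delta> - G \<delta>) / h - (H \<delta> - K \<delta>) / h)
      - (- (F' \<delta> - G' \<delta>) / h - (H' \<delta> - K' \<delta>) / h)) \<longlongrightarrow> 0) A"
proof -
  have "((\<lambda>\<delta>. - ((F \<delta> - F' \<delta>) - (G \<delta> - G' \<delta>) + ((H \<delta> - H' \<delta>) - (K \<delta> - K' \<delta>))) * (1 / h))
      \<longlongrightarrow> - ((0 - 0) + (0 - 0)) * (1 / h)) A"
    by (intro tendsto_intros assms)
  then show ?thesis
    by (simp add: diff_divide_distrib add_divide_distrib algebra_simps)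
qed

lemma
  assumes P: "valid_params P" and C: "low_mach C" and S: "near_state P S S0" and S0: "uniform_density P S0 r0"
  shows conv_mx_limit: "a < cells P - 1 \<Longrightarrow> b < cells P \<Longrightarrow>
      ((\<lambda>\<delta>. conv_mx (P\<lparr>cp1 := C \<delta>\<rparr>) (S \<delta>) $$ (a, b) - conv_mx (P\<lparr>cp1 := C \<delta>\<rparr>) S0 $$ (a, b))
        \<longlongrightarrow> 0) (at_right 0)"
    and conv_my_limit: "a < cells P \<Longrightarrow> b < cells P - 1 \<Longrightarrow>
      ((\<lambda>\<delta>. conv_my (P\<lparr>cp1 := C \<delta>\<rparr>) (S \<delta>) $$ (a, b) - conv_my (P\<lparr>cp1 := C \<delta>\<rparr>) S0 $$ (a, b))
        \<longlongrightarrow> 0) (at_right 0)"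
    and conv_c_limit: "a < cells P \<Longrightarrow> b < cells P \<Longrightarrow>
      ((\<lambda>\<delta>. conv_c (P\<lparr>cp1 := C \<delta>\<rparr>) (S \<delta>) $$ (a, b) - conv_c (P\<lparr>cp1 := C \<delta>\<rparr>) S0 $$ (a, b))
        \<longlongrightarrow> 0) (at_right 0)"
proof -
  note lim = F_mx_limit F_my_limit F_c_limit
  note lims = lim[OF P C S S0] lim[OF P C near_state_swap[OF S] uniform_swap[OF S0]]
  show "((\<lambda>\<delta>. conv_mx (P\<lparr>cp1 := C \<delta>\<rparr>) (S \<delta>) $$ (a, b) - conv_mx (P\<lparr>cp1 := C \<delta>\<rparr>) S0 $$ (a, b))
        \<longlongrightarrow> 0) (at_right 0)" if "a < cells P - 1" "b < cells P"
    unfolding conv_index(1)[of a "P\<lparr>cp1 := _\<rparr>", unfolded cells_cp1, OF that] cp1_update_simps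
    by (intro flux_difference_limit lims)
  show "((\<lambda>\<delta>. conv_my (P\<lparr>cp1 := C \<delta>\<rparr>) (S \<delta>) $$ (a, b) - conv_my (P\<lparr>cp1 := C \<delta>\<rparr>) S0 $$ (a, b))
        \<longlongrightarrow> 0) (at_right 0)" if "a < cells P" "b < cells P - 1"
    unfolding conv_index(2)[of a "P\<lparr>cp1 := _\<rparr>", unfolded cells_cp1, OF that] cp1_update_simps
    by (intro flux_difference_limit lims)
  show "((\<lambda>\<delta>. conv_c (P\<lparr>cp1 := C \<delta>\<rparr>) (S \<delta>) $$ (a, b) - conv_c (P\<lparr>cp1 := C \<delta>\<rparr>) S0 $$ (a, b))
        \<longlongrightarrow> 0) (at_right 0)" if "a < cells P" "b < cells P"
    unfolding conv_index(3)[of a "P\<lparr>cp1 := _\<rparr>", unfolded cells_cp1, OF that] cp1_update_simps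
    by (intro flux_difference_limit lims)
qed

section \<open>Entrywise limits of matrices\<close>

text \<open>
  Limits of matrix families whose dimensions are only known for small \<open>\<delta>\<close>.
\<close>

definition mat_tendsto :: "nat \<Rightarrow> nat \<Rightarrow> (real \<Rightarrow> real mat) \<Rightarrow> real mat \<Rightarrow> bool" where
  "mat_tendsto r c F A \<longleftrightarrow> A \<in> carrier_mat r c \<and> (\<forall>\<^sub>F \<delta> in at_right 0. F \<delta> \<in> carrier_mat r c) \<and>
     (\<forall>i<r. \<forall>j<c. ((\<lambda>\<delta>. F \<delta> $$ (i, j)) \<longlongrightarrow> A $$ (i, j)) (at_right 0))"

lemma mat_tendstoD:
  assumes "mat_tendsto r c F A"
  shows "A \<in> carrier_mat r c" "\<forall>\<^sub>F \<delta> in at_right 0. F \<delta> \<in> carrier_mat r c"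
    "i < r \<Longrightarrow> j < c \<Longrightarrow> ((\<lambda>\<delta>. F \<delta> $$ (i, j)) \<longlongrightarrow> A $$ (i, j)) (at_right 0)"
  using assms by (auto simp: mat_tendsto_def)

lemma mat_tendstoI:
  assumes "A \<in> carrier_mat r c" "\<forall>\<^sub>F \<delta> in at_right 0. F \<delta> \<in> carrier_mat r c"
    "\<And>i j. i < r \<Longrightarrow> j < c \<Longrightarrow> \<forall>\<^sub>F \<delta> in at_right 0. F \<delta> $$ (i, j) = f i j \<delta>"
    "\<And>i j. i < r \<Longrightarrow> j < c \<Longrightarrow> (f i j \<longlongrightarrow> A $$ (i, j)) (at_right 0)"
  shows "mat_tendsto r c F A"
  unfolding mat_tendsto_def using assms(1,2) assms(3)[THEN tendsto_cong] assms(4) by auto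

lemma mat_tendsto_unique:
  assumes "mat_tendsto r c F A" "mat_tendsto r c F B"
  shows "A = B"
proof (rule eq_matI)
  fix i j assume "i < dim_row B" "j < dim_col B"
  then have ij: "i < r" "j < c" using mat_tendstoD(1)[OF assms(2)] by auto
  show "A $$ (i, j) = B $$ (i, j)"
    by (rule tendsto_unique[OF trivial_limit_at_right_real mat_tendstoD(3)[OF assms(1) ij] mat_tendstoD(3)[OF assms(2) ij]])
qed (use assms[THEN mat_tendstoD(1)] in auto)

lemma mat_tendsto_cong:
  assumes "mat_tendsto r c F A" "\<forall>\<^sub>F \<delta> in at_right 0. F \<delta> = G \<delta>"
  shows "mat_tendsto r c G A"
proof (rule mat_tendstoI)
  show "\<forall>\<^sub>F \<delta> in at_right 0. G \<delta> \<in> carrier_mat r c"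
    using assms(2) mat_tendstoD(2)[OF assms(1)] by eventually_elim simp
  show "\<forall>\<^sub>F \<delta> in at_right 0. G \<delta> $$ (i, j) = F \<delta> $$ (i, j)" for i j
    using assms(2) by eventually_elim simp
qed (use assms(1) in \<open>auto simp: mat_tendsto_def\<close>)

lemma mat_tendsto_const: "A \<in> carrier_mat r c \<Longrightarrow> mat_tendsto r c (\<lambda>_. A) A"
  by (simp add: mat_tendsto_def)

lemma mat_tendsto_add:
  assumes "mat_tendsto r c F A" "mat_tendsto r c G B"
  shows "mat_tendsto r c (\<lambda>\<delta>. F \<delta> + G \<delta>) (A + B)"
proof (rule mat_tendstoI[where f = "\<lambda>i j \<delta>. F \<delta> $$ (i, j) + G \<delta> $$ (i, j)"])
  show "\<forall>\<^sub>F \<delta> in at_right 0. F \<delta> + G \<delta> \<in> carrier_mat r c"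
    using mat_tendstoD(2)[OF assms(1)] mat_tendstoD(2)[OF assms(2)] by eventually_elim simp
  show "\<forall>\<^sub>F \<delta> in at_right 0. (F \<delta> + G \<delta>) $$ (i, j) = F \<delta> $$ (i, j) + G \<delta> $$ (i, j)"
    if "i < r" "j < c" for i j
    using mat_tendstoD(2)[OF assms(2)] by eventually_elim (use that in auto)
  show "((\<lambda>\<delta>. F \<delta> $$ (i, j) + G \<delta> $$ (i, j)) \<longlongrightarrow> (A + B) $$ (i, j)) (at_right 0)"
    if "i < r" "j < c" for i j
    using mat_tendstoD(1)[OF assms(2)] that
    by (auto intro!: tendsto_intros mat_tendstoD(3)[OF assms(1)] mat_tendstoD(3)[OF assms(2)])
qed (use assms in \<open>auto simp: mat_tendsto_def\<close>)

lemma mat_tendsto_smult: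
  assumes "(g \<longlongrightarrow> a) (at_right 0)" "mat_tendsto r c F A"
  shows "mat_tendsto r c (\<lambda>\<delta>. g \<delta> \<cdot>\<^sub>m F \<delta>) (a \<cdot>\<^sub>m A)"
proof (rule mat_tendstoI[where f = "\<lambda>i j \<delta>. g \<delta> * F \<delta> $$ (i, j)"])
  show "\<forall>\<^sub>F \<delta> in at_right 0. g \<delta> \<cdot>\<^sub>m F \<delta> \<in> carrier_mat r c"
    using mat_tendstoD(2)[OF assms(2)] by eventually_elim simp
  show "\<forall>\<^sub>F \<delta> in at_right 0. (g \<delta> \<cdot>\<^sub>m F \<delta>) $$ (i, j) = g \<delta> * F \<delta> $$ (i, j)"
    if "i < r" "j < c" for i j
    using mat_tendstoD(2)[OF assms(2)] by eventually_elim (use that in auto)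
  show "((\<lambda>\<delta>. g \<delta> * F \<delta> $$ (i, j)) \<longlongrightarrow> (a \<cdot>\<^sub>m A) $$ (i, j)) (at_right 0)"
    if "i < r" "j < c" for i j
    using mat_tendstoD(1)[OF assms(2)] that
    by (auto intro!: tendsto_intros assms(1) mat_tendstoD(3)[OF assms(2)])
qed (use assms in \<open>auto simp: mat_tendsto_def\<close>)

lemma mat_tendsto_uminus:
  assumes "mat_tendsto r c F A"
  shows "mat_tendsto r c (\<lambda>\<delta>. - F \<delta>) (- A)"
proof (rule mat_tendstoI[where f = "\<lambda>i j \<delta>. - F \<delta> $$ (i, j)"])
  show "\<forall>\<^sub>F \<delta> in at_right 0. - F \<delta> \<in> carrier_mat r c"
    using mat_tendstoD(2)[OF assms] by eventually_elim simp
  show "\<forall>\<^sub>F \<delta> in at_right 0. (- F \<delta>) $$ (i, j) = - F \<delta> $$ (i, j)" if "i < r" "j < c" for i j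
    using mat_tendstoD(2)[OF assms] by eventually_elim (use that in auto)
  show "((\<lambda>\<delta>. - F \<delta> $$ (i, j)) \<longlongrightarrow> (- A) $$ (i, j)) (at_right 0)" if "i < r" "j < c" for i j
    using mat_tendstoD(1)[OF assms] that
    by (auto intro!: tendsto_intros mat_tendstoD(3)[OF assms])
qed (use assms in \<open>auto simp: mat_tendsto_def\<close>)

lemma mat_tendsto_diff:
  assumes "mat_tendsto r c F A" "mat_tendsto r c G B"
  shows "mat_tendsto r c (\<lambda>\<delta>. F \<delta> - G \<delta>) (A - B)"
proof -
  have "A + - B = A - B"
    using assms by (intro eq_matI) (auto simp: mat_tendsto_def)
  moreover have "\<forall>\<^sub>F \<delta> in at_right 0. F \<delta> + - G \<delta> = F \<delta> - G \<delta>"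
    using mat_tendstoD(2)[OF assms(1)] mat_tendstoD(2)[OF assms(2)]
    by eventually_elim (intro eq_matI, auto)
  ultimately show ?thesis
    using mat_tendsto_cong[OF mat_tendsto_add[OF assms(1) mat_tendsto_uminus[OF assms(2)]]] by simp
qed

lemma mult_index_sum:
  "A \<in> carrier_mat r m \<Longrightarrow> B \<in> carrier_mat m c \<Longrightarrow> i < r \<Longrightarrow> j < c \<Longrightarrow>
    (A * B) $$ (i, j) = (\<Sum>k<m. A $$ (i, k) * B $$ (k, j))" for A :: "real mat"
  by (auto simp: scalar_prod_def atLeast0LessThan intro!: sum.cong)

lemma mat_tendsto_mult:
  assumes "mat_tendsto r m F A" "mat_tendsto m c G B"
  shows "mat_tendsto r c (\<lambda>\<delta>. F \<delta> * G \<delta>) (A * B)"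
proof (rule mat_tendstoI[where f = "\<lambda>i j \<delta>. \<Sum>k<m. F \<delta> $$ (i, k) * G \<delta> $$ (k, j)"])
  show "\<forall>\<^sub>F \<delta> in at_right 0. F \<delta> * G \<delta> \<in> carrier_mat r c"
    using mat_tendstoD(2)[OF assms(1)] mat_tendstoD(2)[OF assms(2)] by eventually_elim simp
  show "\<forall>\<^sub>F \<delta> in at_right 0. (F \<delta> * G \<delta>) $$ (i, j) = (\<Sum>k<m. F \<delta> $$ (i, k) * G \<delta> $$ (k, j))"
    if "i < r" "j < c" for i j
    using mat_tendstoD(2)[OF assms(1)] mat_tendstoD(2)[OF assms(2)]
    by eventually_elim (rule mult_index_sum, use that in auto)
  show "((\<lambda>\<delta>. \<Sum>k<m. F \<delta> $$ (i, k) * G \<delta> $$ (k, j)) \<longlongrightarrow> (A * B) $$ (i, j)) (at_right 0)"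
    if "i < r" "j < c" for i j
    unfolding mult_index_sum[OF mat_tendstoD(1)[OF assms(1)] mat_tendstoD(1)[OF assms(2)] that]
    using that by (auto intro!: tendsto_intros mat_tendstoD(3)[OF assms(1)] mat_tendstoD(3)[OF assms(2)])
qed (use assms in \<open>auto simp: mat_tendsto_def\<close>)

lemma hprod_carrier: "A \<in> carrier_mat r c \<Longrightarrow> A \<star> B \<in> carrier_mat r c"
  by (simp add: hprod_def)

lemma hprod_index: "A \<in> carrier_mat r c \<Longrightarrow> i < r \<Longrightarrow> j < c \<Longrightarrow> (A \<star> B) $$ (i, j) = A $$ (i, j) * B $$ (i, j)"
  by (simp add: hprod_def)

lemma mat_tendsto_hprod:
  assumes "mat_tendsto r c F A" "mat_tendsto r c G B"
  shows "mat_tendsto r c (\<lambda>\<delta>. F \<delta> \<star> G \<delta>) (A \<star> B)"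
proof (rule mat_tendstoI[where f = "\<lambda>i j \<delta>. F \<delta> $$ (i, j) * G \<delta> $$ (i, j)"])
  show "\<forall>\<^sub>F \<delta> in at_right 0. F \<delta> \<star> G \<delta> \<in> carrier_mat r c"
    using mat_tendstoD(2)[OF assms(1)] by eventually_elim (rule hprod_carrier)
  show "\<forall>\<^sub>F \<delta> in at_right 0. (F \<delta> \<star> G \<delta>) $$ (i, j) = F \<delta> $$ (i, j) * G \<delta> $$ (i, j)"
    if "i < r" "j < c" for i j
    using mat_tendstoD(2)[OF assms(1)] by eventually_elim (rule hprod_index, use that in auto)
  show "((\<lambda>\<delta>. F \<delta> $$ (i, j) * G \<delta> $$ (i, j)) \<longlongrightarrow> (A \<star> B) $$ (i, j)) (at_right 0)"
    if "i < r" "j < c" for i j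
    unfolding hprod_index[OF mat_tendstoD(1)[OF assms(1)] that]
    using that by (auto intro!: tendsto_intros mat_tendstoD(3)[OF assms(1)] mat_tendstoD(3)[OF assms(2)])
qed (use assms in \<open>auto simp: mat_tendsto_def hprod_carrier\<close>)

lemma mat_tendsto_map:
  assumes "mat_tendsto r c F A" "\<And>i j. i < r \<Longrightarrow> j < c \<Longrightarrow> isCont f (A $$ (i, j))"
  shows "mat_tendsto r c (\<lambda>\<delta>. map_mat f (F \<delta>)) (map_mat f A)"
proof (rule mat_tendstoI[where f = "\<lambda>i j \<delta>. f (F \<delta> $$ (i, j))"])
  show "\<forall>\<^sub>F \<delta> in at_right 0. map_mat f (F \<delta>) \<in> carrier_mat r c"
    using mat_tendstoD(2)[OF assms(1)] by eventually_elim simp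
  show "\<forall>\<^sub>F \<delta> in at_right 0. map_mat f (F \<delta>) $$ (i, j) = f (F \<delta> $$ (i, j))"
    if "i < r" "j < c" for i j
    using mat_tendstoD(2)[OF assms(1)] by eventually_elim (use that in auto)
  show "((\<lambda>\<delta>. f (F \<delta> $$ (i, j))) \<longlongrightarrow> map_mat f A $$ (i, j)) (at_right 0)"
    if "i < r" "j < c" for i j
    using mat_tendstoD(1)[OF assms(1)] that
    by (auto intro!: isCont_tendsto_compose[OF assms(2)] mat_tendstoD(3)[OF assms(1)])
qed (use assms in \<open>auto simp: mat_tendsto_def\<close>)

lemma mat_tendsto_transpose:
  assumes "mat_tendsto c r F A"
  shows "mat_tendsto r c (\<lambda>\<delta>. transpose_mat (F \<delta>)) (transpose_mat A)"
proof (rule mat_tendstoI[where f = "\<lambda>i j \<delta>. F \<delta> $$ (j, i)"])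
  show "\<forall>\<^sub>F \<delta> in at_right 0. transpose_mat (F \<delta>) \<in> carrier_mat r c"
    using mat_tendstoD(2)[OF assms] by eventually_elim simp
  show "\<forall>\<^sub>F \<delta> in at_right 0. transpose_mat (F \<delta>) $$ (i, j) = F \<delta> $$ (j, i)" if "i < r" "j < c" for i j
    using mat_tendstoD(2)[OF assms] by eventually_elim (use that in auto)
  show "((\<lambda>\<delta>. F \<delta> $$ (j, i)) \<longlongrightarrow> transpose_mat A $$ (i, j)) (at_right 0)" if "i < r" "j < c" for i j
    using mat_tendstoD(1)[OF assms] that by (auto intro!: mat_tendstoD(3)[OF assms])
qed (use assms in \<open>auto simp: mat_tendsto_def\<close>)

lemma near_state_tendsto:
  assumes "near_state P S S0"
  shows "mat_tendsto (cells P) (cells P) (\<lambda>\<delta>. dens (S \<delta>)) (dens S0)"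
    "mat_tendsto (cells P - 1) (cells P) (\<lambda>\<delta>. velx (S \<delta>)) (velx S0)"
    "mat_tendsto (cells P) (cells P - 1) (\<lambda>\<delta>. vely (S \<delta>)) (vely S0)"
    "mat_tendsto (cells P) (cells P) (\<lambda>\<delta>. conc (S \<delta>)) (conc S0)"
  using assms unfolding near_state_def mat_tendsto_def valid_state_def
  by (auto intro!: near_imp_tendsto elim!: eventually_mono)

lemma operator_carrier:
  "Dmat P n \<in> carrier_mat n (n - 1)" "Dstar P n \<in> carrier_mat n (n - 1)"
  "Dcen P n \<in> carrier_mat n n" "Amat n \<in> carrier_mat (n - 1) n"
  by (auto simp: Dmat_def Dstar_def Dcen_def Amat_def)

lemma operator_carrier':
  "DM1 P \<in> carrier_mat (cells P + 1) (cells P)" "DS1 P \<in> carrier_mat (cells P + 1) (cells P)"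
  using operator_carrier(1)[of P "cells P + 1"] operator_carrier(2)[of P "cells P + 1"] by simp_all

lemma transpose_carrier: "A \<in> carrier_mat c r \<Longrightarrow> transpose_mat A \<in> carrier_mat r c"
  by simp

lemmas mat_tendsto_intros = mat_tendsto_add mat_tendsto_diff mat_tendsto_uminus
  mat_tendsto_smult[OF tendsto_const] mat_tendsto_mult mat_tendsto_hprod mat_tendsto_map
lemmas carrier_intros = operator_carrier transpose_carrier operator_carrier'

lemma mat_tendsto_grad:
  assumes "mat_tendsto (cells P) (cells P) F A"
  shows "mat_tendsto (cells P - 1) (cells P) (\<lambda>\<delta>. grad_x P (F \<delta>)) (grad_x P A)"
    "mat_tendsto (cells P) (cells P - 1) (\<lambda>\<delta>. grad_y P (F \<delta>)) (grad_y P A)"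
  unfolding grad_x_def grad_y_def
  by (rule mat_tendsto_intros assms mat_tendsto_const carrier_intros)+

lemma mat_tendsto_divh:
  assumes "mat_tendsto (cells P - 1) (cells P) F A" "mat_tendsto (cells P) (cells P - 1) G B"
  shows "mat_tendsto (cells P) (cells P) (\<lambda>\<delta>. divh P (F \<delta>) (G \<delta>)) (divh P A B)"
  unfolding divh_def by (rule mat_tendsto_intros assms mat_tendsto_const carrier_intros)+

lemma mat_tendsto_laph:
  assumes "mat_tendsto (cells P) (cells P) F A"
  shows "mat_tendsto (cells P) (cells P) (\<lambda>\<delta>. laph P (F \<delta>)) (laph P A)"
  unfolding laph_def by (rule mat_tendsto_divh mat_tendsto_grad assms)+

lemma mat_tendsto_cap:
  assumes "mat_tendsto (cells P) (cells P) F A"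
  shows "mat_tendsto (cells P - 1) (cells P) (\<lambda>\<delta>. cap_mx P (F \<delta>)) (cap_mx P A)"
    "mat_tendsto (cells P) (cells P - 1) (\<lambda>\<delta>. cap_my P (F \<delta>)) (cap_my P A)"
  unfolding cap_mx_def cap_my_def capX_def capY_def capW_def
  by (rule mat_tendsto_intros assms mat_tendsto_const carrier_intros)+

lemma mat_tendsto_Qh:
  assumes "mat_tendsto (cells P) (cells P) F A"
  shows "mat_tendsto (cells P) (cells P) (\<lambda>\<delta>. Qh P (F \<delta>)) (Qh P A)"
proof -
  have "isCont psi2'' x" for x unfolding psi2''_def[abs_def] by (intro continuous_intros)
  show ?thesis
    unfolding Qh_def
    by (rule \<open>\<And>x. isCont psi2'' x\<close> mat_tendsto_divh mat_tendsto_intros mat_tendsto_grad assms mat_tendsto_const carrier_intros)+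
qed

lemma mat_tendsto_visc:
  assumes "mat_tendsto (cells P - 1) (cells P) (\<lambda>\<delta>. velx (S \<delta>)) (velx S0)"
    "mat_tendsto (cells P) (cells P - 1) (\<lambda>\<delta>. vely (S \<delta>)) (vely S0)"
  shows "mat_tendsto (cells P - 1) (cells P) (\<lambda>\<delta>. visc_mx P (S \<delta>)) (visc_mx P S0)"
    "mat_tendsto (cells P) (cells P - 1) (\<lambda>\<delta>. visc_my P (S \<delta>)) (visc_my P S0)"
  unfolding visc_mx_def visc_my_def
  by (rule mat_tendsto_intros assms mat_tendsto_const carrier_intros)+

lemma mat_tendsto_momentum:
  assumes "near_state P S S0"
  shows "mat_tendsto (cells P - 1) (cells P) (\<lambda>\<delta>. dens_x P (S \<delta>) \<star> velx (S \<delta>)) (dens_x P S0 \<star> velx S0)"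
    "mat_tendsto (cells P) (cells P - 1) (\<lambda>\<delta>. dens_y P (S \<delta>) \<star> vely (S \<delta>)) (dens_y P S0 \<star> vely S0)"
  unfolding dens_x_def dens_y_def
  by (rule mat_tendsto_intros near_state_tendsto[OF assms] mat_tendsto_const carrier_intros)+

lemma D_mult_index:
  assumes "A \<in> carrier_mat (cells P) c" "i < cells P - 1" "j < c"
  shows "(DMT P * A) $$ (i, j) = (A $$ (i, j) - A $$ (i + 1, j)) / mesh P"
proof -
  have "(DMT P * A) $$ (i, j) = (\<Sum>k<cells P. DMT P $$ (i, k) * A $$ (k, j))"
    by (rule mult_index_sum) (use assms carrier_intros in auto)
  also have "\<dots> = (\<Sum>k<cells P. (if k = i then A $$ (i, j) / mesh P else 0)
      + (if k = i + 1 then - A $$ (i + 1, j) / mesh P else 0))"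
    using assms(2) by (intro sum.cong) (auto simp: Dmat_def)
  also have "\<dots> = (A $$ (i, j) - A $$ (i + 1, j)) / mesh P"
    using assms(2) by (auto simp: sum.distrib sum.delta diff_divide_distrib)
  finally show ?thesis .
qed

lemma mult_D_index:
  assumes "A \<in> carrier_mat r (cells P)" "i < r" "j < cells P - 1"
  shows "(A * DM P) $$ (i, j) = (A $$ (i, j) - A $$ (i, j + 1)) / mesh P"
proof -
  have "A * DM P = transpose_mat (DMT P * transpose_mat A)"
    using assms(1) operator_carrier(1)[of P "cells P"]
    by (subst transpose_mult) auto
  then have "(A * DM P) $$ (i, j) = (DMT P * transpose_mat A) $$ (j, i)"
    using assms operator_carrier(1)[of P "cells P"] by auto
  also have "\<dots> = (A $$ (i, j) - A $$ (i, j + 1)) / mesh P"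
    using assms by (subst D_mult_index[where c = r]) auto
  finally show ?thesis .
qed

lemma const_mat_carrier: "const_mat r c x \<in> carrier_mat r c"
  by (simp add: const_mat_def)

section \<open>Dependence of the operators on the Mach number\<close>

lemma cells_at_mach [simp]: "cells (at_mach P C \<delta>) = cells P"
  by (simp add: at_mach_def)

text \<open>
  None of these operators reads \<open>cp1\<close> or \<open>delta\<close>: the Mach number enters the scheme only through the two
  pressures and the sound speed.
\<close>

lemma operator_cong:
  assumes "cells P' = cells P" "nu P' = nu P" "lame P' = lame P" "epsi P' = epsi P" "gam P' = gam P"
    "grav P' = grav P" "weno_eps P' = weno_eps P"
  shows "mesh P' = mesh P" "Dmat P' = Dmat P" "Dstar P' = Dstar P" "Dcen P' = Dcen P"
    "dens_x P' = dens_x P" "dens_y P' = dens_y P" "grad_x P' = grad_x P" "grad_y P' = grad_y P"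
    "divh P' = divh P" "laph P' = laph P" "cap_mx P' = cap_mx P" "cap_my P' = cap_my P"
    "visc_mx P' = visc_mx P" "visc_my P' = visc_my P" "Qh P' = Qh P"
    "lap_velx P' = lap_velx P" "lap_vely P' = lap_vely P" "at_density P' = at_density P"
    "conserved P' = conserved P" "pres P' = pres P"
    "rec_plus P' = rec_plus P" "rec_minus P' = rec_minus P"
proof -
  show m: "mesh P' = mesh P" using assms by (simp add: mesh_def)
  show D: "Dmat P' = Dmat P" by (auto simp: fun_eq_iff Dmat_def m)
  show S: "Dstar P' = Dstar P" by (auto simp: fun_eq_iff Dstar_def m D)
  show N: "Dcen P' = Dcen P" by (auto simp: fun_eq_iff Dcen_def m)
  show x: "dens_x P' = dens_x P" and y: "dens_y P' = dens_y P"
    using assms by (auto simp: fun_eq_iff dens_x_def dens_y_def)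
  show gx: "grad_x P' = grad_x P" and gy: "grad_y P' = grad_y P" and d: "divh P' = divh P"
    using assms by (auto simp: fun_eq_iff grad_x_def grad_y_def divh_def D)
  show "laph P' = laph P" by (auto simp: fun_eq_iff laph_def d gx gy)
  show "cap_mx P' = cap_mx P" "cap_my P' = cap_my P"
    using assms by (auto simp: fun_eq_iff cap_mx_def cap_my_def capX_def capY_def capW_def D N)
  show "visc_mx P' = visc_mx P" "visc_my P' = visc_my P"
    using assms by (auto simp: fun_eq_iff visc_mx_def visc_my_def D S)
  show "Qh P' = Qh P" using assms by (auto simp: fun_eq_iff Qh_def d gx gy)
  show "lap_velx P' = lap_velx P" "lap_vely P' = lap_vely P"
    using assms by (auto simp: fun_eq_iff lap_velx_def lap_vely_def D S)
  show "at_density P' = at_density P"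
    using assms by (auto simp: fun_eq_iff at_density_def)
  show "conserved P' = conserved P"
  proof (intro ext)
    show "conserved P' S k = conserved P S k" for S k by (cases k) (simp_all add: x y)
  qed
  show "pres P' = pres P"
    using assms by (auto simp: fun_eq_iff pres_def)
  show "rec_plus P' = rec_plus P" "rec_minus P' = rec_minus P"
    using assms by (auto simp: fun_eq_iff rec_plus_def rec_minus_def weno5_def)
qed

lemma operator_at_mach:
  "mesh (at_mach P C \<delta>) = mesh P" "Dmat (at_mach P C \<delta>) = Dmat P"
  "dens_x (at_mach P C \<delta>) = dens_x P" "dens_y (at_mach P C \<delta>) = dens_y P" "divh (at_mach P C \<delta>) = divh P"
  "laph (at_mach P C \<delta>) = laph P" "cap_mx (at_mach P C \<delta>) = cap_mx P" "cap_my (at_mach P C \<delta>) = cap_my P"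
  "visc_mx (at_mach P C \<delta>) = visc_mx P" "visc_my (at_mach P C \<delta>) = visc_my P" "Qh (at_mach P C \<delta>) = Qh P"
  "conserved (at_mach P C \<delta>) = conserved P" "pres (at_mach P C \<delta>) = pres P"
  "grav (at_mach P C \<delta>) = grav P" "epsi (at_mach P C \<delta>) = epsi P"
  by (simp_all add: at_mach_def operator_cong[of "P\<lparr>cp1 := C \<delta>, delta := \<delta>\<rparr>" P])

lemma operator_cp1:
  "Dmat (P\<lparr>cp1 := c\<rparr>) = Dmat P" "grad_x (P\<lparr>cp1 := c\<rparr>) = grad_x P" "grad_y (P\<lparr>cp1 := c\<rparr>) = grad_y P"
  "divh (P\<lparr>cp1 := c\<rparr>) = divh P" "laph (P\<lparr>cp1 := c\<rparr>) = laph P"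
  "cap_mx (P\<lparr>cp1 := c\<rparr>) = cap_mx P" "cap_my (P\<lparr>cp1 := c\<rparr>) = cap_my P"
  "lap_velx (P\<lparr>cp1 := c\<rparr>) = lap_velx P" "lap_vely (P\<lparr>cp1 := c\<rparr>) = lap_vely P" "Qh (P\<lparr>cp1 := c\<rparr>) = Qh P"
  "at_density (P\<lparr>cp1 := c\<rparr>) = at_density P"
  by (simp_all add: operator_cong[of "P\<lparr>cp1 := c\<rparr>" P])

lemma flux_delta: "F_mx (P\<lparr>delta := d\<rparr>) = F_mx P" "F_my (P\<lparr>delta := d\<rparr>) = F_my P" "F_c (P\<lparr>delta := d\<rparr>) = F_c P"
  "visc_x (P\<lparr>delta := d\<rparr>) = visc_x P"
proof -
  have r: "rho_at (P\<lparr>delta := d\<rparr>) = rho_at P" and c: "c_at (P\<lparr>delta := d\<rparr>) = c_at P"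
    and v1: "v1_at (P\<lparr>delta := d\<rparr>) = v1_at P" and v2: "v2_at (P\<lparr>delta := d\<rparr>) = v2_at P"
    by (auto simp: fun_eq_iff rho_at_def c_at_def v1_at_def v2_at_def)
  have fx: "rho_fx (P\<lparr>delta := d\<rparr>) = rho_fx P" and fy: "rho_fy (P\<lparr>delta := d\<rparr>) = rho_fy P"
    and cen: "v1_cen (P\<lparr>delta := d\<rparr>) = v1_cen P" and v1fy: "v1_fy (P\<lparr>delta := d\<rparr>) = v1_fy P"
    by (auto simp: fun_eq_iff rho_fx_def rho_fy_def v1_cen_def v1_fy_def r v1)
  have rp: "rec_plus (P\<lparr>delta := d\<rparr>) = rec_plus P" and rm: "rec_minus (P\<lparr>delta := d\<rparr>) = rec_minus P"
    by (simp_all add: operator_cong[of "P\<lparr>delta := d\<rparr>" P])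
  have p: "pres1 (P\<lparr>delta := d\<rparr>) = pres1 P" and s: "sound (P\<lparr>delta := d\<rparr>) = sound P"
    by (auto simp: fun_eq_iff pres1_def pres_def sound_def pres_deriv_def)
  have v: "viscosity (P\<lparr>delta := d\<rparr>) = viscosity P"
    by (auto simp: fun_eq_iff viscosity_def rp rm s)
  then have "rusanov (P\<lparr>delta := d\<rparr>) = rusanov P"
    by (auto simp: fun_eq_iff rusanov_def rp rm)
  then show "F_mx (P\<lparr>delta := d\<rparr>) = F_mx P" "F_my (P\<lparr>delta := d\<rparr>) = F_my P" "F_c (P\<lparr>delta := d\<rparr>) = F_c P"
    by (auto simp: fun_eq_iff F_mx_def F_my_def F_c_def r c v1 v2 fx fy cen v1fy p)
  show "visc_x (P\<lparr>delta := d\<rparr>) = visc_x P"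
    by (auto simp: fun_eq_iff visc_x_def v r cen)
qed

lemma explicit_at_mach:
  "conv_mx (at_mach P C \<delta>) = conv_mx (P\<lparr>cp1 := C \<delta>\<rparr>)" "conv_my (at_mach P C \<delta>) = conv_my (P\<lparr>cp1 := C \<delta>\<rparr>)"
  "conv_c (at_mach P C \<delta>) = conv_c (P\<lparr>cp1 := C \<delta>\<rparr>)"
  "visc_x (at_mach P C \<delta>) = visc_x (P\<lparr>cp1 := C \<delta>\<rparr>)" "visc_y (at_mach P C \<delta>) = visc_y (P\<lparr>cp1 := C \<delta>\<rparr>)"
  by (auto simp: fun_eq_iff conv_mx_def conv_my_def conv_c_def G_mx_def G_my_def G_c_def visc_y_def
      at_mach_def flux_delta mesh_def)

lemma conv_carrier:
  "conv_mx P S \<in> carrier_mat (cells P - 1) (cells P)" "conv_my P S \<in> carrier_mat (cells P) (cells P - 1)"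
  "conv_c P S \<in> carrier_mat (cells P) (cells P)"
  by (simp_all add: conv_mx_def conv_my_def conv_c_def)

text \<open>
  Since \<open>cp2 = (1 - C * \<delta>) / \<delta>\<close>, the bound \<open>C \<le> k * cp2\<close> reads \<open>C * \<delta> \<le> k * \<bar>1 - C * \<delta>\<bar>\<close>, which for small \<open>k\<close>
  can be solved for \<open>C * \<delta>\<close>.
\<close>

lemma low_mach_if_smallo:
  assumes "\<forall>\<^sub>F \<delta> in at_right 0. 0 < C \<delta>" "C \<in> o[at_right 0](\<lambda>\<delta>. cp2 (at_mach P C \<delta>))"
  shows "low_mach C"
proof -
  have "\<forall>\<^sub>F \<delta> in at_right 0. dist (C \<delta> * \<delta>) 0 < e" if "0 < e" for e
  proof -
    \<comment> \<open>For \<open>k \<le> 1 / 2\<close> the estimate below gives \<open>C * \<delta> \<le> 2 * k < e\<close>.\<close>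
    define k where "k = min (1 / 2) (e / 3)"
    have k: "0 < k" "k \<le> 1 / 2" "2 * k < e" using that by (auto simp: k_def)
    have "\<forall>\<^sub>F \<delta> in at_right 0. norm (C \<delta>) \<le> k * norm (cp2 (at_mach P C \<delta>))"
      using landau_o.smallD[OF assms(2) k(1)] .
    with assms(1) eventually_at_right_less[of 0] show ?thesis
    proof eventually_elim
      case (elim \<delta>)
      then have "C \<delta> * \<delta> \<le> k * \<bar>1 - C \<delta> * \<delta>\<bar>"
        by (simp add: cp2_def at_mach_def field_simps)
      also have "\<dots> \<le> k * (1 + C \<delta> * \<delta>)"
        using elim k(1) by (intro mult_left_mono) (auto simp: abs_if)
      also have "\<dots> \<le> k + 1 / 2 * (C \<delta> * \<delta>)"
        using mult_right_mono[OF k(2), of "C \<delta> * \<delta>"] elim by (simp add: algebra_simps)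
      finally have "C \<delta> * \<delta> \<le> 2 * k" by simp
      then show ?case using elim k(3) by (simp add: dist_real_def)
    qed
  qed
  then have "((\<lambda>\<delta>. C \<delta> * \<delta>) \<longlongrightarrow> 0) (at_right 0)" by (rule tendstoI)
  with assms(1) show ?thesis by (auto simp: low_mach_def elim: eventually_mono)
qed

lemma low_mach_cp2:
  assumes "low_mach C"
  shows "((\<lambda>\<delta>. \<delta> * cp2 (at_mach P C \<delta>)) \<longlongrightarrow> 1) (at_right 0)"
proof -
  have "((\<lambda>\<delta>. 1 - C \<delta> * \<delta>) \<longlongrightarrow> 1 - 0) (at_right 0)"
    using assms unfolding low_mach_def by (intro tendsto_intros) auto
  moreover have "\<forall>\<^sub>F \<delta> in at_right 0. 1 - C \<delta> * \<delta> = \<delta> * cp2 (at_mach P C \<delta>)"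
    using eventually_at_right_less[of 0] by eventually_elim (simp add: cp2_def at_mach_def)
  ultimately show ?thesis using Lim_transform_eventually by fastforce
qed

lemma pres2_mult:
  assumes "R \<in> carrier_mat (cells P) (cells P)"
  shows "DMT P * map_mat (pres2 (at_mach P C \<delta>)) R = cp2 (at_mach P C \<delta>) \<cdot>\<^sub>m (DMT P * map_mat (pres P) R)"
    "map_mat (pres2 (at_mach P C \<delta>)) R * DM P = cp2 (at_mach P C \<delta>) \<cdot>\<^sub>m (map_mat (pres P) R * DM P)"
proof -
  have eq: "map_mat (pres2 (at_mach P C \<delta>)) R = cp2 (at_mach P C \<delta>) \<cdot>\<^sub>m map_mat (pres P) R"
    by (rule eq_matI) (auto simp: pres2_def operator_at_mach)
  show "DMT P * map_mat (pres2 (at_mach P C \<delta>)) R = cp2 (at_mach P C \<delta>) \<cdot>\<^sub>m (DMT P * map_mat (pres P) R)"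
    unfolding eq by (rule mult_smult_distrib) (use assms carrier_intros in auto)
  show "map_mat (pres2 (at_mach P C \<delta>)) R * DM P = cp2 (at_mach P C \<delta>) \<cdot>\<^sub>m (map_mat (pres P) R * DM P)"
    unfolding eq by (rule mult_smult_assoc_mat) (use assms carrier_intros in auto)
qed

section \<open>The mass equation\<close>

lemma near_D_mult:
  assumes P: "valid_params P" and T: "near_state P T T0" and T0: "uniform_density P T0 r0"
    and "i < cells P - 1" "j < cells P"
  shows "near (\<lambda>\<delta>. (DMT P * dens (T \<delta>)) $$ (i, j)) 0"
proof -
  have *: "near (\<lambda>\<delta>. dens (T \<delta>) $$ (a, b)) r0" if "a < cells P" "b < cells P" for a b
    using T T0 that by (auto simp: near_state_def uniform_density_def const_mat_def)
  have "near (\<lambda>\<delta>. (dens (T \<delta>) $$ (i, j) - dens (T \<delta>) $$ (i + 1, j)) * (1 / mesh P)) ((r0 - r0) * (1 / mesh P))"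
    by (intro near.arith_intros *) (use assms in auto)
  moreover have "\<forall>\<^sub>F \<delta> in at_right 0. (dens (T \<delta>) $$ (i, j) - dens (T \<delta>) $$ (i + 1, j)) * (1 / mesh P)
      = (DMT P * dens (T \<delta>)) $$ (i, j)"
    using mat_tendstoD(2)[OF near_state_tendsto(1)[OF T]]
    by eventually_elim (use assms in \<open>simp add: D_mult_index[of _ P "cells P"]\<close>)
  ultimately show ?thesis using near_cong by fastforce
qed

text \<open>
  The viscosity grows at most like \<open>sqrt C\<close> while the density differences are \<open>O(\<delta>)\<close>.
\<close>

lemma mass_viscosity_limit:
  assumes P: "valid_params P" and C: "low_mach C" and T: "near_state P T T0" and T0: "uniform_density P T0 r0"
  shows "mat_tendsto (cells P - 1) (cells P)
    (\<lambda>\<delta>. visc_x (P\<lparr>cp1 := C \<delta>\<rparr>) (T \<delta>) \<star> (DMT P * dens (T \<delta>))) (0\<^sub>m (cells P - 1) (cells P))"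
proof (rule mat_tendstoI)
  show "\<forall>\<^sub>F \<delta> in at_right 0. visc_x (P\<lparr>cp1 := C \<delta>\<rparr>) (T \<delta>) \<star> (DMT P * dens (T \<delta>)) \<in> carrier_mat (cells P - 1) (cells P)"
    by (intro always_eventually allI hprod_carrier) (simp add: visc_x_def)
next
  fix i j assume ij: "i < cells P - 1" "j < cells P"
  define V where "V \<delta> = viscosity (P\<lparr>cp1 := C \<delta>\<rparr>) (\<lambda>k. v1_cen P (T \<delta>) k (int j + 1))
      (\<lambda>k. rho_at P (T \<delta>) k (int j + 1)) (int i + 1)" for \<delta>
  show "\<forall>\<^sub>F \<delta> in at_right 0. (visc_x (P\<lparr>cp1 := C \<delta>\<rparr>) (T \<delta>) \<star> (DMT P * dens (T \<delta>))) $$ (i, j)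
      = V \<delta> * (DMT P * dens (T \<delta>)) $$ (i, j)"
    using ij by (simp add: hprod_def visc_x_def V_def Let_def)
  have eps: "0 < weno_eps P" using P by (simp add: valid_params_def)
  define V0 where "V0 \<delta> = viscosity (P\<lparr>cp1 := C \<delta>\<rparr>) (\<lambda>k. v1_cen P T0 k (int j + 1)) (\<lambda>k. r0) (int i + 1)" for \<delta>
  note D = near_D_mult[OF P T T0 ij]
  have V: "((\<lambda>\<delta>. V \<delta> - V0 \<delta>) \<longlongrightarrow> 0) (at_right 0)"
    unfolding V_def V0_def
    by (intro viscosity_limit P C near_v1_cen T)
      (use T0 near_rho_at[OF P T] in \<open>auto simp: uniform_density_def uniform_rho(1)[OF P T0]\<close>)
  define m where "m = max \<bar>rec_plus P (\<lambda>k. v1_cen P T0 k (int j + 1)) (int i + 1 + 1)\<bar>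
      \<bar>rec_minus P (\<lambda>k. v1_cen P T0 k (int j + 1)) (int i + 1)\<bar>"
  have V0: "V0 \<delta> = m + sqrt (C \<delta>) * unit_sound P r0" for \<delta>
    by (simp add: V0_def m_def viscosity_uniform[OF eps])
  have "((\<lambda>\<delta>. (V \<delta> - V0 \<delta>) * (DMT P * dens (T \<delta>)) $$ (i, j) + m * (DMT P * dens (T \<delta>)) $$ (i, j)
      + unit_sound P r0 * (sqrt (C \<delta>) * ((DMT P * dens (T \<delta>)) $$ (i, j) - 0))) \<longlongrightarrow> 0 * 0 + m * 0 + unit_sound P r0 * 0) (at_right 0)"
    by (intro tendsto_intros V near_imp_tendsto[OF D] scaled_near_tendsto_0[OF D] low_mach_sqrt[OF C])
  then show "((\<lambda>\<delta>. V \<delta> * (DMT P * dens (T \<delta>)) $$ (i, j)) \<longlongrightarrow> 0\<^sub>m (cells P - 1) (cells P) $$ (i, j)) (at_right 0)"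
    using ij by (simp add: V0 algebra_simps)
qed simp

lemma mass_viscosity_limit_y:
  assumes P: "valid_params P" and C: "low_mach C" and T: "near_state P T T0" and T0: "uniform_density P T0 r0"
  shows "mat_tendsto (cells P) (cells P - 1)
    (\<lambda>\<delta>. visc_y (P\<lparr>cp1 := C \<delta>\<rparr>) (T \<delta>) \<star> (dens (T \<delta>) * DM P)) (0\<^sub>m (cells P) (cells P - 1))"
proof -
  have "\<forall>\<^sub>F \<delta> in at_right 0.
      transpose_mat (visc_x (P\<lparr>cp1 := C \<delta>\<rparr>) (swap_state (T \<delta>)) \<star> (DMT P * dens (swap_state (T \<delta>))))
      = visc_y (P\<lparr>cp1 := C \<delta>\<rparr>) (T \<delta>) \<star> (dens (T \<delta>) * DM P)"
    using mat_tendstoD(2)[OF near_state_tendsto(1)[OF T]]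
  proof eventually_elim
    case (elim \<delta>)
    have "DMT P * transpose_mat (dens (T \<delta>)) = transpose_mat (dens (T \<delta>) * DM P)"
      using elim operator_carrier(1)[of P "cells P"] by (subst transpose_mult) auto
    then show ?case
      using elim operator_carrier(1)[of P "cells P"]
      by (intro eq_matI) (auto simp: visc_y_def hprod_def swap_state_def visc_x_def)
  qed
  from mat_tendsto_cong[OF mat_tendsto_transpose[OF mass_viscosity_limit[OF P C near_state_swap[OF T] uniform_swap[OF T0]]] this]
  show ?thesis by simp
qed

lemma rhs_Mass_limit:
  assumes P: "valid_params P" and C: "low_mach C" and T: "near_state P T T0" and T0: "uniform_density P T0 r0"
    and S: "near_state P S S0"
  shows "mat_tendsto (cells P) (cells P) (\<lambda>\<delta>. rhs (at_mach P C \<delta>) (T \<delta>) (S \<delta>) Mass)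
    (- divh P (dens_x P S0 \<star> velx S0) (dens_y P S0 \<star> vely S0))"
proof -
  let ?n = "cells P"
  have "mat_tendsto ?n ?n (\<lambda>\<delta>. rhs (at_mach P C \<delta>) (T \<delta>) (S \<delta>) Mass)
    (- divh P (dens_x P S0 \<star> velx S0) (dens_y P S0 \<star> vely S0)
      - mesh P \<cdot>\<^sub>m (DM P * 0\<^sub>m (?n - 1) ?n + 0\<^sub>m ?n (?n - 1) * DMT P))"
    unfolding rhs.simps operator_at_mach explicit_at_mach cells_at_mach
    by (rule mat_tendsto_intros mat_tendsto_divh mat_tendsto_momentum S mass_viscosity_limit[OF P C T T0]
        mass_viscosity_limit_y[OF P C T T0] mat_tendsto_const carrier_intros)+
  moreover have "DM P * 0\<^sub>m (?n - 1) ?n = 0\<^sub>m ?n ?n" "0\<^sub>m ?n (?n - 1) * DMT P = 0\<^sub>m ?n ?n"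
    using operator_carrier(1)[of P ?n] by (auto intro!: right_mult_zero_mat left_mult_zero_mat)
  moreover have "A - mesh P \<cdot>\<^sub>m (0\<^sub>m ?n ?n + 0\<^sub>m ?n ?n) = A" if "A \<in> carrier_mat ?n ?n" for A
    using that by (intro eq_matI) auto
  moreover have "- divh P (dens_x P S0 \<star> velx S0) (dens_y P S0 \<star> vely S0) \<in> carrier_mat ?n ?n"
    by (rule mat_tendstoD(1)[OF mat_tendsto_uminus[OF mat_tendsto_divh[OF mat_tendsto_momentum[OF S]]]])
  ultimately show ?thesis by simp
qed

section \<open>Averaging and difference matrices\<close>

lemma A_mult_index:
  assumes "A \<in> carrier_mat (cells P) c" "i < cells P - 1" "j < c"
  shows "(AM P * A) $$ (i, j) = (A $$ (i, j) + A $$ (i + 1, j)) / 2"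
proof -
  have "(AM P * A) $$ (i, j) = (\<Sum>k<cells P. AM P $$ (i, k) * A $$ (k, j))"
    by (rule mult_index_sum) (use assms carrier_intros in auto)
  also have "\<dots> = (\<Sum>k<cells P. (if k = i then A $$ (i, j) / 2 else 0)
      + (if k = i + 1 then A $$ (i + 1, j) / 2 else 0))"
    using assms(2) by (intro sum.cong) (auto simp: Amat_def)
  also have "\<dots> = (A $$ (i, j) + A $$ (i + 1, j)) / 2"
    using assms(2) by (auto simp: sum.distrib sum.delta add_divide_distrib)
  finally show ?thesis .
qed

lemma mult_A_index:
  assumes "A \<in> carrier_mat r (cells P)" "i < r" "j < cells P - 1"
  shows "(A * AMT P) $$ (i, j) = (A $$ (i, j) + A $$ (i, j + 1)) / 2"
proof -
  have "A * AMT P = transpose_mat (AM P * transpose_mat A)"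
    using assms(1) operator_carrier(4)[of "cells P"]
    by (subst transpose_mult) auto
  then have "(A * AMT P) $$ (i, j) = (AM P * transpose_mat A) $$ (j, i)"
    using assms operator_carrier(4)[of "cells P"] by auto
  also have "\<dots> = (A $$ (i, j) + A $$ (i, j + 1)) / 2"
    using assms by (subst A_mult_index[where c = r]) auto
  finally show ?thesis .
qed

lemma operator_dim:
  "dim_row (Dmat P n) = n" "dim_col (Dmat P n) = n - 1" "dim_row (Amat n) = n - 1" "dim_col (Amat n) = n"
  "dim_row (const_mat r c x) = r" "dim_col (const_mat r c x) = c"
  by (simp_all add: Dmat_def Amat_def const_mat_def)

lemma face_density_uniform:
  assumes "uniform_density P S r"
  shows "dens_x P S = const_mat (cells P - 1) (cells P) r" "dens_y P S = const_mat (cells P) (cells P - 1) r"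
proof -
  have d: "dens S = const_mat (cells P) (cells P) r" using assms by (simp add: uniform_density_def)
  note i = A_mult_index[OF const_mat_carrier, of _ P] mult_A_index[OF const_mat_carrier, of _ _ _ P]
  show "dens_x P S = const_mat (cells P - 1) (cells P) r"
    unfolding dens_x_def d
    by (intro eq_matI) (simp_all del: index_mult_mat(1) add: operator_dim i, simp_all add: const_mat_def)
  show "dens_y P S = const_mat (cells P) (cells P - 1) r"
    unfolding dens_y_def d
    by (intro eq_matI) (simp_all del: index_mult_mat(1) add: operator_dim i, simp_all add: const_mat_def)
qed

lemma const_matI:
  assumes "A \<in> carrier_mat r c" "\<And>i j. i < r \<Longrightarrow> j < c \<Longrightarrow> A $$ (i, j) = x"
  shows "A = const_mat r c x"
  using assms by (intro eq_matI) (simp_all add: const_mat_def)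

lemma const_mat_hprod: "A \<in> carrier_mat r c \<Longrightarrow> const_mat r c x \<star> A = x \<cdot>\<^sub>m A"
  by (intro eq_matI) (auto simp: const_mat_def hprod_def)

lemma momentum_uniform:
  assumes "uniform_density P S r" "valid_state P S"
  shows "dens_x P S \<star> velx S = r \<cdot>\<^sub>m velx S" "dens_y P S \<star> vely S = r \<cdot>\<^sub>m vely S"
    "dens S \<star> conc S = r \<cdot>\<^sub>m conc S"
  using assms(2) face_density_uniform[OF assms(1)] assms(1)
  by (auto simp: valid_state_def uniform_density_def const_mat_hprod)

lemma D_const:
  shows "DMT P * const_mat (cells P) c x = 0\<^sub>m (cells P - 1) c"
    "const_mat r (cells P) x * DM P = 0\<^sub>m r (cells P - 1)"
proof -
  note i = D_mult_index[OF const_mat_carrier, of _ P] mult_D_index[OF const_mat_carrier, of _ _ _ P]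
  show "DMT P * const_mat (cells P) c x = 0\<^sub>m (cells P - 1) c"
    by (intro eq_matI) (simp_all del: index_mult_mat(1) add: operator_dim i, simp_all add: const_mat_def)
  show "const_mat r (cells P) x * DM P = 0\<^sub>m r (cells P - 1)"
    by (intro eq_matI) (simp_all del: index_mult_mat(1) add: operator_dim i, simp_all add: const_mat_def)
qed

lemma D_mult_shift:
  assumes "A \<in> carrier_mat (cells P) c"
  shows "DMT P * (k \<cdot>\<^sub>m (A - const_mat (cells P) c x)) = k \<cdot>\<^sub>m (DMT P * A)"
proof -
  have "(DMT P * (k \<cdot>\<^sub>m (A - const_mat (cells P) c x))) $$ (i, j) = k * (DMT P * A) $$ (i, j)"
    if ij: "i < cells P - 1" "j < c" for i j
  proof -
    have "k \<cdot>\<^sub>m (A - const_mat (cells P) c x) \<in> carrier_mat (cells P) c"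
      by (intro smult_carrier_mat minus_carrier_mat const_mat_carrier)
    then show ?thesis
      unfolding D_mult_index[OF assms ij] using assms ij
      by (subst D_mult_index[OF _ ij]) (simp_all add: const_mat_def right_diff_distrib)
  qed
  then show ?thesis
    using assms by (intro eq_matI) (simp_all del: index_mult_mat(1) add: operator_dim)
qed

lemma mult_D_shift:
  assumes "A \<in> carrier_mat r (cells P)"
  shows "(k \<cdot>\<^sub>m (A - const_mat r (cells P) x)) * DM P = k \<cdot>\<^sub>m (A * DM P)"
proof -
  have "((k \<cdot>\<^sub>m (A - const_mat r (cells P) x)) * DM P) $$ (i, j) = k * (A * DM P) $$ (i, j)"
    if ij: "i < r" "j < cells P - 1" for i j
  proof -
    have "k \<cdot>\<^sub>m (A - const_mat r (cells P) x) \<in> carrier_mat r (cells P)"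
      by (intro smult_carrier_mat minus_carrier_mat const_mat_carrier)
    then show ?thesis
      unfolding mult_D_index[OF assms ij] using assms ij
      by (subst mult_D_index[OF _ ij]) (simp_all add: const_mat_def right_diff_distrib)
  qed
  then show ?thesis
    using assms by (intro eq_matI) (simp_all del: index_mult_mat(1) add: operator_dim)
qed

lemma mesh_pos: "valid_params P \<Longrightarrow> 0 < mesh P"
  by (simp add: valid_params_def mesh_def)

text \<open>
  Any two cells are connected through neighbouring cells.
\<close>

lemma const_if_D_zero:
  assumes P: "valid_params P" and A: "A \<in> carrier_mat (cells P) (cells P)"
    and x: "DMT P * A = 0\<^sub>m (cells P - 1) (cells P)" and y: "A * DM P = 0\<^sub>m (cells P) (cells P - 1)"
  shows "A = const_mat (cells P) (cells P) (A $$ (0, 0))"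
proof -
  have i: "A $$ (Suc i, j) = A $$ (i, j)" if "Suc i < cells P" "j < cells P" for i j
    using D_mult_index[OF A, of i j] that mesh_pos[OF P] unfolding x by simp
  have j: "A $$ (i, Suc j) = A $$ (i, j)" if "i < cells P" "Suc j < cells P" for i j
    using mult_D_index[OF A, of i j] that mesh_pos[OF P] unfolding y by simp
  have i0: "i < cells P \<Longrightarrow> j < cells P \<Longrightarrow> A $$ (i, j) = A $$ (0, j)" for i j
    by (induction i) (auto simp: i)
  have j0: "j < cells P \<Longrightarrow> A $$ (0, j) = A $$ (0, 0)" for j
    by (induction j) (auto simp: j)
  have "A $$ (i, j) = A $$ (0, 0)" if "i < cells P" "j < cells P" for i j
    using i0[OF that] j0[OF that(2)] by simp
  from const_matI[OF A this] show ?thesis .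
qed

lemma DM_column_sum: "k < cells P - 1 \<Longrightarrow> (\<Sum>i<cells P. DM P $$ (i, k)) = 0"
proof -
  assume k: "k < cells P - 1"
  have "(\<Sum>i<cells P. DM P $$ (i, k)) =
    (\<Sum>i<cells P. (if i = k then 1 / mesh P else 0) + (if i = k + 1 then - 1 / mesh P else 0))"
    using k by (intro sum.cong) (auto simp: Dmat_def)
  also have "\<dots> = 0" using k by (auto simp: sum.distrib sum.delta)
  finally show ?thesis .
qed

text \<open>
  No mass passes through the walls: every column of the difference matrix sums to zero.
\<close>

lemma sum_divh:
  assumes "w1 \<in> carrier_mat (cells P - 1) (cells P)" "w2 \<in> carrier_mat (cells P) (cells P - 1)"
  shows "(\<Sum>i<cells P. \<Sum>j<cells P. divh P w1 w2 $$ (i, j)) = 0"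
proof -
  let ?n = "cells P"
  note D = operator_carrier(1)[of P "cells P"]
  have "divh P w1 w2 $$ (i, j) = (\<Sum>k<?n - 1. DM P $$ (i, k) * w1 $$ (k, j)) + (\<Sum>k<?n - 1. w2 $$ (i, k) * DM P $$ (j, k))"
    if "i < ?n" "j < ?n" for i j
  proof -
    have "divh P w1 w2 $$ (i, j) = (DM P * w1) $$ (i, j) + (w2 * DMT P) $$ (i, j)"
      using assms D that by (auto simp: divh_def)
    then show ?thesis
      using that D by (simp add: mult_index_sum[OF D assms(1) that] mult_index_sum[OF assms(2) transpose_carrier[OF D] that])
  qed
  then have "(\<Sum>i<?n. \<Sum>j<?n. divh P w1 w2 $$ (i, j)) =
     (\<Sum>i<?n. \<Sum>j<?n. \<Sum>k<?n - 1. DM P $$ (i, k) * w1 $$ (k, j))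
     + (\<Sum>i<?n. \<Sum>j<?n. \<Sum>k<?n - 1. w2 $$ (i, k) * DM P $$ (j, k))"
    by (simp add: sum.distrib)
  also have "(\<Sum>i<?n. \<Sum>j<?n. \<Sum>k<?n - 1. DM P $$ (i, k) * w1 $$ (k, j))
      = (\<Sum>j<?n. \<Sum>k<?n - 1. (\<Sum>i<?n. DM P $$ (i, k)) * w1 $$ (k, j))"
    unfolding sum_distrib_right
    by (rule trans[OF sum.swap], rule sum.cong[OF refl], rule sum.swap)
  also have "\<dots> = 0" by (simp add: DM_column_sum)
  also have "(\<Sum>i<?n. \<Sum>j<?n. \<Sum>k<?n - 1. w2 $$ (i, k) * DM P $$ (j, k))
      = (\<Sum>i<?n. \<Sum>k<?n - 1. w2 $$ (i, k) * (\<Sum>j<?n. DM P $$ (j, k)))"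
    unfolding sum_distrib_left by (rule sum.cong[OF refl], rule sum.swap)
  also have "\<dots> = 0" by (simp add: DM_column_sum)
  finally show ?thesis by simp
qed

section \<open>Expansions and the stiff pressure gradient\<close>

lemma smult_smult_mat: "a \<cdot>\<^sub>m (b \<cdot>\<^sub>m A) = (a * b) \<cdot>\<^sub>m A" for A :: "real mat"
  by (intro eq_matI) auto

lemma expands_near:
  assumes "expands r c A A0 A1" "i < r" "j < c"
  shows "near (\<lambda>\<delta>. A \<delta> $$ (i, j)) (A0 $$ (i, j))"
proof -
  have "(\<lambda>\<delta>. A \<delta> $$ (i, j) - (A0 $$ (i, j) + \<delta> * A1 $$ (i, j))) \<in> O[at_right 0](\<lambda>\<delta>. \<delta>)"
    using assms by (auto simp: expands_def intro: landau_o.small_imp_big)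
  moreover have "(\<lambda>\<delta>. \<delta> * A1 $$ (i, j)) \<in> O[at_right 0](\<lambda>\<delta>. \<delta>)"
    by simp
  ultimately have "(\<lambda>\<delta>. (A \<delta> $$ (i, j) - (A0 $$ (i, j) + \<delta> * A1 $$ (i, j))) + \<delta> * A1 $$ (i, j)) \<in> O[at_right 0](\<lambda>\<delta>. \<delta>)"
    by (rule sum_in_bigo)
  then show ?thesis by (simp add: near_def algebra_simps)
qed

lemma expands_slope:
  assumes "expands r c A A0 A1" "\<forall>\<^sub>F \<delta> in at_right 0. A \<delta> \<in> carrier_mat r c"
  shows "mat_tendsto r c (\<lambda>\<delta>. (1 / \<delta>) \<cdot>\<^sub>m (A \<delta> - A0)) A1"
proof (rule mat_tendstoI)
  have A0: "A0 \<in> carrier_mat r c" and A1: "A1 \<in> carrier_mat r c"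
    using assms(1) by (auto simp: expands_def)
  show "A1 \<in> carrier_mat r c" by (rule A1)
  show "\<forall>\<^sub>F \<delta> in at_right 0. (1 / \<delta>) \<cdot>\<^sub>m (A \<delta> - A0) \<in> carrier_mat r c"
    using assms(2) by eventually_elim (use A0 in auto)
  fix i j assume ij: "i < r" "j < c"
  show "\<forall>\<^sub>F \<delta> in at_right 0. ((1 / \<delta>) \<cdot>\<^sub>m (A \<delta> - A0)) $$ (i, j)
      = (A \<delta> $$ (i, j) - (A0 $$ (i, j) + \<delta> * A1 $$ (i, j))) / \<delta> + A1 $$ (i, j)"
    using assms(2) eventually_at_right_less[of 0]
    by eventually_elim (use A0 ij in \<open>auto simp: field_simps\<close>)
  have "((\<lambda>\<delta>. (A \<delta> $$ (i, j) - (A0 $$ (i, j) + \<delta> * A1 $$ (i, j))) / \<delta>) \<longlongrightarrow> 0) (at_right 0)"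
    using assms(1) ij by (intro smalloD_tendsto) (auto simp: expands_def)
  from tendsto_add[OF this tendsto_const]
  show "((\<lambda>\<delta>. (A \<delta> $$ (i, j) - (A0 $$ (i, j) + \<delta> * A1 $$ (i, j))) / \<delta> + A1 $$ (i, j)) \<longlongrightarrow> A1 $$ (i, j)) (at_right 0)"
    by simp
qed

lemma admits_expansion_near:
  assumes "admits_expansion P S S0 S1" "\<forall>\<^sub>F \<delta> in at_right 0. valid_state P (S \<delta>)"
  shows "near_state P S S0"
proof -
  note e = assms(1)[unfolded admits_expansion_def]
  have "valid_state P S0" using e unfolding valid_state_def expands_def by blast
  then show ?thesis
    unfolding near_state_def using assms(2) e
    by (intro conjI allI impI expands_near[of "cells P" "cells P" _ _ "dens S1"]
        expands_near[of "cells P - 1" "cells P" _ _ "velx S1"]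
        expands_near[of "cells P" "cells P - 1" _ _ "vely S1"]
        expands_near[of "cells P" "cells P" _ _ "conc S1"]) blast+
qed

text \<open>
  At constant leading-order density the leading-order pressure has no discrete gradient, and
  \<open>cp2 * (p - p\<^sub>0) = (\<delta> * cp2) * ((p - p\<^sub>0) / \<delta>)\<close> with \<open>\<delta> * cp2 \<rightarrow> 1\<close> leaves the first-order pressure.
\<close>

lemma pressure_gradient_limit:
  assumes C: "low_mach C" and S: "admits_expansion P S S0 S1"
    and v: "\<forall>\<^sub>F \<delta> in at_right 0. valid_state P (S \<delta>)" and S0: "uniform_density P S0 r"
  shows "mat_tendsto (cells P - 1) (cells P)
      (\<lambda>\<delta>. DMT P * map_mat (pres2 (at_mach P C \<delta>)) (dens (S \<delta>))) (DMT P * pres_first_order P S0 S1)"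
    "mat_tendsto (cells P) (cells P - 1)
      (\<lambda>\<delta>. map_mat (pres2 (at_mach P C \<delta>)) (dens (S \<delta>)) * DM P) (pres_first_order P S0 S1 * DM P)"
proof -
  let ?n = "cells P"
  define p where "p \<delta> = map_mat (pres P) (dens (S \<delta>))" for \<delta>
  define p0 where "p0 = const_mat ?n ?n (pres P r)"
  have p0: "map_mat (pres P) (dens S0) = p0"
    using S0 by (auto simp: uniform_density_def p0_def const_mat_def intro!: eq_matI)
  have pc: "\<forall>\<^sub>F \<delta> in at_right 0. p \<delta> \<in> carrier_mat ?n ?n"
    using v by eventually_elim (auto simp: p_def valid_state_def)
  have slope: "mat_tendsto ?n ?n (\<lambda>\<delta>. (1 / \<delta>) \<cdot>\<^sub>m (p \<delta> - p0)) (pres_first_order P S0 S1)"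
    using S pc unfolding admits_expansion_def p0 by (intro expands_slope) (auto simp: p_def)
  have lim: "mat_tendsto ?n ?n (\<lambda>\<delta>. (\<delta> * cp2 (at_mach P C \<delta>)) \<cdot>\<^sub>m ((1 / \<delta>) \<cdot>\<^sub>m (p \<delta> - p0)))
      (1 \<cdot>\<^sub>m pres_first_order P S0 S1)"
    by (rule mat_tendsto_smult[OF low_mach_cp2[OF C] slope])
  have one: "1 \<cdot>\<^sub>m pres_first_order P S0 S1 = pres_first_order P S0 S1"
    by (intro eq_matI) auto
  have eq: "\<forall>\<^sub>F \<delta> in at_right 0. p \<delta> \<in> carrier_mat ?n ?n \<and>
     (\<delta> * cp2 (at_mach P C \<delta>)) \<cdot>\<^sub>m ((1 / \<delta>) \<cdot>\<^sub>m (p \<delta> - p0)) = cp2 (at_mach P C \<delta>) \<cdot>\<^sub>m (p \<delta> - p0)"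
    using pc eventually_at_right_less[of 0]
    by eventually_elim (intro conjI eq_matI, auto)
  have p0c: "p0 \<in> carrier_mat ?n ?n" by (simp add: p0_def const_mat_carrier)
  note D = operator_carrier(1)[of P "cells P"]
  have "\<forall>\<^sub>F \<delta> in at_right 0. DMT P * ((\<delta> * cp2 (at_mach P C \<delta>)) \<cdot>\<^sub>m ((1 / \<delta>) \<cdot>\<^sub>m (p \<delta> - p0)))
      = DMT P * map_mat (pres2 (at_mach P C \<delta>)) (dens (S \<delta>))"
    using eq v
  proof eventually_elim
    case (elim \<delta>)
    then show ?case
      by (simp add: pres2_mult p_def p0_def valid_state_def D_mult_shift)
  qed
  from mat_tendsto_cong[OF mat_tendsto_mult[OF mat_tendsto_const[OF transpose_carrier[OF D]] lim] this]
  show "mat_tendsto (?n - 1) ?n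
      (\<lambda>\<delta>. DMT P * map_mat (pres2 (at_mach P C \<delta>)) (dens (S \<delta>))) (DMT P * pres_first_order P S0 S1)"
    by (simp add: one)
  have "\<forall>\<^sub>F \<delta> in at_right 0. ((\<delta> * cp2 (at_mach P C \<delta>)) \<cdot>\<^sub>m ((1 / \<delta>) \<cdot>\<^sub>m (p \<delta> - p0))) * DM P
      = map_mat (pres2 (at_mach P C \<delta>)) (dens (S \<delta>)) * DM P"
    using eq v
  proof eventually_elim
    case (elim \<delta>)
    then show ?case
      by (simp add: pres2_mult p_def p0_def valid_state_def mult_D_shift)
  qed
  from mat_tendsto_cong[OF mat_tendsto_mult[OF lim mat_tendsto_const[OF D]] this]
  show "mat_tendsto ?n (?n - 1)
      (\<lambda>\<delta>. map_mat (pres2 (at_mach P C \<delta>)) (dens (S \<delta>)) * DM P) (pres_first_order P S0 S1 * DM P)"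
    by (simp add: one)
qed

text \<open>
  For an arbitrary leading-order density the gradient is of size \<open>1 / \<delta>\<close>, with the gradient of the
  leading-order pressure as coefficient.
\<close>

lemma scaled_pressure_gradient_limit:
  assumes C: "low_mach C" and S: "near_state P S S0" and pos: "pos_dens P S0"
  shows "mat_tendsto (cells P - 1) (cells P)
      (\<lambda>\<delta>. \<delta> \<cdot>\<^sub>m (DMT P * map_mat (pres2 (at_mach P C \<delta>)) (dens (S \<delta>)))) (DMT P * map_mat (pres P) (dens S0))"
    "mat_tendsto (cells P) (cells P - 1)
      (\<lambda>\<delta>. \<delta> \<cdot>\<^sub>m (map_mat (pres2 (at_mach P C \<delta>)) (dens (S \<delta>)) * DM P)) (map_mat (pres P) (dens S0) * DM P)"
proof -
  let ?n = "cells P"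
  have "isCont (pres P) x" if "0 < x" for x
    unfolding pres_def[abs_def] using that by (auto intro!: continuous_intros)
  then have lim: "mat_tendsto ?n ?n (\<lambda>\<delta>. map_mat (pres P) (dens (S \<delta>))) (map_mat (pres P) (dens S0))"
    using pos by (intro mat_tendsto_map near_state_tendsto[OF S]) (auto simp: pos_dens_def)
  have one: "1 \<cdot>\<^sub>m A = A" for A :: "real mat" by (intro eq_matI) auto
  note D = operator_carrier(1)[of P "cells P"]
  note v = mat_tendstoD(2)[OF near_state_tendsto(1)[OF S]]
  have "\<forall>\<^sub>F \<delta> in at_right 0. (\<delta> * cp2 (at_mach P C \<delta>)) \<cdot>\<^sub>m (DMT P * map_mat (pres P) (dens (S \<delta>)))
      = \<delta> \<cdot>\<^sub>m (DMT P * map_mat (pres2 (at_mach P C \<delta>)) (dens (S \<delta>)))"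
    using v by eventually_elim (simp add: pres2_mult smult_smult_mat)
  from mat_tendsto_cong[OF mat_tendsto_smult[OF low_mach_cp2[OF C]
    mat_tendsto_mult[OF mat_tendsto_const[OF transpose_carrier[OF D]] lim]] this]
  show "mat_tendsto (?n - 1) ?n
      (\<lambda>\<delta>. \<delta> \<cdot>\<^sub>m (DMT P * map_mat (pres2 (at_mach P C \<delta>)) (dens (S \<delta>)))) (DMT P * map_mat (pres P) (dens S0))"
    by (simp add: one)
  have "\<forall>\<^sub>F \<delta> in at_right 0. (\<delta> * cp2 (at_mach P C \<delta>)) \<cdot>\<^sub>m (map_mat (pres P) (dens (S \<delta>)) * DM P)
      = \<delta> \<cdot>\<^sub>m (map_mat (pres2 (at_mach P C \<delta>)) (dens (S \<delta>)) * DM P)"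
    using v by eventually_elim (simp add: pres2_mult smult_smult_mat)
  from mat_tendsto_cong[OF mat_tendsto_smult[OF low_mach_cp2[OF C]
    mat_tendsto_mult[OF lim mat_tendsto_const[OF D]]] this]
  show "mat_tendsto ?n (?n - 1)
      (\<lambda>\<delta>. \<delta> \<cdot>\<^sub>m (map_mat (pres2 (at_mach P C \<delta>)) (dens (S \<delta>)) * DM P)) (map_mat (pres P) (dens S0) * DM P)"
    by (simp add: one)
qed

text \<open>
  The pressure law is strictly increasing on positive densities.
\<close>

lemma uniform_density_if_pressure_const:
  assumes P: "valid_params P" and v: "valid_state P S" and pos: "pos_dens P S"
    and x: "DMT P * map_mat (pres P) (dens S) = 0\<^sub>m (cells P - 1) (cells P)"
    and y: "map_mat (pres P) (dens S) * DM P = 0\<^sub>m (cells P) (cells P - 1)"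
  shows "uniform_density P S (dens S $$ (0, 0))"
proof -
  let ?n = "cells P"
  have n: "0 < ?n" using P by (simp add: valid_params_def)
  have d: "dens S \<in> carrier_mat ?n ?n" using v by (simp add: valid_state_def)
  from const_if_D_zero[OF P _ x y] have c: "map_mat (pres P) (dens S) = const_mat ?n ?n (map_mat (pres P) (dens S) $$ (0, 0))"
    using d by simp
  have "dens S $$ (i, j) = dens S $$ (0, 0)" if ij: "i < ?n" "j < ?n" for i j
  proof -
    have "pres P (dens S $$ (i, j)) = pres P (dens S $$ (0, 0))"
      using arg_cong[OF c, of "\<lambda>A. A $$ (i, j)"] d ij n by (simp add: const_mat_def)
    moreover have "0 < dens S $$ (i, j)" "0 < dens S $$ (0, 0)" using pos ij n by (auto simp: pos_dens_def)
    ultimately show ?thesis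
      using P powr_less_mono2[of "gam P" "dens S $$ (i, j)" "dens S $$ (0, 0)"]
        powr_less_mono2[of "gam P" "dens S $$ (0, 0)" "dens S $$ (i, j)"]
      by (cases "dens S $$ (i, j)" "dens S $$ (0, 0)" rule: linorder_cases)
        (auto simp: pres_def valid_params_def)
  qed
  from const_matI[OF d this] have "dens S = const_mat ?n ?n (dens S $$ (0, 0))" .
  then show ?thesis
    using n pos by (simp add: uniform_density_def pos_dens_def)
qed

section \<open>Limits of the right-hand sides\<close>

text \<open>
  The explicit pressure constant of the limit scheme has to be the right one for all entries, equations
  and stages at once, hence the quantification over \<open>X\<close>, \<open>Y\<close> and \<open>L\<close>.
\<close>

definition limit_coefficient :: "(real \<Rightarrow> real) \<Rightarrow> real \<Rightarrow> bool" where
  "limit_coefficient C c0 \<longleftrightarrow> 0 \<le> c0 \<and>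
     (\<forall>X Y L. ((\<lambda>\<delta>. X + sqrt (C \<delta>) * Y) \<longlongrightarrow> L) (at_right 0) \<longrightarrow> L = X + sqrt c0 * Y)"

text \<open>
  If \<open>C\<close> converges, take its limit. Otherwise \<open>X + sqrt C * Y\<close> can converge only for \<open>Y = 0\<close>, because for
  \<open>Y \<noteq> 0\<close> one could solve it for \<open>C\<close>; then any value will do.
\<close>

lemma limit_coefficient_exists:
  assumes "\<forall>\<^sub>F \<delta> in at_right 0. 0 \<le> C \<delta>"
  shows "\<exists>c0. limit_coefficient C c0 \<and> (\<forall>c. (C \<longlongrightarrow> c) (at_right 0) \<longrightarrow> c0 = c)"
proof (cases "\<exists>c. (C \<longlongrightarrow> c) (at_right 0)")
  case True
  then obtain c where c: "(C \<longlongrightarrow> c) (at_right 0)" by blast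
  have "0 \<le> c" by (rule tendsto_lowerbound[OF c assms]) simp
  moreover have "L = X + sqrt c * Y" if "((\<lambda>\<delta>. X + sqrt (C \<delta>) * Y) \<longlongrightarrow> L) (at_right 0)" for X Y L
    by (rule tendsto_unique[OF _ that]) (auto intro!: tendsto_intros c)
  moreover have "c = c'" if "(C \<longlongrightarrow> c') (at_right 0)" for c'
    by (rule tendsto_unique[OF _ c that]) simp
  ultimately show ?thesis unfolding limit_coefficient_def by blast
next
  case False
  have "L = X + sqrt 0 * Y" if lim: "((\<lambda>\<delta>. X + sqrt (C \<delta>) * Y) \<longlongrightarrow> L) (at_right 0)" for X Y L
  proof -
    have "Y = 0"
    proof (rule ccontr)
      assume Y: "Y \<noteq> 0"
      have "((\<lambda>\<delta>. ((X + sqrt (C \<delta>) * Y - X) / Y)\<^sup>2) \<longlongrightarrow> ((L - X) / Y)\<^sup>2) (at_right 0)"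
        by (intro tendsto_intros lim Y)
      moreover have "\<forall>\<^sub>F \<delta> in at_right 0. ((X + sqrt (C \<delta>) * Y - X) / Y)\<^sup>2 = C \<delta>"
        using assms by eventually_elim (simp add: Y)
      ultimately have "(C \<longlongrightarrow> ((L - X) / Y)\<^sup>2) (at_right 0)"
        by (rule Lim_transform_eventually)
      with False show False by blast
    qed
    \<comment> \<open>For \<open>Y = 0\<close> the expression does not involve \<open>C\<close> at all.\<close>
    with lim have "((\<lambda>\<delta>. X) \<longlongrightarrow> L) (at_right (0 :: real))" by simp
    then have "L = X" by (intro tendsto_unique[OF _ _ tendsto_const]) simp_all
    with \<open>Y = 0\<close> show ?thesis by simp
  qed
  with False show ?thesis unfolding limit_coefficient_def by (intro exI[of _ 0]) auto
qed

text \<open>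
  Convergence of the convective term itself is assumed here. It will come from the momentum and
  concentration equations, in which all the other terms converge.
\<close>

lemma convective_limit:
  assumes c0: "limit_coefficient C c0"
    and diff: "\<And>i j. i < r \<Longrightarrow> j < c \<Longrightarrow>
      ((\<lambda>\<delta>. F \<delta> $$ (i, j) - G (C \<delta>) $$ (i, j)) \<longlongrightarrow> 0) (at_right 0)"
    and aff: "\<And>i j. i < r \<Longrightarrow> j < c \<Longrightarrow> affine_in_sqrt (\<lambda>c. G c $$ (i, j))"
    and G: "G c0 \<in> carrier_mat r c" and F: "mat_tendsto r c F L"
  shows "mat_tendsto r c F (G c0)"
proof -
  have "L $$ (i, j) = G c0 $$ (i, j)" if ij: "i < r" "j < c" for i j
  proof -
    obtain X Y where XY: "\<And>c. G c $$ (i, j) = X + sqrt c * Y"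
      using aff[OF ij] by (auto simp: affine_in_sqrt_def)
    have "((\<lambda>\<delta>. F \<delta> $$ (i, j) - (F \<delta> $$ (i, j) - G (C \<delta>) $$ (i, j))) \<longlongrightarrow> L $$ (i, j) - 0) (at_right 0)"
      by (intro tendsto_intros mat_tendstoD(3)[OF F] diff ij)
    then have "((\<lambda>\<delta>. X + sqrt (C \<delta>) * Y) \<longlongrightarrow> L $$ (i, j)) (at_right 0)"
      by (simp add: XY)
    then show ?thesis
      using c0 by (auto simp: limit_coefficient_def XY)
  qed
  then have "L = G c0"
    using G mat_tendstoD(1)[OF F] by (intro eq_matI) auto
  with F show ?thesis by simp
qed

text \<open>
  Even an unbounded convective term is \<open>O(1 + sqrt C) = o(1 / \<delta>)\<close>.
\<close>

lemma scaled_convective_limit: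
  assumes C: "low_mach C"
    and diff: "\<And>i j. i < r \<Longrightarrow> j < c \<Longrightarrow>
      ((\<lambda>\<delta>. F \<delta> $$ (i, j) - G (C \<delta>) $$ (i, j)) \<longlongrightarrow> 0) (at_right 0)"
    and aff: "\<And>i j. i < r \<Longrightarrow> j < c \<Longrightarrow> affine_in_sqrt (\<lambda>c. G c $$ (i, j))"
    and F: "\<And>\<delta>. F \<delta> \<in> carrier_mat r c"
  shows "mat_tendsto r c (\<lambda>\<delta>. \<delta> \<cdot>\<^sub>m F \<delta>) (0\<^sub>m r c)"
proof (rule mat_tendstoI)
  show "\<forall>\<^sub>F \<delta> in at_right 0. \<delta> \<cdot>\<^sub>m F \<delta> \<in> carrier_mat r c" using F by simp
  fix i j assume ij: "i < r" "j < c"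
  show "\<forall>\<^sub>F \<delta> in at_right 0. (\<delta> \<cdot>\<^sub>m F \<delta>) $$ (i, j) = \<delta> * F \<delta> $$ (i, j)"
    using F ij by (intro always_eventually allI) (metis carrier_matD index_smult_mat(1))
  obtain X Y where XY: "\<And>c. G c $$ (i, j) = X + sqrt c * Y"
    using aff[OF ij] by (auto simp: affine_in_sqrt_def)
  have "((\<lambda>\<delta>. \<delta> * (F \<delta> $$ (i, j) - G (C \<delta>) $$ (i, j)) + \<delta> * X + (sqrt (C \<delta>) * \<delta>) * Y)
      \<longlongrightarrow> 0 * 0 + 0 * X + 0 * Y) (at_right 0)"
    by (intro tendsto_intros diff ij low_mach_sqrt C)
  then show "((\<lambda>\<delta>. \<delta> * F \<delta> $$ (i, j)) \<longlongrightarrow> 0\<^sub>m r c $$ (i, j)) (at_right 0)"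
    using ij by (simp add: XY algebra_simps)
qed simp

lemma smult_add_mat:
  "A \<in> carrier_mat r c \<Longrightarrow> B \<in> carrier_mat r c \<Longrightarrow> k \<cdot>\<^sub>m A + k \<cdot>\<^sub>m B = k \<cdot>\<^sub>m (A + B)" for A B :: "real mat"
  by (rule add_smult_distrib_left_mat[symmetric])

lemma zero_smult_mat: "A \<in> carrier_mat r c \<Longrightarrow> 0 \<cdot>\<^sub>m A = 0\<^sub>m r c" for A :: "real mat"
  by (intro eq_matI) auto

context
  fixes P :: params and C :: "real \<Rightarrow> real" and T :: "real \<Rightarrow> state" and T0 :: state and r0 :: real
  assumes P: "valid_params P" and C: "low_mach C" and T: "near_state P T T0" and T0: "uniform_density P T0 r0"
begin

lemma scaled_conv:
  "mat_tendsto (cells P - 1) (cells P) (\<lambda>\<delta>. \<delta> \<cdot>\<^sub>m conv_mx (P\<lparr>cp1 := C \<delta>\<rparr>) (T \<delta>)) (0\<^sub>m (cells P - 1) (cells P))"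
  "mat_tendsto (cells P) (cells P - 1) (\<lambda>\<delta>. \<delta> \<cdot>\<^sub>m conv_my (P\<lparr>cp1 := C \<delta>\<rparr>) (T \<delta>)) (0\<^sub>m (cells P) (cells P - 1))"
  using conv_carrier[of "P\<lparr>cp1 := _\<rparr>", unfolded cells_cp1]
  by (auto intro!: scaled_convective_limit[OF C conv_mx_limit[OF P C T T0] affine_conv_mx[OF P T0]]
      scaled_convective_limit[OF C conv_my_limit[OF P C T T0] affine_conv_my[OF P T0]])

lemma conv_limit:
  assumes c0: "limit_coefficient C c0"
  shows "mat_tendsto (cells P - 1) (cells P) (\<lambda>\<delta>. conv_mx (P\<lparr>cp1 := C \<delta>\<rparr>) (T \<delta>)) Lx \<Longrightarrow>
      mat_tendsto (cells P - 1) (cells P) (\<lambda>\<delta>. conv_mx (P\<lparr>cp1 := C \<delta>\<rparr>) (T \<delta>)) (conv_mx (P\<lparr>cp1 := c0\<rparr>) T0)"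
    "mat_tendsto (cells P) (cells P - 1) (\<lambda>\<delta>. conv_my (P\<lparr>cp1 := C \<delta>\<rparr>) (T \<delta>)) Ly \<Longrightarrow>
      mat_tendsto (cells P) (cells P - 1) (\<lambda>\<delta>. conv_my (P\<lparr>cp1 := C \<delta>\<rparr>) (T \<delta>)) (conv_my (P\<lparr>cp1 := c0\<rparr>) T0)"
    "mat_tendsto (cells P) (cells P) (\<lambda>\<delta>. conv_c (P\<lparr>cp1 := C \<delta>\<rparr>) (T \<delta>)) Lc \<Longrightarrow>
      mat_tendsto (cells P) (cells P) (\<lambda>\<delta>. conv_c (P\<lparr>cp1 := C \<delta>\<rparr>) (T \<delta>)) (conv_c (P\<lparr>cp1 := c0\<rparr>) T0)"
  using conv_carrier[of "P\<lparr>cp1 := _\<rparr>", unfolded cells_cp1]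
  by (auto intro!: convective_limit[OF c0 conv_mx_limit[OF P C T T0] affine_conv_mx[OF P T0]]
      convective_limit[OF c0 conv_my_limit[OF P C T T0] affine_conv_my[OF P T0]]
      convective_limit[OF c0 conv_c_limit[OF P C T T0] affine_conv_c[OF P T0]])

text \<open>
  Multiplied by \<open>\<delta>\<close>, only the stiff pressure gradient survives in the momentum equations.
\<close>

lemma scaled_rhs_limit:
  assumes S: "near_state P S S0" and pos: "pos_dens P S0"
  shows "mat_tendsto (cells P - 1) (cells P) (\<lambda>\<delta>. \<delta> \<cdot>\<^sub>m rhs (at_mach P C \<delta>) (T \<delta>) (S \<delta>) MomX)
      (DMT P * map_mat (pres P) (dens S0))"
    "mat_tendsto (cells P) (cells P - 1) (\<lambda>\<delta>. \<delta> \<cdot>\<^sub>m rhs (at_mach P C \<delta>) (T \<delta>) (S \<delta>) MomY)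
      (map_mat (pres P) (dens S0) * DM P)"
proof -
  let ?n = "cells P"
  note id = tendsto_ident_at[of "0::real" "{0<..}"]
  note pg = scaled_pressure_gradient_limit[OF C S pos]
  note cap = mat_tendsto_cap[OF near_state_tendsto(4)[OF T]]
  note visc = mat_tendsto_visc[OF near_state_tendsto(2,3)[OF S]]
  note D = operator_carrier(1)[of P ?n]
  note cc = conv_carrier[of "P\<lparr>cp1 := _\<rparr>", unfolded cells_cp1]
  have x: "mat_tendsto (?n - 1) ?n
      (\<lambda>\<delta>. \<delta> \<cdot>\<^sub>m conv_mx (P\<lparr>cp1 := C \<delta>\<rparr>) (T \<delta>) + \<delta> \<cdot>\<^sub>m (DMT P * map_mat (pres2 (at_mach P C \<delta>)) (dens (S \<delta>)))
        + \<delta> \<cdot>\<^sub>m cap_mx P (conc (T \<delta>)) + \<delta> \<cdot>\<^sub>m visc_mx P (S \<delta>))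
      (0\<^sub>m (?n - 1) ?n + DMT P * map_mat (pres P) (dens S0) + 0 \<cdot>\<^sub>m cap_mx P (conc T0) + 0 \<cdot>\<^sub>m visc_mx P S0)"
    by (intro mat_tendsto_add scaled_conv pg mat_tendsto_smult[OF id] cap visc)
  have evx: "\<forall>\<^sub>F \<delta> in at_right 0. \<delta> \<cdot>\<^sub>m conv_mx (P\<lparr>cp1 := C \<delta>\<rparr>) (T \<delta>)
        + \<delta> \<cdot>\<^sub>m (DMT P * map_mat (pres2 (at_mach P C \<delta>)) (dens (S \<delta>)))
        + \<delta> \<cdot>\<^sub>m cap_mx P (conc (T \<delta>)) + \<delta> \<cdot>\<^sub>m visc_mx P (S \<delta>)
      = \<delta> \<cdot>\<^sub>m rhs (at_mach P C \<delta>) (T \<delta>) (S \<delta>) MomX"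
    using mat_tendstoD(2)[OF near_state_tendsto(1)[OF S]] mat_tendstoD(2)[OF cap(1)] mat_tendstoD(2)[OF visc(1)]
  proof eventually_elim
    case (elim \<delta>)
    note c = cc(1)[of "C \<delta>" "T \<delta>"]
    have p: "DMT P * map_mat (pres2 (at_mach P C \<delta>)) (dens (S \<delta>)) \<in> carrier_mat (?n - 1) ?n"
      using elim(1) D by (intro mult_carrier_mat[of _ _ ?n]) auto
    show ?case
      unfolding rhs.simps operator_at_mach explicit_at_mach cells_at_mach
      by (simp only: smult_add_mat[OF c p] smult_add_mat[OF add_carrier_mat[OF p] elim(2)]
          smult_add_mat[OF add_carrier_mat[OF elim(2)] elim(3)])
  qed
  have "0\<^sub>m (?n - 1) ?n + DMT P * map_mat (pres P) (dens S0) + 0 \<cdot>\<^sub>m cap_mx P (conc T0) + 0 \<cdot>\<^sub>m visc_mx P S0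
      = DMT P * map_mat (pres P) (dens S0)"
    using mat_tendstoD(1)[OF pg(1)]
    by (simp add: zero_smult_mat[OF mat_tendstoD(1)[OF cap(1)]] zero_smult_mat[OF mat_tendstoD(1)[OF visc(1)]])
  with mat_tendsto_cong[OF x evx]
  show "mat_tendsto (?n - 1) ?n (\<lambda>\<delta>. \<delta> \<cdot>\<^sub>m rhs (at_mach P C \<delta>) (T \<delta>) (S \<delta>) MomX)
      (DMT P * map_mat (pres P) (dens S0))" by simp
  have grav: "mat_tendsto ?n (?n - 1) (\<lambda>\<delta>. grav P \<cdot>\<^sub>m (dens (T \<delta>) * AMT P)) (grav P \<cdot>\<^sub>m (dens T0 * AMT P))"
    by (rule mat_tendsto_intros near_state_tendsto[OF T] mat_tendsto_const carrier_intros)+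
  have y: "mat_tendsto ?n (?n - 1)
      (\<lambda>\<delta>. \<delta> \<cdot>\<^sub>m conv_my (P\<lparr>cp1 := C \<delta>\<rparr>) (T \<delta>) + \<delta> \<cdot>\<^sub>m (grav P \<cdot>\<^sub>m (dens (T \<delta>) * AMT P))
        + \<delta> \<cdot>\<^sub>m (map_mat (pres2 (at_mach P C \<delta>)) (dens (S \<delta>)) * DM P)
        + \<delta> \<cdot>\<^sub>m cap_my P (conc (T \<delta>)) + \<delta> \<cdot>\<^sub>m visc_my P (S \<delta>))
      (0\<^sub>m ?n (?n - 1) + 0 \<cdot>\<^sub>m (grav P \<cdot>\<^sub>m (dens T0 * AMT P)) + map_mat (pres P) (dens S0) * DM P
        + 0 \<cdot>\<^sub>m cap_my P (conc T0) + 0 \<cdot>\<^sub>m visc_my P S0)"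
    by (intro mat_tendsto_add scaled_conv pg mat_tendsto_smult[OF id] cap visc grav)
  have evy: "\<forall>\<^sub>F \<delta> in at_right 0. \<delta> \<cdot>\<^sub>m conv_my (P\<lparr>cp1 := C \<delta>\<rparr>) (T \<delta>) + \<delta> \<cdot>\<^sub>m (grav P \<cdot>\<^sub>m (dens (T \<delta>) * AMT P))
        + \<delta> \<cdot>\<^sub>m (map_mat (pres2 (at_mach P C \<delta>)) (dens (S \<delta>)) * DM P)
        + \<delta> \<cdot>\<^sub>m cap_my P (conc (T \<delta>)) + \<delta> \<cdot>\<^sub>m visc_my P (S \<delta>)
      = \<delta> \<cdot>\<^sub>m rhs (at_mach P C \<delta>) (T \<delta>) (S \<delta>) MomY"
    using mat_tendstoD(2)[OF near_state_tendsto(1)[OF S]] mat_tendstoD(2)[OF cap(2)] mat_tendstoD(2)[OF visc(2)]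
      mat_tendstoD(2)[OF grav]
  proof eventually_elim
    case (elim \<delta>)
    note c = cc(2)[of "C \<delta>" "T \<delta>"]
    have p: "map_mat (pres2 (at_mach P C \<delta>)) (dens (S \<delta>)) * DM P \<in> carrier_mat ?n (?n - 1)"
      using elim(1) D by (intro mult_carrier_mat[of _ _ ?n]) auto
    show ?case
      unfolding rhs.simps operator_at_mach explicit_at_mach cells_at_mach
      by (simp only: smult_add_mat[OF c elim(4)] smult_add_mat[OF add_carrier_mat[OF elim(4)] p]
          smult_add_mat[OF add_carrier_mat[OF p] elim(2)]
          smult_add_mat[OF add_carrier_mat[OF elim(2)] elim(3)])
  qed
  have "0\<^sub>m ?n (?n - 1) + 0 \<cdot>\<^sub>m (grav P \<cdot>\<^sub>m (dens T0 * AMT P)) + map_mat (pres P) (dens S0) * DM P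
        + 0 \<cdot>\<^sub>m cap_my P (conc T0) + 0 \<cdot>\<^sub>m visc_my P S0
      = map_mat (pres P) (dens S0) * DM P"
    using mat_tendstoD(1)[OF pg(2)]
    by (simp add: zero_smult_mat[OF mat_tendstoD(1)[OF cap(2)]] zero_smult_mat[OF mat_tendstoD(1)[OF visc(2)]]
        zero_smult_mat[OF mat_tendstoD(1)[OF grav]])
  with mat_tendsto_cong[OF y evy]
  show "mat_tendsto ?n (?n - 1) (\<lambda>\<delta>. \<delta> \<cdot>\<^sub>m rhs (at_mach P C \<delta>) (T \<delta>) (S \<delta>) MomY)
      (map_mat (pres P) (dens S0) * DM P)" by simp
qed

end

lemma smult_distribs:
  "A \<in> carrier_mat r m \<Longrightarrow> B \<in> carrier_mat m c \<Longrightarrow> A * (k \<cdot>\<^sub>m B) = k \<cdot>\<^sub>m (A * B)"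
  "A \<in> carrier_mat r m \<Longrightarrow> B \<in> carrier_mat m c \<Longrightarrow> (k \<cdot>\<^sub>m A) * B = k \<cdot>\<^sub>m (A * B)" for A B :: "real mat"
  by (rule mult_smult_distrib mult_smult_assoc_mat; assumption)+

lemma grad_carrier:
  assumes "A \<in> carrier_mat (cells P) (cells P)"
  shows "grad_x P A \<in> carrier_mat (cells P - 1) (cells P)" "grad_y P A \<in> carrier_mat (cells P) (cells P - 1)"
    "laph P A \<in> carrier_mat (cells P) (cells P)"
  using mat_tendstoD(1)[OF mat_tendsto_grad(1)[OF mat_tendsto_const[OF assms]]]
    mat_tendstoD(1)[OF mat_tendsto_grad(2)[OF mat_tendsto_const[OF assms]]]
    mat_tendstoD(1)[OF mat_tendsto_laph[OF mat_tendsto_const[OF assms]]] by auto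

lemma divh_smult:
  assumes "A \<in> carrier_mat (cells P - 1) (cells P)" "B \<in> carrier_mat (cells P) (cells P - 1)"
  shows "divh P (k \<cdot>\<^sub>m A) (k \<cdot>\<^sub>m B) = k \<cdot>\<^sub>m divh P A B"
proof -
  note D = operator_carrier(1)[of P "cells P"]
  show ?thesis
    unfolding divh_def smult_distribs(1)[OF D assms(1)] smult_distribs(2)[OF assms(2) transpose_carrier[OF D]]
    by (rule smult_add_mat) (use assms D in auto)
qed

lemma grad_smult:
  assumes "A \<in> carrier_mat (cells P) (cells P)"
  shows "grad_x P (k \<cdot>\<^sub>m A) = k \<cdot>\<^sub>m grad_x P A" "grad_y P (k \<cdot>\<^sub>m A) = k \<cdot>\<^sub>m grad_y P A"
proof -
  note D = operator_carrier(1)[of P "cells P"]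
  have neg: "- (k \<cdot>\<^sub>m B) = k \<cdot>\<^sub>m (- B)" for B :: "real mat" by (intro eq_matI) auto
  show "grad_x P (k \<cdot>\<^sub>m A) = k \<cdot>\<^sub>m grad_x P A" "grad_y P (k \<cdot>\<^sub>m A) = k \<cdot>\<^sub>m grad_y P A"
    unfolding grad_x_def grad_y_def smult_distribs(1)[OF transpose_carrier[OF D] assms] smult_distribs(2)[OF assms D] neg
    by (rule refl)+
qed

lemma laph_smult:
  assumes "A \<in> carrier_mat (cells P) (cells P)"
  shows "laph P (k \<cdot>\<^sub>m A) = k \<cdot>\<^sub>m laph P A"
  unfolding laph_def grad_smult[OF assms] by (rule divh_smult[OF grad_carrier(1,2)[OF assms]])

lemma at_density_uniform: "uniform_density P S r \<Longrightarrow> at_density P r S = S"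
  by (cases S) (simp add: at_density_def uniform_density_def)

text \<open>
  The extra term of the compressible stress is the discrete gradient of the discrete divergence.
\<close>

lemma visc_incompressible:
  assumes v: "valid_state P S" and div: "divh P (velx S) (vely S) = 0\<^sub>m (cells P) (cells P)"
  shows "visc_mx P S = nu P \<cdot>\<^sub>m lap_velx P S" "visc_my P S = nu P \<cdot>\<^sub>m lap_vely P S"
    "lap_velx P S \<in> carrier_mat (cells P - 1) (cells P)" "lap_vely P S \<in> carrier_mat (cells P) (cells P - 1)"
proof -
  let ?n = "cells P"
  note D = operator_carrier(1)[of P ?n]
  note DT = transpose_carrier[OF D]
  have v1: "velx S \<in> carrier_mat (?n - 1) ?n" and v2: "vely S \<in> carrier_mat ?n (?n - 1)"
    using v by (auto simp: valid_state_def)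
  have alg: "- ((2 * n + l) \<cdot>\<^sub>m a + n \<cdot>\<^sub>m b + (n + l) \<cdot>\<^sub>m c) = n \<cdot>\<^sub>m (- (a + b))"
    if "a \<in> carrier_mat r q" "b \<in> carrier_mat r q" "c \<in> carrier_mat r q" "a + c = 0\<^sub>m r q"
    for n l :: real and a b c :: "real mat" and r q
  proof (rule eq_matI)
    fix i j assume "i < dim_row (n \<cdot>\<^sub>m (- (a + b)))" "j < dim_col (n \<cdot>\<^sub>m (- (a + b)))"
    then have ij: "i < r" "j < q" using that by auto
    have "a $$ (i, j) + c $$ (i, j) = 0"
    proof -
      have "(a + c) $$ (i, j) = 0" unfolding that(4) using ij by simp
      then show ?thesis using that(1-3) ij by simp
    qed
    then have "c $$ (i, j) = - a $$ (i, j)" by simp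
    then show "(- ((2 * n + l) \<cdot>\<^sub>m a + n \<cdot>\<^sub>m b + (n + l) \<cdot>\<^sub>m c)) $$ (i, j) = (n \<cdot>\<^sub>m (- (a + b))) $$ (i, j)"
      using that(1-3) ij by (simp add: algebra_simps)
  qed (use that in auto)
  note DS = operator_carrier'(2)[of P] and D1 = operator_carrier'(1)[of P]
  have a: "DMT P * DM P * velx S \<in> carrier_mat (?n - 1) ?n"
    by (intro mult_carrier_mat[OF mult_carrier_mat[OF DT D] v1])
  have b: "velx S * transpose_mat (DS1 P) * DM1 P \<in> carrier_mat (?n - 1) ?n"
    by (intro mult_carrier_mat[OF mult_carrier_mat[OF v1 transpose_carrier[OF DS]] D1])
  have c: "DMT P * vely S * DMT P \<in> carrier_mat (?n - 1) ?n"
    by (intro mult_carrier_mat[OF mult_carrier_mat[OF DT v2] DT])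
  have "DMT P * DM P * velx S + DMT P * vely S * DMT P = DMT P * divh P (velx S) (vely S)"
    unfolding divh_def assoc_mult_mat[OF DT D v1] assoc_mult_mat[OF DT v2 DT]
    by (rule mult_add_distrib_mat[symmetric, OF DT mult_carrier_mat[OF D v1] mult_carrier_mat[OF v2 DT]])
  also have "\<dots> = 0\<^sub>m (?n - 1) ?n"
    unfolding div using DT by (rule right_mult_zero_mat)
  finally have "DMT P * DM P * velx S + DMT P * vely S * DMT P = 0\<^sub>m (?n - 1) ?n" .
  from alg[OF a b c this] show "visc_mx P S = nu P \<cdot>\<^sub>m lap_velx P S"
    unfolding visc_mx_def lap_velx_def .
  show "lap_velx P S \<in> carrier_mat (?n - 1) ?n"
    unfolding lap_velx_def by (intro uminus_carrier_mat add_carrier_mat b)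
  have a: "vely S * DMT P * DM P \<in> carrier_mat ?n (?n - 1)"
    by (intro mult_carrier_mat[OF mult_carrier_mat[OF v2 DT] D])
  have b: "transpose_mat (DM1 P) * DS1 P * vely S \<in> carrier_mat ?n (?n - 1)"
    by (intro mult_carrier_mat[OF mult_carrier_mat[OF transpose_carrier[OF D1] DS] v2])
  have c: "DM P * velx S * DM P \<in> carrier_mat ?n (?n - 1)"
    by (intro mult_carrier_mat[OF mult_carrier_mat[OF D v1] D])
  have "vely S * DMT P * DM P + DM P * velx S * DM P = DM P * velx S * DM P + vely S * DMT P * DM P"
    by (rule comm_add_mat[OF a c])
  also have "\<dots> = divh P (velx S) (vely S) * DM P"
    unfolding divh_def
    by (rule add_mult_distrib_mat[symmetric, OF mult_carrier_mat[OF D v1] mult_carrier_mat[OF v2 DT] D])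
  also have "\<dots> = 0\<^sub>m ?n (?n - 1)"
    unfolding div using D by (rule left_mult_zero_mat)
  finally have "vely S * DMT P * DM P + DM P * velx S * DM P = 0\<^sub>m ?n (?n - 1)" .
  from alg[OF a b c this] show "visc_my P S = nu P \<cdot>\<^sub>m lap_vely P S"
    unfolding visc_my_def lap_vely_def .
  show "lap_vely P S \<in> carrier_mat ?n (?n - 1)"
    unfolding lap_vely_def by (intro uminus_carrier_mat add_carrier_mat b)
qed

lemma spatial_carrier:
  assumes "valid_state P S"
  shows "cap_mx P (conc S) \<in> carrier_mat (cells P - 1) (cells P)" "cap_my P (conc S) \<in> carrier_mat (cells P) (cells P - 1)"
    "Qh P (conc S) \<in> carrier_mat (cells P) (cells P)"
proof -
  have c: "conc S \<in> carrier_mat (cells P) (cells P)" using assms by (simp add: valid_state_def)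
  show "cap_mx P (conc S) \<in> carrier_mat (cells P - 1) (cells P)" "cap_my P (conc S) \<in> carrier_mat (cells P) (cells P - 1)"
    "Qh P (conc S) \<in> carrier_mat (cells P) (cells P)"
    using mat_tendstoD(1)[OF mat_tendsto_cap(1)[OF mat_tendsto_const[OF c]]]
      mat_tendstoD(1)[OF mat_tendsto_cap(2)[OF mat_tendsto_const[OF c]]]
      mat_tendstoD(1)[OF mat_tendsto_Qh[OF mat_tendsto_const[OF c]]] by auto
qed

text \<open>
  The limits of the right-hand sides are those of the incompressible scheme multiplied by the density,
  as it should be for equations in conservative variables.
\<close>

lemma limit_operators:
  assumes T: "valid_state P T" "uniform_density P T r" and S: "valid_state P S" "uniform_density P S r"
    and div: "divh P (velx S) (vely S) = 0\<^sub>m (cells P) (cells P)"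
    and p: "p \<in> carrier_mat (cells P) (cells P)"
  shows "r \<cdot>\<^sub>m limit_Kx (P\<lparr>cp1 := c\<rparr>) r T S ((1 / r) \<cdot>\<^sub>m p) =
      conv_mx (P\<lparr>cp1 := c\<rparr>) T + DMT P * p + cap_mx P (conc T) + visc_mx P S" (is ?X)
    "r \<cdot>\<^sub>m limit_Ky (P\<lparr>cp1 := c\<rparr>) r T S ((1 / r) \<cdot>\<^sub>m p) =
      conv_my (P\<lparr>cp1 := c\<rparr>) T + grav P \<cdot>\<^sub>m (dens T * AMT P) + p * DM P + cap_my P (conc T) + visc_my P S" (is ?Y)
    "r \<cdot>\<^sub>m limit_J (P\<lparr>cp1 := c\<rparr>) r T S =
      conv_c (P\<lparr>cp1 := c\<rparr>) T + 2 \<cdot>\<^sub>m laph P (conc S) + Qh P (conc T)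
        - epsi P \<cdot>\<^sub>m laph P (map_mat inverse (dens S) \<star> laph P (conc S))" (is ?Z)
    "limit_Kx (P\<lparr>cp1 := c\<rparr>) r T S ((1 / r) \<cdot>\<^sub>m p) \<in> carrier_mat (cells P - 1) (cells P)"
    "limit_Ky (P\<lparr>cp1 := c\<rparr>) r T S ((1 / r) \<cdot>\<^sub>m p) \<in> carrier_mat (cells P) (cells P - 1)"
    "limit_J (P\<lparr>cp1 := c\<rparr>) r T S \<in> carrier_mat (cells P) (cells P)"
proof -
  let ?n = "cells P"
  have r: "r \<noteq> 0" using T(2) by (simp add: uniform_density_def)
  note cc = conv_carrier[of "P\<lparr>cp1 := c\<rparr>" T, unfolded cells_cp1]
  note at = at_density_uniform[OF T(2)]
  note sp = spatial_carrier[OF T(1)]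
  note visc = visc_incompressible[OF S(1) div]
  note D = operator_carrier(1)[of P ?n]
  have Dp: "DMT P * p \<in> carrier_mat (?n - 1) ?n" "p * DM P \<in> carrier_mat ?n (?n - 1)"
    using D p by auto
  have cS: "conc S \<in> carrier_mat ?n ?n" using S(1) by (simp add: valid_state_def)
  note lap = grad_carrier(3)[OF cS]
  have inv: "map_mat inverse (dens S) \<star> laph P (conc S) = (1 / r) \<cdot>\<^sub>m laph P (conc S)"
  proof -
    have "map_mat inverse (dens S) = const_mat ?n ?n (1 / r)"
      using S(2) by (intro const_matI) (auto simp: uniform_density_def const_mat_def divide_inverse)
    then show ?thesis using const_mat_hprod[OF lap] by simp
  qed
  have dA: "dens T * AMT P = const_mat ?n (?n - 1) r"
    using face_density_uniform(2)[OF T(2)] by (simp add: dens_y_def)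
  have [simp]: "nu (P\<lparr>cp1 := c\<rparr>) = nu P" "grav (P\<lparr>cp1 := c\<rparr>) = grav P" "epsi (P\<lparr>cp1 := c\<rparr>) = epsi P" by simp_all
  have entryx: "r \<cdot>\<^sub>m (- ((- 1 / r) \<cdot>\<^sub>m A) + (1 / r) \<cdot>\<^sub>m (B + L) - - ((1 / r) \<cdot>\<^sub>m Q)) = A + Q + B + L"
    if "A \<in> carrier_mat m q" "B \<in> carrier_mat m q" "L \<in> carrier_mat m q" "Q \<in> carrier_mat m q"
    for A B L Q :: "real mat" and m q
    using that r by (intro eq_matI) (auto simp: field_simps)
  have Kx: "limit_Kx (P\<lparr>cp1 := c\<rparr>) r T S ((1 / r) \<cdot>\<^sub>m p) =
     - ((- 1 / r) \<cdot>\<^sub>m conv_mx (P\<lparr>cp1 := c\<rparr>) T) + (1 / r) \<cdot>\<^sub>m (cap_mx P (conc T) + nu P \<cdot>\<^sub>m lap_velx P S)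
       - - ((1 / r) \<cdot>\<^sub>m (DMT P * p))"
    unfolding limit_Kx_def div_vv_x_def operator_cp1 at grad_x_def smult_distribs(1)[OF transpose_carrier[OF D] p] by simp
  show ?X unfolding Kx visc(1) by (rule entryx[OF cc(1) sp(1) smult_carrier_mat[OF visc(3)] Dp(1)])
  show "limit_Kx (P\<lparr>cp1 := c\<rparr>) r T S ((1 / r) \<cdot>\<^sub>m p) \<in> carrier_mat (?n - 1) ?n"
    unfolding Kx by (intro minus_carrier_mat uminus_carrier_mat smult_carrier_mat Dp)
  have entryy: "r \<cdot>\<^sub>m (const_mat m q g - ((- 1 / r) \<cdot>\<^sub>m A) + (1 / r) \<cdot>\<^sub>m (B + L) - - ((1 / r) \<cdot>\<^sub>m Q))
      = A + g \<cdot>\<^sub>m const_mat m q r + Q + B + L"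
    if "A \<in> carrier_mat m q" "B \<in> carrier_mat m q" "L \<in> carrier_mat m q" "Q \<in> carrier_mat m q"
    for A B L Q :: "real mat" and m q g
    using that r by (intro eq_matI) (auto simp: const_mat_def field_simps)
  have Ky: "limit_Ky (P\<lparr>cp1 := c\<rparr>) r T S ((1 / r) \<cdot>\<^sub>m p) =
     const_mat ?n (?n - 1) (grav P) - ((- 1 / r) \<cdot>\<^sub>m conv_my (P\<lparr>cp1 := c\<rparr>) T)
       + (1 / r) \<cdot>\<^sub>m (cap_my P (conc T) + nu P \<cdot>\<^sub>m lap_vely P S) - - ((1 / r) \<cdot>\<^sub>m (p * DM P))"
    unfolding limit_Ky_def div_vv_y_def operator_cp1 at grad_y_def smult_distribs(2)[OF p D] by simp
  show ?Y unfolding Ky visc(2) dA by (rule entryy[OF cc(2) sp(2) smult_carrier_mat[OF visc(4)] Dp(2)])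
  show "limit_Ky (P\<lparr>cp1 := c\<rparr>) r T S ((1 / r) \<cdot>\<^sub>m p) \<in> carrier_mat ?n (?n - 1)"
    unfolding Ky by (intro minus_carrier_mat uminus_carrier_mat smult_carrier_mat Dp)
  have entryc: "r \<cdot>\<^sub>m (- ((- 1 / r) \<cdot>\<^sub>m A) + (1 / r) \<cdot>\<^sub>m (2 \<cdot>\<^sub>m B + L - (e / r) \<cdot>\<^sub>m Q))
      = A + 2 \<cdot>\<^sub>m B + L - e \<cdot>\<^sub>m ((1 / r) \<cdot>\<^sub>m Q)"
    if "A \<in> carrier_mat m q" "B \<in> carrier_mat m q" "L \<in> carrier_mat m q" "Q \<in> carrier_mat m q"
    for A B L Q :: "real mat" and m q e
    using that r by (intro eq_matI) (auto simp: field_simps)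
  have J: "limit_J (P\<lparr>cp1 := c\<rparr>) r T S = - ((- 1 / r) \<cdot>\<^sub>m conv_c (P\<lparr>cp1 := c\<rparr>) T)
      + (1 / r) \<cdot>\<^sub>m (2 \<cdot>\<^sub>m laph P (conc S) + Qh P (conc T) - (epsi P / r) \<cdot>\<^sub>m laph P (laph P (conc S)))"
    unfolding limit_J_def div_vc_def operator_cp1 at by simp
  show ?Z unfolding J inv laph_smult[OF lap] by (rule entryc[OF cc(3) lap sp(3) grad_carrier(3)[OF lap]])
  show "limit_J (P\<lparr>cp1 := c\<rparr>) r T S \<in> carrier_mat ?n ?n"
    unfolding J by (intro add_carrier_mat minus_carrier_mat smult_carrier_mat grad_carrier(3) lap)
qed

text \<open>
  All terms but the convective one have known limits, so if the right-hand side converges, then so does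
  the convective term, and its limit is the value at \<open>c\<^sub>0\<close>.
\<close>

lemma rhs_limits:
  assumes P: "valid_params P" and C: "low_mach C" and T: "near_state P T T0" and T0: "uniform_density P T0 r0"
    and c0: "limit_coefficient C c0"
    and S: "admits_expansion P S S0 S1" "\<forall>\<^sub>F \<delta> in at_right 0. valid_state P (S \<delta>)" "uniform_density P S0 r0"
  shows "mat_tendsto (cells P - 1) (cells P) (\<lambda>\<delta>. rhs (at_mach P C \<delta>) (T \<delta>) (S \<delta>) MomX) Rx \<Longrightarrow>
      Rx = conv_mx (P\<lparr>cp1 := c0\<rparr>) T0 + DMT P * pres_first_order P S0 S1 + cap_mx P (conc T0) + visc_mx P S0"
    "mat_tendsto (cells P) (cells P - 1) (\<lambda>\<delta>. rhs (at_mach P C \<delta>) (T \<delta>) (S \<delta>) MomY) Ry \<Longrightarrow>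
      Ry = conv_my (P\<lparr>cp1 := c0\<rparr>) T0 + grav P \<cdot>\<^sub>m (dens T0 * AMT P) + pres_first_order P S0 S1 * DM P
        + cap_my P (conc T0) + visc_my P S0"
    "mat_tendsto (cells P) (cells P) (\<lambda>\<delta>. rhs (at_mach P C \<delta>) (T \<delta>) (S \<delta>) Conc) Rc \<Longrightarrow>
      Rc = conv_c (P\<lparr>cp1 := c0\<rparr>) T0 + 2 \<cdot>\<^sub>m laph P (conc S0) + Qh P (conc T0)
        - epsi P \<cdot>\<^sub>m laph P (map_mat inverse (dens S0) \<star> laph P (conc S0))"
proof -
  let ?n = "cells P"
  note nS = admits_expansion_near[OF S(1,2)]
  note pg = pressure_gradient_limit[OF C S]
  note cap = mat_tendsto_cap[OF near_state_tendsto(4)[OF T]]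
  note visc = mat_tendsto_visc[OF near_state_tendsto(2,3)[OF nS]]
  note Q = mat_tendsto_Qh[OF near_state_tendsto(4)[OF T]]
  note cc = conv_carrier[of "P\<lparr>cp1 := _\<rparr>", unfolded cells_cp1]
  note cl = conv_limit[OF P C T T0 c0]
  have grav: "mat_tendsto ?n (?n - 1) (\<lambda>\<delta>. grav P \<cdot>\<^sub>m (dens (T \<delta>) * AMT P)) (grav P \<cdot>\<^sub>m (dens T0 * AMT P))"
    by (rule mat_tendsto_intros near_state_tendsto[OF T] mat_tendsto_const carrier_intros)+
  have lap: "mat_tendsto ?n ?n (\<lambda>\<delta>. 2 \<cdot>\<^sub>m laph P (conc (S \<delta>))) (2 \<cdot>\<^sub>m laph P (conc S0))"
    by (intro mat_tendsto_smult tendsto_const mat_tendsto_laph near_state_tendsto(4)[OF nS])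
  have "isCont inverse (dens S0 $$ (i, j))" if "i < ?n" "j < ?n" for i j
    using S(3) that by (intro continuous_intros) (auto simp: uniform_density_def const_mat_def)
  then have bilap: "mat_tendsto ?n ?n (\<lambda>\<delta>. epsi P \<cdot>\<^sub>m laph P (map_mat inverse (dens (S \<delta>)) \<star> laph P (conc (S \<delta>))))
      (epsi P \<cdot>\<^sub>m laph P (map_mat inverse (dens S0) \<star> laph P (conc S0)))"
    by (intro mat_tendsto_smult tendsto_const mat_tendsto_laph mat_tendsto_hprod mat_tendsto_map
        near_state_tendsto[OF nS])
  \<comment> \<open>Three identities that recover the convective term from the right-hand side.\<close>
  have cancel_x: "A + B + L + Q - Q - L - B = A"
    if "A \<in> carrier_mat m q" "B \<in> carrier_mat m q" "L \<in> carrier_mat m q" "Q \<in> carrier_mat m q"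
    for A B L Q :: "real mat" and m q
    using that by (intro eq_matI) auto
  have cancel_y: "A + G + B + L + Q - Q - L - B - G = A"
    if "A \<in> carrier_mat m q" "G \<in> carrier_mat m q" "B \<in> carrier_mat m q" "L \<in> carrier_mat m q" "Q \<in> carrier_mat m q"
    for A G B L Q :: "real mat" and m q
    using that by (intro eq_matI) auto
  have cancel_conc: "A + B + L - Q + Q - L - B = A"
    if "A \<in> carrier_mat m q" "B \<in> carrier_mat m q" "L \<in> carrier_mat m q" "Q \<in> carrier_mat m q"
    for A B L Q :: "real mat" and m q
    using that by (intro eq_matI) auto
  note rhs = rhs.simps operator_at_mach explicit_at_mach cells_at_mach
  show "Rx = conv_mx (P\<lparr>cp1 := c0\<rparr>) T0 + DMT P * pres_first_order P S0 S1 + cap_mx P (conc T0) + visc_mx P S0"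
    if R: "mat_tendsto (?n - 1) ?n (\<lambda>\<delta>. rhs (at_mach P C \<delta>) (T \<delta>) (S \<delta>) MomX) Rx"
  proof -
    note lim = mat_tendsto_diff[OF mat_tendsto_diff[OF mat_tendsto_diff[OF R visc(1)] cap(1)] pg(1)]
    have "\<forall>\<^sub>F \<delta> in at_right 0. rhs (at_mach P C \<delta>) (T \<delta>) (S \<delta>) MomX - visc_mx P (S \<delta>) - cap_mx P (conc (T \<delta>))
        - DMT P * map_mat (pres2 (at_mach P C \<delta>)) (dens (S \<delta>)) = conv_mx (P\<lparr>cp1 := C \<delta>\<rparr>) (T \<delta>)"
      using mat_tendstoD(2)[OF visc(1)] mat_tendstoD(2)[OF cap(1)] mat_tendstoD(2)[OF pg(1)]
      unfolding rhs by eventually_elim (rule cancel_x[OF cc(1)])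
    note conv = cl(1)[OF mat_tendsto_cong[OF lim this]]
    show ?thesis
      by (rule mat_tendsto_unique[OF R], unfold rhs) (intro mat_tendsto_add conv pg cap visc)
  qed
  show "Ry = conv_my (P\<lparr>cp1 := c0\<rparr>) T0 + grav P \<cdot>\<^sub>m (dens T0 * AMT P) + pres_first_order P S0 S1 * DM P
        + cap_my P (conc T0) + visc_my P S0"
    if R: "mat_tendsto ?n (?n - 1) (\<lambda>\<delta>. rhs (at_mach P C \<delta>) (T \<delta>) (S \<delta>) MomY) Ry"
  proof -
    note lim = mat_tendsto_diff[OF mat_tendsto_diff[OF mat_tendsto_diff[OF mat_tendsto_diff[OF R visc(2)] cap(2)] pg(2)] grav]
    have "\<forall>\<^sub>F \<delta> in at_right 0. rhs (at_mach P C \<delta>) (T \<delta>) (S \<delta>) MomY - visc_my P (S \<delta>) - cap_my P (conc (T \<delta>))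
        - map_mat (pres2 (at_mach P C \<delta>)) (dens (S \<delta>)) * DM P - grav P \<cdot>\<^sub>m (dens (T \<delta>) * AMT P) = conv_my (P\<lparr>cp1 := C \<delta>\<rparr>) (T \<delta>)"
      using mat_tendstoD(2)[OF visc(2)] mat_tendstoD(2)[OF cap(2)] mat_tendstoD(2)[OF pg(2)] mat_tendstoD(2)[OF grav]
      unfolding rhs by eventually_elim (rule cancel_y[OF cc(2)])
    note conv = cl(2)[OF mat_tendsto_cong[OF lim this]]
    show ?thesis
      by (rule mat_tendsto_unique[OF R], unfold rhs) (intro mat_tendsto_add conv pg cap visc grav)
  qed
  show "Rc = conv_c (P\<lparr>cp1 := c0\<rparr>) T0 + 2 \<cdot>\<^sub>m laph P (conc S0) + Qh P (conc T0)
        - epsi P \<cdot>\<^sub>m laph P (map_mat inverse (dens S0) \<star> laph P (conc S0))"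
    if R: "mat_tendsto ?n ?n (\<lambda>\<delta>. rhs (at_mach P C \<delta>) (T \<delta>) (S \<delta>) Conc) Rc"
  proof -
    note lim = mat_tendsto_diff[OF mat_tendsto_diff[OF mat_tendsto_add[OF R bilap] Q] lap]
    have "\<forall>\<^sub>F \<delta> in at_right 0. rhs (at_mach P C \<delta>) (T \<delta>) (S \<delta>) Conc
        + epsi P \<cdot>\<^sub>m laph P (map_mat inverse (dens (S \<delta>)) \<star> laph P (conc (S \<delta>))) - Qh P (conc (T \<delta>))
        - 2 \<cdot>\<^sub>m laph P (conc (S \<delta>)) = conv_c (P\<lparr>cp1 := C \<delta>\<rparr>) (T \<delta>)"
      using mat_tendstoD(2)[OF bilap] mat_tendstoD(2)[OF Q] mat_tendstoD(2)[OF lap]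
      unfolding rhs by eventually_elim (rule cancel_conc[OF cc(3)])
    note conv = cl(3)[OF mat_tendsto_cong[OF lim this]]
    show ?thesis
      by (rule mat_tendsto_unique[OF R], unfold rhs) (intro mat_tendsto_add mat_tendsto_diff conv lap Q bilap)
  qed
qed

section \<open>Runge--Kutta combinations\<close>

lemma rk_comb_index:
  "X \<in> carrier_mat r c \<Longrightarrow> i < r \<Longrightarrow> j < c \<Longrightarrow>
    rk_comb X \<tau> w J L $$ (i, j) = X $$ (i, j) + \<tau> * (\<Sum>l\<in>J. w l * L l $$ (i, j))"
  by (simp add: rk_comb_def)

lemma rk_comb_carrier: "X \<in> carrier_mat r c \<Longrightarrow> rk_comb X \<tau> w J L \<in> carrier_mat r c"
  by (simp add: rk_comb_def)

lemma mat_tendsto_rk_comb: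
  assumes X: "mat_tendsto r c X X0" and dt: "(dt \<longlongrightarrow> dt0) (at_right 0)"
    and R: "\<And>l. l \<in> J \<Longrightarrow> mat_tendsto r c (R l) (R0 l)"
  shows "mat_tendsto r c (\<lambda>\<delta>. rk_comb (X \<delta>) (dt \<delta>) w J (\<lambda>l. R l \<delta>)) (rk_comb X0 dt0 w J R0)"
proof (rule mat_tendstoI)
  show "\<forall>\<^sub>F \<delta> in at_right 0. rk_comb (X \<delta>) (dt \<delta>) w J (\<lambda>l. R l \<delta>) \<in> carrier_mat r c"
    using mat_tendstoD(2)[OF X] by eventually_elim (rule rk_comb_carrier)
  fix i j assume ij: "i < r" "j < c"
  show "\<forall>\<^sub>F \<delta> in at_right 0. rk_comb (X \<delta>) (dt \<delta>) w J (\<lambda>l. R l \<delta>) $$ (i, j)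
      = X \<delta> $$ (i, j) + dt \<delta> * (\<Sum>l\<in>J. w l * R l \<delta> $$ (i, j))"
    using mat_tendstoD(2)[OF X] by eventually_elim (rule rk_comb_index[OF _ ij])
  show "((\<lambda>\<delta>. X \<delta> $$ (i, j) + dt \<delta> * (\<Sum>l\<in>J. w l * R l \<delta> $$ (i, j))) \<longlongrightarrow> rk_comb X0 dt0 w J R0 $$ (i, j)) (at_right 0)"
    unfolding rk_comb_index[OF mat_tendstoD(1)[OF X] ij]
    by (intro tendsto_intros mat_tendstoD(3)[OF X ij] dt mat_tendstoD(3)[OF R ij])
qed (rule rk_comb_carrier[OF mat_tendstoD(1)[OF X]])

lemma rk_comb_cancel:
  assumes r: "r \<noteq> 0" and X: "X \<in> carrier_mat m n" and Y: "Y \<in> carrier_mat m n"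
    and K: "\<And>l. l \<in> J \<Longrightarrow> K l \<in> carrier_mat m n"
    and eq: "r \<cdot>\<^sub>m X = rk_comb (r \<cdot>\<^sub>m Y) \<tau> w J (\<lambda>l. r \<cdot>\<^sub>m K l)"
  shows "X = rk_comb Y \<tau> w J K"
proof (rule eq_matI)
  fix i j assume "i < dim_row (rk_comb Y \<tau> w J K)" "j < dim_col (rk_comb Y \<tau> w J K)"
  then have ij: "i < m" "j < n" using rk_comb_carrier[OF Y, of \<tau> w J K] by auto
  have "r * X $$ (i, j) = (r \<cdot>\<^sub>m X) $$ (i, j)"
    using X ij by simp
  also have "\<dots> = (r \<cdot>\<^sub>m Y) $$ (i, j) + \<tau> * (\<Sum>l\<in>J. w l * (r \<cdot>\<^sub>m K l) $$ (i, j))"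
    unfolding eq by (rule rk_comb_index[OF smult_carrier_mat[OF Y] ij])
  also have "(\<Sum>l\<in>J. w l * (r \<cdot>\<^sub>m K l) $$ (i, j)) = (\<Sum>l\<in>J. r * (w l * K l $$ (i, j)))"
    by (intro sum.cong refl) (use K ij in \<open>auto dest!: K\<close>)
  also have "(r \<cdot>\<^sub>m Y) $$ (i, j) + \<tau> * \<dots> = r * (Y $$ (i, j) + \<tau> * (\<Sum>l\<in>J. w l * K l $$ (i, j)))"
    using Y ij by (simp add: sum_distrib_left[symmetric] algebra_simps)
  finally show "X $$ (i, j) = rk_comb Y \<tau> w J K $$ (i, j)"
    using r rk_comb_index[OF Y ij] by simp
qed (use X rk_comb_carrier[OF Y, of \<tau> w J K] in auto)

lemma rk_comb_smult:
  assumes "X \<in> carrier_mat m n" "\<And>l. l \<in> J \<Longrightarrow> K l \<in> carrier_mat m n"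
  shows "k \<cdot>\<^sub>m rk_comb X \<tau> w J K = rk_comb (k \<cdot>\<^sub>m X) \<tau> w J (\<lambda>l. k \<cdot>\<^sub>m K l)"
proof (rule eq_matI)
  note c = rk_comb_carrier[OF smult_carrier_mat[OF assms(1)], of k \<tau> w J "\<lambda>l. k \<cdot>\<^sub>m K l"]
  note c' = rk_comb_carrier[OF assms(1), of \<tau> w J K]
  fix i j assume "i < dim_row (rk_comb (k \<cdot>\<^sub>m X) \<tau> w J (\<lambda>l. k \<cdot>\<^sub>m K l))"
    "j < dim_col (rk_comb (k \<cdot>\<^sub>m X) \<tau> w J (\<lambda>l. k \<cdot>\<^sub>m K l))"
  then have ij: "i < m" "j < n" using c by auto
  have "(\<Sum>l\<in>J. w l * (k \<cdot>\<^sub>m K l) $$ (i, j)) = (\<Sum>l\<in>J. k * (w l * K l $$ (i, j)))"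
    by (intro sum.cong refl) (use ij in \<open>auto dest!: assms(2)\<close>)
  then show "(k \<cdot>\<^sub>m rk_comb X \<tau> w J K) $$ (i, j) = rk_comb (k \<cdot>\<^sub>m X) \<tau> w J (\<lambda>l. k \<cdot>\<^sub>m K l) $$ (i, j)"
    using ij assms(1) c'
    by (simp add: rk_comb_index[OF smult_carrier_mat[OF assms(1)] ij] rk_comb_index[OF assms(1) ij]
        sum_distrib_left[symmetric] algebra_simps)
qed (use rk_comb_carrier[OF smult_carrier_mat[OF assms(1)], of k \<tau> w J "\<lambda>l. k \<cdot>\<^sub>m K l"]
    rk_comb_carrier[OF assms(1), of \<tau> w J K] in auto)

text \<open>
  The nonzero diagonal coefficient lets one solve the stage equation for the last increment.
\<close>

lemma last_increment_zero:
  fixes l :: nat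
  assumes X: "mat_tendsto r c X A" and Y: "mat_tendsto r c Y A"
    and eq: "\<forall>\<^sub>F \<delta> in at_right 0. X \<delta> = rk_comb (Y \<delta>) (dt \<delta>) w {1..l} (\<lambda>j. R j \<delta>)"
    and R: "\<And>j. j \<in> {1..<l} \<Longrightarrow> mat_tendsto r c (R j) (0\<^sub>m r c)" and B: "mat_tendsto r c (R l) B"
    and dt: "(dt \<longlongrightarrow> dt0) (at_right 0)" "dt0 \<noteq> 0" and w: "w l \<noteq> 0" and l: "1 \<le> l"
  shows "B = 0\<^sub>m r c"
proof (rule eq_matI)
  have lim: "mat_tendsto r c (\<lambda>\<delta>. rk_comb (Y \<delta>) (dt \<delta>) w {1..l} (\<lambda>j. R j \<delta>))
      (rk_comb A dt0 w {1..l} (\<lambda>j. if j = l then B else 0\<^sub>m r c))"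
    by (rule mat_tendsto_rk_comb[OF Y dt(1)]) (use R B in auto)
  have "\<forall>\<^sub>F \<delta> in at_right 0. rk_comb (Y \<delta>) (dt \<delta>) w {1..l} (\<lambda>j. R j \<delta>) = X \<delta>"
    using eq by eventually_elim simp
  from mat_tendsto_unique[OF X mat_tendsto_cong[OF lim this]]
  have A: "A = rk_comb A dt0 w {1..l} (\<lambda>j. if j = l then B else 0\<^sub>m r c)" .
  fix i j assume "i < dim_row (0\<^sub>m r c)" "j < dim_col (0\<^sub>m r c)"
  then have ij: "i < r" "j < c" by auto
  have "A $$ (i, j) = A $$ (i, j) + dt0 * (\<Sum>k\<in>{1..l}. w k * (if k = l then B else 0\<^sub>m r c) $$ (i, j))"
    by (subst A) (rule rk_comb_index[OF mat_tendstoD(1)[OF X] ij])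
  also have "(\<Sum>k\<in>{1..l}. w k * (if k = l then B else 0\<^sub>m r c) $$ (i, j)) = (\<Sum>k\<in>{1..l}. if k = l then w l * B $$ (i, j) else 0)"
    using ij by (intro sum.cong) auto
  also have "\<dots> = w l * B $$ (i, j)" using l by simp
  finally show "B $$ (i, j) = 0\<^sub>m r c $$ (i, j)" using dt(2) w ij by simp
qed (use mat_tendstoD(1)[OF B] in auto)

text \<open>
  The diagonally implicit stage equations form a lower triangular system for the increments, with
  nonzero diagonal; hence the increments inherit the convergence of the stages. This is the only
  source of convergence for the convective terms.
\<close>

lemma increments_converge:
  fixes a :: "nat \<Rightarrow> nat \<Rightarrow> real"
  assumes X: "\<And>l. l \<in> {1..s} \<Longrightarrow> mat_tendsto r c (X l) (X0 l)" and Y: "mat_tendsto r c Y Y0"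
    and eq: "\<And>l. l \<in> {1..s} \<Longrightarrow> \<forall>\<^sub>F \<delta> in at_right 0. X l \<delta> = rk_comb (Y \<delta>) (dt \<delta>) (a l) {1..l} (\<lambda>j. R j \<delta>)"
    and R: "\<And>l. l \<in> {1..s} \<Longrightarrow> \<forall>\<^sub>F \<delta> in at_right 0. R l \<delta> \<in> carrier_mat r c"
    and dt: "(dt \<longlongrightarrow> dt0) (at_right 0)" "dt0 \<noteq> 0" and a: "\<And>l. l \<in> {1..s} \<Longrightarrow> a l l \<noteq> 0"
    and l: "l \<in> {1..s}"
  shows "\<exists>A. mat_tendsto r c (R l) A"
  using l
proof (induction l rule: less_induct)
  case (less l)
  then have "\<forall>j\<in>{1..<l}. \<exists>A. mat_tendsto r c (R j) A" by auto
  then obtain A where A: "\<And>j. j \<in> {1..<l} \<Longrightarrow> mat_tendsto r c (R j) (A j)" by metis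
  define f where "f i j \<delta> = ((X l \<delta> $$ (i, j) - Y \<delta> $$ (i, j)) / dt \<delta> - (\<Sum>k\<in>{1..<l}. a l k * R k \<delta> $$ (i, j))) / a l l"
    for i j \<delta>
  define B where "B = mat r c (\<lambda>(i, j). ((X0 l $$ (i, j) - Y0 $$ (i, j)) / dt0 - (\<Sum>k\<in>{1..<l}. a l k * A k $$ (i, j))) / a l l)"
  have dt_ev: "\<forall>\<^sub>F \<delta> in at_right 0. dt \<delta> \<noteq> 0"
    using dt by (rule tendsto_imp_eventually_ne)
  have "mat_tendsto r c (R l) B"
  proof (rule mat_tendstoI[where f = f])
    show "\<forall>\<^sub>F \<delta> in at_right 0. R l \<delta> \<in> carrier_mat r c" by (rule R[OF less.prems])
    fix i j assume ij: "i < r" "j < c"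
    show "\<forall>\<^sub>F \<delta> in at_right 0. R l \<delta> $$ (i, j) = f i j \<delta>"
      using eq[OF less.prems] mat_tendstoD(2)[OF Y] dt_ev
    proof eventually_elim
      case (elim \<delta>)
      have "{1..l} = insert l {1..<l}" using less.prems by auto
      then have "X l \<delta> $$ (i, j) = Y \<delta> $$ (i, j) + dt \<delta> * (a l l * R l \<delta> $$ (i, j) + (\<Sum>k\<in>{1..<l}. a l k * R k \<delta> $$ (i, j)))"
        unfolding elim(1) rk_comb_index[OF elim(2) ij] by simp
      then show ?case
        unfolding f_def using elim(3) a[OF less.prems] by simp
    qed
    show "(f i j \<longlongrightarrow> B $$ (i, j)) (at_right 0)"
      unfolding f_def B_def using ij dt(2) a[OF less.prems]
      by (auto intro!: tendsto_intros mat_tendstoD(3)[OF X[OF less.prems]] mat_tendstoD(3)[OF Y] mat_tendstoD(3)[OF A] dt(1))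
  qed (simp add: B_def)
  then show ?case by blast
qed

lemma rhs_carrier:
  assumes T: "near_state P T T0" and S: "near_state P S S0"
  shows "\<forall>\<^sub>F \<delta> in at_right 0. rhs (at_mach P C \<delta>) (T \<delta>) (S \<delta>) MomX \<in> carrier_mat (cells P - 1) (cells P)"
    "\<forall>\<^sub>F \<delta> in at_right 0. rhs (at_mach P C \<delta>) (T \<delta>) (S \<delta>) MomY \<in> carrier_mat (cells P) (cells P - 1)"
    "\<forall>\<^sub>F \<delta> in at_right 0. rhs (at_mach P C \<delta>) (T \<delta>) (S \<delta>) Conc \<in> carrier_mat (cells P) (cells P)"
proof -
  note visc = mat_tendsto_visc[OF near_state_tendsto(2,3)[OF S], THEN mat_tendstoD(2)]
  note rhs = rhs.simps operator_at_mach explicit_at_mach cells_at_mach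
  show "\<forall>\<^sub>F \<delta> in at_right 0. rhs (at_mach P C \<delta>) (T \<delta>) (S \<delta>) MomX \<in> carrier_mat (cells P - 1) (cells P)"
    unfolding rhs using visc(1) by eventually_elim (rule add_carrier_mat)
  show "\<forall>\<^sub>F \<delta> in at_right 0. rhs (at_mach P C \<delta>) (T \<delta>) (S \<delta>) MomY \<in> carrier_mat (cells P) (cells P - 1)"
    unfolding rhs using visc(2) by eventually_elim (rule add_carrier_mat)
  show "\<forall>\<^sub>F \<delta> in at_right 0. rhs (at_mach P C \<delta>) (T \<delta>) (S \<delta>) Conc \<in> carrier_mat (cells P) (cells P)"
    unfolding rhs using mat_tendstoD(2)[OF near_state_tendsto(1)[OF S]]
    by eventually_elim (intro minus_carrier_mat smult_carrier_mat grad_carrier(3) hprod_carrier map_carrier_mat[THEN iffD2])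
qed

lemma conserved_limit:
  assumes "near_state P S S0"
  shows "mat_tendsto (cells P) (cells P) (\<lambda>\<delta>. conserved P (S \<delta>) Mass) (conserved P S0 Mass)"
    "mat_tendsto (cells P - 1) (cells P) (\<lambda>\<delta>. conserved P (S \<delta>) MomX) (conserved P S0 MomX)"
    "mat_tendsto (cells P) (cells P - 1) (\<lambda>\<delta>. conserved P (S \<delta>) MomY) (conserved P S0 MomY)"
    "mat_tendsto (cells P) (cells P) (\<lambda>\<delta>. conserved P (S \<delta>) Conc) (conserved P S0 Conc)"
  by (simp_all only: conserved.simps) (intro mat_tendsto_momentum mat_tendsto_hprod near_state_tendsto assms)+

lemma conserved_uniform:
  assumes "uniform_density P S r" "valid_state P S"
  shows "conserved P S MomX = r \<cdot>\<^sub>m velx S" "conserved P S MomY = r \<cdot>\<^sub>m vely S" "conserved P S Conc = r \<cdot>\<^sub>m conc S"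
  using momentum_uniform[OF assms] by simp_all

lemma well_prepared_iff:
  assumes P: "valid_params P" and v: "valid_state P S" and pos: "pos_dens P S"
  shows "well_prepared P S \<longleftrightarrow> uniform_density P S (dens S $$ (0, 0)) \<and> divh P (velx S) (vely S) = 0\<^sub>m (cells P) (cells P)"
proof -
  have n: "0 < cells P" using P by (simp add: valid_params_def)
  have d: "dens S \<in> carrier_mat (cells P) (cells P)" using v by (simp add: valid_state_def)
  have neg: "A = 0\<^sub>m r c" if "- A = 0\<^sub>m r c" for A :: "real mat" and r c
  proof -
    have "A = - (- A)" by (intro eq_matI) auto
    also have "\<dots> = 0\<^sub>m r c" unfolding that by (intro eq_matI) auto
    finally show ?thesis .
  qed
  have neg0: "- 0\<^sub>m r c = (0\<^sub>m r c :: real mat)" for r c by (intro eq_matI) auto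
  have "uniform_density P S (dens S $$ (0, 0))" if "grad_x P (dens S) = 0\<^sub>m (cells P - 1) (cells P)"
    "grad_y P (dens S) = 0\<^sub>m (cells P) (cells P - 1)"
    using const_if_D_zero[OF P d neg neg] that pos n unfolding grad_x_def grad_y_def
    by (simp add: uniform_density_def pos_dens_def)
  moreover have "grad_x P (dens S) = 0\<^sub>m (cells P - 1) (cells P)" "grad_y P (dens S) = 0\<^sub>m (cells P) (cells P - 1)"
    if "uniform_density P S (dens S $$ (0, 0))"
  proof -
    have c: "dens S = const_mat (cells P) (cells P) (dens S $$ (0, 0))" using that by (simp add: uniform_density_def)
    show "grad_x P (dens S) = 0\<^sub>m (cells P - 1) (cells P)" "grad_y P (dens S) = 0\<^sub>m (cells P) (cells P - 1)"
      unfolding grad_x_def grad_y_def by (subst c, simp add: D_const neg0)+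
  qed
  ultimately show ?thesis unfolding well_prepared_def by blast
qed

text \<open>
  The sound speed in the characteristic speed is that of the explicit pressure alone.
\<close>

lemma stability_independent: "stability_independent P s"
proof -
  have "stability_condition (P\<lparr>cp1 := c, delta := d\<rparr>) s CFL \<tau> U = stability_condition (P\<lparr>cp1 := c\<rparr>) s CFL \<tau> U"
    for c d CFL \<tau> U
  proof -
    have "sound (P\<lparr>cp1 := c, delta := d\<rparr>) = sound (P\<lparr>cp1 := c\<rparr>)"
      by (auto simp: fun_eq_iff sound_def pres_deriv_def)
    then show ?thesis
      by (simp add: stability_condition_def char_speed_def operator_cong[of "P\<lparr>cp1 := c, delta := d\<rparr>" "P\<lparr>cp1 := c\<rparr>"])
  qed
  then show ?thesis by (simp add: stability_independent_def)
qed

section \<open>The stages and the update in the limit\<close>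

definition incompressible_stage :: "params \<Rightarrow> real \<Rightarrow> state \<Rightarrow> state \<Rightarrow> bool" where
  "incompressible_stage P r T S \<longleftrightarrow> uniform_density P T r \<and> uniform_density P S r \<and>
     divh P (velx S) (vely S) = 0\<^sub>m (cells P) (cells P)"

text \<open>
  A step that starts from a state whose leading-order density is the constant \<open>r0\<close>.
\<close>

context
  fixes P :: params
    and C dt :: "real \<Rightarrow> real"
    and dt0 :: real
    and s :: nat
    and aE aI :: "nat \<Rightarrow> nat \<Rightarrow> real"
    and bE bI :: "nat \<Rightarrow> real"
    and Unow :: "real \<Rightarrow> state"
    and Ut U :: "real \<Rightarrow> nat \<Rightarrow> state"
    and Unow0 Unow1 :: state
    and Ut0 Ut1 U0 U1 :: "nat \<Rightarrow> state"
    and r0 :: real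
  assumes P: "valid_params P"
    and C: "low_mach C"
    and imex: "imex_pair s aE aI bE bI"
    and dt: "(dt \<longlongrightarrow> dt0) (at_right 0)"
    and dt0: "0 < dt0"
    and valid_now: "\<forall>\<^sub>F \<delta> in at_right 0. valid_state P (Unow \<delta>)"
    and valid_stages: "\<forall>l\<in>{1..s}. \<forall>\<^sub>F \<delta> in at_right 0. valid_state P (Ut \<delta> l)"
      "\<forall>l\<in>{1..s}. \<forall>\<^sub>F \<delta> in at_right 0. valid_state P (U \<delta> l)"
    and stages: "\<forall>\<^sub>F \<delta> in at_right 0. imex_stages (at_mach P C \<delta>) s aE aI (dt \<delta>) (Unow \<delta>) (Ut \<delta>) (U \<delta>)"
    and expansion_now: "admits_expansion P Unow Unow0 Unow1"
    and expansion_stages: "\<forall>l\<in>{1..s}. admits_expansion P (\<lambda>\<delta>. Ut \<delta> l) (Ut0 l) (Ut1 l)"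
      "\<forall>l\<in>{1..s}. admits_expansion P (\<lambda>\<delta>. U \<delta> l) (U0 l) (U1 l)"
    and pos_stages: "\<forall>l\<in>{1..s}. pos_dens P (U0 l)"
    and prep: "uniform_density P Unow0 r0"
begin

lemmas valid = valid_now valid_stages[THEN bspec]
lemmas expansion = expansion_now expansion_stages[THEN bspec]
lemmas pos = pos_stages[THEN bspec]

abbreviation increment :: "component \<Rightarrow> nat \<Rightarrow> real \<Rightarrow> real mat" where
  "increment k j \<delta> \<equiv> rhs (at_mach P C \<delta>) (Ut \<delta> j) (U \<delta> j) k"

lemma near_states:
  "near_state P Unow Unow0"
  "l \<in> {1..s} \<Longrightarrow> near_state P (\<lambda>\<delta>. Ut \<delta> l) (Ut0 l)"
  "l \<in> {1..s} \<Longrightarrow> near_state P (\<lambda>\<delta>. U \<delta> l) (U0 l)"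
  by (blast intro: admits_expansion_near expansion valid)+

lemma valid_limits:
  "valid_state P Unow0" "l \<in> {1..s} \<Longrightarrow> valid_state P (Ut0 l)" "l \<in> {1..s} \<Longrightarrow> valid_state P (U0 l)"
  using near_states by (auto simp: near_state_def)

lemma stage_equations:
  assumes "l \<in> {1..s}"
  shows "\<forall>\<^sub>F \<delta> in at_right 0. conserved P (Ut \<delta> l) k =
      rk_comb (conserved P (Unow \<delta>) k) (dt \<delta>) (aE l) {1..<l} (\<lambda>j. increment k j \<delta>)"
    "\<forall>\<^sub>F \<delta> in at_right 0. conserved P (U \<delta> l) k =
      rk_comb (conserved P (Unow \<delta>) k) (dt \<delta>) (aI l) {1..l} (\<lambda>j. increment k j \<delta>)"
  using stages by (eventually_elim, use assms in \<open>simp add: imex_stages_def operator_at_mach\<close>)+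

lemma diagonal: "l \<in> {1..s} \<Longrightarrow> aI l l \<noteq> 0"
  using imex by (auto simp: imex_pair_def)

lemma explicit_stage_limit:
  assumes l: "l \<in> {1..s}"
    and lim: "\<And>S S0. near_state P S S0 \<Longrightarrow> mat_tendsto r c (\<lambda>\<delta>. conserved P (S \<delta>) k) (conserved P S0 k)"
    and R: "\<And>j. j \<in> {1..<l} \<Longrightarrow> mat_tendsto r c (increment k j) (R0 j)"
  shows "conserved P (Ut0 l) k = rk_comb (conserved P Unow0 k) dt0 (aE l) {1..<l} R0"
  by (rule mat_tendsto_unique[OF mat_tendsto_cong[OF lim[OF near_states(2)[OF l]] stage_equations(1)[OF l]]
        mat_tendsto_rk_comb[OF lim[OF near_states(1)] dt R]])

lemma implicit_stage_limit:
  assumes l: "l \<in> {1..s}"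
    and lim: "\<And>S S0. near_state P S S0 \<Longrightarrow> mat_tendsto r c (\<lambda>\<delta>. conserved P (S \<delta>) k) (conserved P S0 k)"
    and R: "\<And>j. j \<in> {1..l} \<Longrightarrow> mat_tendsto r c (increment k j) (R0 j)"
  shows "conserved P (U0 l) k = rk_comb (conserved P Unow0 k) dt0 (aI l) {1..l} R0"
  by (rule mat_tendsto_unique[OF mat_tendsto_cong[OF lim[OF near_states(3)[OF l]] stage_equations(2)[OF l]]
        mat_tendsto_rk_comb[OF lim[OF near_states(1)] dt R]])

lemma mass_increment:
  assumes "j \<in> {1..s}" "uniform_density P (Ut0 j) r0"
  shows "mat_tendsto (cells P) (cells P) (increment Mass j)
      (- divh P (dens_x P (U0 j) \<star> velx (U0 j)) (dens_y P (U0 j) \<star> vely (U0 j)))"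
  by (rule rhs_Mass_limit[OF P C near_states(2)[OF assms(1)] assms(2) near_states(3)[OF assms(1)]])

lemma momentum_flux_uniform:
  assumes "valid_state P S" "uniform_density P S r"
  shows "- divh P (dens_x P S \<star> velx S) (dens_y P S \<star> vely S) = (- r) \<cdot>\<^sub>m divh P (velx S) (vely S)"
proof -
  have v: "velx S \<in> carrier_mat (cells P - 1) (cells P)" "vely S \<in> carrier_mat (cells P) (cells P - 1)"
    using assms(1) by (auto simp: valid_state_def)
  show ?thesis
    unfolding momentum_uniform[OF assms(2,1)] divh_smult[OF v] by (intro eq_matI) auto
qed

lemma mass_increment_zero:
  assumes "j \<in> {1..s}" "incompressible_stage P r0 (Ut0 j) (U0 j)"
  shows "mat_tendsto (cells P) (cells P) (increment Mass j) (0\<^sub>m (cells P) (cells P))"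
proof -
  have *: "uniform_density P (Ut0 j) r0" "uniform_density P (U0 j) r0" "divh P (velx (U0 j)) (vely (U0 j)) = 0\<^sub>m (cells P) (cells P)"
    using assms(2) by (auto simp: incompressible_stage_def)
  show ?thesis
    using mass_increment[OF assms(1) *(1)]
    unfolding momentum_flux_uniform[OF valid_limits(3)[OF assms(1)] *(2)] *(3) smult_zero_mat .
qed

text \<open>
  The induction treats one stage \<open>l\<close> in four steps. The mass increments of the earlier stages vanish in
  the limit, which gives the density of the explicit state. The momentum equations multiplied by \<open>\<delta>\<close> then
  make the leading-order density of the implicit state constant. Summed over all cells, the mass
  equation loses its divergence terms, so the constant is the initial one. Without change of
  density, the mass increment of stage \<open>l\<close> vanishes, which is the divergence constraint.
\<close>

lemma all_stages_incompressible:
  assumes "l \<in> {1..s}"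
  shows "incompressible_stage P r0 (Ut0 l) (U0 l)"
  using assms
proof (induction l rule: less_induct)
  case (less l)
  let ?n = "cells P"
  have IH: "j \<in> {1..s}" "incompressible_stage P r0 (Ut0 j) (U0 j)" if "j \<in> {1..<l}" for j
    using that less by auto
  have l1: "1 \<le> l" using less.prems by simp
  have n: "0 < ?n" using P by (simp add: valid_params_def)
  have r0: "0 < r0" using prep by (simp add: uniform_density_def)

  have "conserved P (Ut0 l) Mass = rk_comb (conserved P Unow0 Mass) dt0 (aE l) {1..<l} (\<lambda>_. 0\<^sub>m ?n ?n)"
    by (rule explicit_stage_limit[OF less.prems conserved_limit(1)]) (use IH mass_increment_zero in blast)+
  also have "\<dots> = dens Unow0"
    using valid_limits(1) by (intro eq_matI) (auto simp: rk_comb_def valid_state_def)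
  finally have Ut: "uniform_density P (Ut0 l) r0"
    using prep by (simp add: uniform_density_def)

  \<comment> \<open>This serves both momentum components: \<open>k\<close> is the component and \<open>r\<close>, \<open>c\<close> are its dimensions.\<close>
  have pressure: "B = 0\<^sub>m r c"
    if lim: "\<And>S S0. near_state P S S0 \<Longrightarrow> mat_tendsto r c (\<lambda>\<delta>. conserved P (S \<delta>) k) (conserved P S0 k)"
      and car: "\<And>j. j \<in> {1..s} \<Longrightarrow> \<forall>\<^sub>F \<delta> in at_right 0. increment k j \<delta> \<in> carrier_mat r c"
      and R: "\<And>j. j \<in> {1..<l} \<Longrightarrow> mat_tendsto r c (\<lambda>\<delta>. \<delta> \<cdot>\<^sub>m increment k j \<delta>) (0\<^sub>m r c)"
      and B: "mat_tendsto r c (\<lambda>\<delta>. \<delta> \<cdot>\<^sub>m increment k l \<delta>) B" for r c k B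
  proof (rule last_increment_zero[where R = "\<lambda>j \<delta>. \<delta> \<cdot>\<^sub>m increment k j \<delta>" and l = l and w = "aI l",
        OF _ _ _ R B dt _ diagonal[OF less.prems] l1])
    note id = tendsto_ident_at[of "0::real" "{0<..}"]
    show "mat_tendsto r c (\<lambda>\<delta>. \<delta> \<cdot>\<^sub>m conserved P (U \<delta> l) k) (0\<^sub>m r c)"
      using mat_tendsto_smult[OF id lim[OF near_states(3)[OF less.prems]]]
      unfolding zero_smult_mat[OF mat_tendstoD(1)[OF lim[OF near_states(3)[OF less.prems]]]] .
    note now = lim[OF near_states(1)]
    show "mat_tendsto r c (\<lambda>\<delta>. \<delta> \<cdot>\<^sub>m conserved P (Unow \<delta>) k) (0\<^sub>m r c)"
      using mat_tendsto_smult[OF id now] unfolding zero_smult_mat[OF mat_tendstoD(1)[OF now]] .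
    have "\<forall>\<^sub>F \<delta> in at_right 0. \<forall>j\<in>{1..l}. increment k j \<delta> \<in> carrier_mat r c"
      using less.prems by (intro eventually_ball_finite) (auto intro!: car)
    with stage_equations(2)[OF less.prems, of k] mat_tendstoD(2)[OF now]
    show "\<forall>\<^sub>F \<delta> in at_right 0. \<delta> \<cdot>\<^sub>m conserved P (U \<delta> l) k =
        rk_comb (\<delta> \<cdot>\<^sub>m conserved P (Unow \<delta>) k) (dt \<delta>) (aI l) {1..l} (\<lambda>j. \<delta> \<cdot>\<^sub>m increment k j \<delta>)"
      by eventually_elim (simp only:, rule rk_comb_smult, auto)
  qed (use dt0 in auto)
  note scaled = scaled_rhs_limit[OF P C near_states(2) _ near_states(3) pos]
  have earlier: "DMT P * map_mat (pres P) (dens (U0 j)) = 0\<^sub>m (?n - 1) ?n"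
    "map_mat (pres P) (dens (U0 j)) * DM P = 0\<^sub>m ?n (?n - 1)" if "j \<in> {1..<l}" for j
  proof -
    have "map_mat (pres P) (dens (U0 j)) = const_mat ?n ?n (pres P r0)"
      using IH(2)[OF that] by (intro const_matI) (auto simp: incompressible_stage_def uniform_density_def const_mat_def)
    then show "DMT P * map_mat (pres P) (dens (U0 j)) = 0\<^sub>m (?n - 1) ?n"
      "map_mat (pres P) (dens (U0 j)) * DM P = 0\<^sub>m ?n (?n - 1)" by (simp_all only: D_const)
  qed
  have unif: "uniform_density P (Ut0 j) r0" if "j \<in> {1..<l}" for j
    using IH(2)[OF that] by (simp add: incompressible_stage_def)
  have x: "DMT P * map_mat (pres P) (dens (U0 l)) = 0\<^sub>m (?n - 1) ?n"
  proof (rule pressure[OF conserved_limit(2) rhs_carrier(1)[OF near_states(2,3)]])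
    fix j assume j: "j \<in> {1..<l}"
    show "mat_tendsto (?n - 1) ?n (\<lambda>\<delta>. \<delta> \<cdot>\<^sub>m increment MomX j \<delta>) (0\<^sub>m (?n - 1) ?n)"
      using scaled(1)[OF IH(1)[OF j] unif[OF j] IH(1)[OF j] IH(1)[OF j]] unfolding earlier(1)[OF j] .
  qed (use scaled(1)[OF less.prems Ut less.prems less.prems] in auto)
  have y: "map_mat (pres P) (dens (U0 l)) * DM P = 0\<^sub>m ?n (?n - 1)"
  proof (rule pressure[OF conserved_limit(3) rhs_carrier(2)[OF near_states(2,3)]])
    fix j assume j: "j \<in> {1..<l}"
    show "mat_tendsto ?n (?n - 1) (\<lambda>\<delta>. \<delta> \<cdot>\<^sub>m increment MomY j \<delta>) (0\<^sub>m ?n (?n - 1))"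
      using scaled(2)[OF IH(1)[OF j] unif[OF j] IH(1)[OF j] IH(1)[OF j]] unfolding earlier(2)[OF j] .
  qed (use scaled(2)[OF less.prems Ut less.prems less.prems] in auto)
  \<comment> \<open>So the leading-order density of the implicit state is constant; its value is determined below.\<close>
  define r1 where "r1 = dens (U0 l) $$ (0, 0)"
  have U1: "uniform_density P (U0 l) r1"
    unfolding r1_def by (rule uniform_density_if_pressure_const[OF P valid_limits(3)[OF less.prems] pos[OF less.prems] x y])

  define M where "M j = - divh P (dens_x P (U0 j) \<star> velx (U0 j)) (dens_y P (U0 j) \<star> vely (U0 j))" for j
  have M: "mat_tendsto ?n ?n (increment Mass j) (M j)" if "j \<in> {1..l}" for j
  proof -
    have "uniform_density P (Ut0 j) r0" using that unif[of j] Ut by (cases "j = l") auto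
    then show ?thesis unfolding M_def using that less.prems by (intro mass_increment) auto
  qed
  have M_sum: "(\<Sum>i<?n. \<Sum>k<?n. M j $$ (i, k)) = 0" if "j \<in> {1..l}" for j
  proof -
    have "j \<in> {1..s}" using that less.prems by auto
    note mom = mat_tendsto_momentum[OF near_states(3)[OF this], THEN mat_tendstoD(1)]
    have "dim_row (divh P (dens_x P (U0 j) \<star> velx (U0 j)) (dens_y P (U0 j) \<star> vely (U0 j))) = ?n"
      "dim_col (divh P (dens_x P (U0 j) \<star> velx (U0 j)) (dens_y P (U0 j) \<star> vely (U0 j))) = ?n"
      using mat_tendstoD(1)[OF M[OF that]] by (auto simp: M_def)
    then have "(\<Sum>i<?n. \<Sum>k<?n. M j $$ (i, k)) =
        - (\<Sum>i<?n. \<Sum>k<?n. divh P (dens_x P (U0 j) \<star> velx (U0 j)) (dens_y P (U0 j) \<star> vely (U0 j)) $$ (i, k))"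
      by (simp add: M_def sum_negf)
    then show ?thesis using sum_divh[OF mom] by simp
  qed
  \<comment> \<open>The leading-order mass balance, to be summed over all cells.\<close>
  have mass: "dens (U0 l) = rk_comb (dens Unow0) dt0 (aI l) {1..l} M"
    using implicit_stage_limit[OF less.prems conserved_limit(1) M] by simp
  have "r1 = r0"
  proof -
    have entry: "r1 = r0 + dt0 * (\<Sum>j\<in>{1..l}. aI l j * M j $$ (i, k))" if ik: "i < ?n" "k < ?n" for i k
    proof -
      have "dens (U0 l) $$ (i, k) = dens Unow0 $$ (i, k) + dt0 * (\<Sum>j\<in>{1..l}. aI l j * M j $$ (i, k))"
        unfolding mass by (rule rk_comb_index[OF _ ik]) (use valid_limits(1) in \<open>simp add: valid_state_def\<close>)
      then show ?thesis using U1 prep ik by (simp add: uniform_density_def const_mat_def)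
    qed
    have "(\<Sum>i<?n. \<Sum>k<?n. r1) = (\<Sum>i<?n. \<Sum>k<?n. r0 + dt0 * (\<Sum>j\<in>{1..l}. aI l j * M j $$ (i, k)))"
      by (intro sum.cong refl entry) auto
    also have "\<dots> = (\<Sum>i<?n. \<Sum>k<?n. r0) + dt0 * (\<Sum>i<?n. \<Sum>k<?n. \<Sum>j\<in>{1..l}. aI l j * M j $$ (i, k))"
      by (simp add: sum.distrib sum_distrib_left)
    also have "(\<Sum>i<?n. \<Sum>k<?n. \<Sum>j\<in>{1..l}. aI l j * M j $$ (i, k)) = (\<Sum>i<?n. \<Sum>j\<in>{1..l}. \<Sum>k<?n. aI l j * M j $$ (i, k))"
      by (rule sum.cong[OF refl], rule sum.swap)
    also have "\<dots> = (\<Sum>j\<in>{1..l}. \<Sum>i<?n. \<Sum>k<?n. aI l j * M j $$ (i, k))"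
      by (rule sum.swap)
    also have "\<dots> = (\<Sum>j\<in>{1..l}. aI l j * (\<Sum>i<?n. \<Sum>k<?n. M j $$ (i, k)))"
      by (simp add: sum_distrib_left)
    also have "\<dots> = 0" using M_sum by simp
    finally show ?thesis using n by simp
  qed
  with U1 have U: "uniform_density P (U0 l) r0" by simp

  have "M l = 0\<^sub>m ?n ?n"
  proof (rule last_increment_zero[where R = "increment Mass" and l = l and w = "aI l",
        OF _ _ stage_equations(2)[OF less.prems, of Mass] _ M dt _ diagonal[OF less.prems] l1])
    have "conserved P (U0 l) Mass = conserved P Unow0 Mass" using U prep by (simp add: uniform_density_def)
    with conserved_limit(1)[OF near_states(3)[OF less.prems]]
    show "mat_tendsto ?n ?n (\<lambda>\<delta>. conserved P (U \<delta> l) Mass) (conserved P Unow0 Mass)" by simp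
    show "mat_tendsto ?n ?n (\<lambda>\<delta>. conserved P (Unow \<delta>) Mass) (conserved P Unow0 Mass)"
      by (rule conserved_limit(1)[OF near_states(1)])
    show "mat_tendsto ?n ?n (increment Mass j) (0\<^sub>m ?n ?n)" if "j \<in> {1..<l}" for j
      by (rule mass_increment_zero[OF IH[OF that]])
  qed (use dt0 l1 in auto)
  then have zero: "(- r0) \<cdot>\<^sub>m divh P (velx (U0 l)) (vely (U0 l)) = 0\<^sub>m ?n ?n"
    unfolding M_def momentum_flux_uniform[OF valid_limits(3)[OF less.prems] U] .
  have "divh P (velx (U0 l)) (vely (U0 l)) = (- 1 / r0) \<cdot>\<^sub>m ((- r0) \<cdot>\<^sub>m divh P (velx (U0 l)) (vely (U0 l)))"
    using r0 by (intro eq_matI) auto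
  also have "\<dots> = 0\<^sub>m ?n ?n" unfolding zero by simp
  finally show ?case using Ut U by (simp add: incompressible_stage_def)
qed

lemma increment_limits:
  assumes c0: "limit_coefficient C c0" and l: "l \<in> {1..s}"
  defines "q \<equiv> (1 / r0) \<cdot>\<^sub>m pres_first_order P (U0 l) (U1 l)"
  shows "mat_tendsto (cells P - 1) (cells P) (increment MomX l) (r0 \<cdot>\<^sub>m limit_Kx (P\<lparr>cp1 := c0\<rparr>) r0 (Ut0 l) (U0 l) q)"
    "mat_tendsto (cells P) (cells P - 1) (increment MomY l) (r0 \<cdot>\<^sub>m limit_Ky (P\<lparr>cp1 := c0\<rparr>) r0 (Ut0 l) (U0 l) q)"
    "mat_tendsto (cells P) (cells P) (increment Conc l) (r0 \<cdot>\<^sub>m limit_J (P\<lparr>cp1 := c0\<rparr>) r0 (Ut0 l) (U0 l))"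
    "limit_Kx (P\<lparr>cp1 := c0\<rparr>) r0 (Ut0 l) (U0 l) q \<in> carrier_mat (cells P - 1) (cells P)"
    "limit_Ky (P\<lparr>cp1 := c0\<rparr>) r0 (Ut0 l) (U0 l) q \<in> carrier_mat (cells P) (cells P - 1)"
    "limit_J (P\<lparr>cp1 := c0\<rparr>) r0 (Ut0 l) (U0 l) \<in> carrier_mat (cells P) (cells P)"
proof -
  have inc: "uniform_density P (Ut0 l) r0" "uniform_density P (U0 l) r0" "divh P (velx (U0 l)) (vely (U0 l)) = 0\<^sub>m (cells P) (cells P)"
    using all_stages_incompressible[OF l] by (auto simp: incompressible_stage_def)
  have p: "pres_first_order P (U0 l) (U1 l) \<in> carrier_mat (cells P) (cells P)"
    using expansion(3)[OF l] by (simp add: admits_expansion_def expands_def)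
  note ops = limit_operators[OF valid_limits(2)[OF l] inc(1) valid_limits(3)[OF l] inc(2,3) p, folded q_def]
  note rl = rhs_limits[OF P C near_states(2)[OF l] inc(1) c0 expansion(3)[OF l] valid(3)[OF l] inc(2)]
  have conv: "\<exists>A. mat_tendsto r c (increment k l) A"
    if "\<And>S S0. near_state P S S0 \<Longrightarrow> mat_tendsto r c (\<lambda>\<delta>. conserved P (S \<delta>) k) (conserved P S0 k)"
      and "\<And>j. j \<in> {1..s} \<Longrightarrow> \<forall>\<^sub>F \<delta> in at_right 0. increment k j \<delta> \<in> carrier_mat r c" for r c k
    by (rule increments_converge[OF that(1)[OF near_states(3)] that(1)[OF near_states(1)] stage_equations(2) that(2)
          dt _ diagonal l]) (use dt0 in auto)
  show "mat_tendsto (cells P - 1) (cells P) (increment MomX l) (r0 \<cdot>\<^sub>m limit_Kx (P\<lparr>cp1 := c0\<rparr>) r0 (Ut0 l) (U0 l) q)"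
    unfolding ops(1) using conv[OF conserved_limit(2) rhs_carrier(1)[OF near_states(2,3)]] rl(1) by blast
  show "mat_tendsto (cells P) (cells P - 1) (increment MomY l) (r0 \<cdot>\<^sub>m limit_Ky (P\<lparr>cp1 := c0\<rparr>) r0 (Ut0 l) (U0 l) q)"
    unfolding ops(2) using conv[OF conserved_limit(3) rhs_carrier(2)[OF near_states(2,3)]] rl(2) by blast
  show "mat_tendsto (cells P) (cells P) (increment Conc l) (r0 \<cdot>\<^sub>m limit_J (P\<lparr>cp1 := c0\<rparr>) r0 (Ut0 l) (U0 l))"
    unfolding ops(3) using conv[OF conserved_limit(4) rhs_carrier(3)[OF near_states(2,3)]] rl(3) by blast
  show "limit_Kx (P\<lparr>cp1 := c0\<rparr>) r0 (Ut0 l) (U0 l) q \<in> carrier_mat (cells P - 1) (cells P)"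
    "limit_Ky (P\<lparr>cp1 := c0\<rparr>) r0 (Ut0 l) (U0 l) q \<in> carrier_mat (cells P) (cells P - 1)"
    "limit_J (P\<lparr>cp1 := c0\<rparr>) r0 (Ut0 l) (U0 l) \<in> carrier_mat (cells P) (cells P)"
    by (rule ops)+
qed

text \<open>
  Stiff accuracy makes the update coincide with the last stage in conservative variables for each
  small \<open>\<delta>\<close>; dividing by the limit density transfers this to the primitive variables.
\<close>

lemma update_limit:
  assumes stiff: "stiffly_accurate s aI bI"
    and new: "\<forall>\<^sub>F \<delta> in at_right 0. valid_state P (Unew \<delta>)"
      "\<forall>\<^sub>F \<delta> in at_right 0. imex_update (at_mach P C \<delta>) s bI (dt \<delta>) (Unow \<delta>) (Ut \<delta>) (U \<delta>) (Unew \<delta>)"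
      "admits_expansion P Unew Unew0 Unew1"
  shows "uniform_density P Unew0 r0" "valid_state P Unew0"
    "velx Unew0 = velx (U0 s)" "vely Unew0 = vely (U0 s)" "conc Unew0 = conc (U0 s)"
proof -
  have s: "s \<in> {1..s}" using imex by (auto simp: imex_pair_def)
  note nn = admits_expansion_near[OF new(3,1)]
  show v: "valid_state P Unew0" using nn by (simp add: near_state_def)
  have eq: "\<forall>\<^sub>F \<delta> in at_right 0. conserved P (U \<delta> s) k = conserved P (Unew \<delta>) k" for k
    using stage_equations(2)[OF s, of k] new(2)
  proof eventually_elim
    case (elim \<delta>)
    have "rk_comb (conserved P (Unow \<delta>) k) (dt \<delta>) bI {1..s} (\<lambda>j. increment k j \<delta>) =
        rk_comb (conserved P (Unow \<delta>) k) (dt \<delta>) (aI s) {1..s} (\<lambda>j. increment k j \<delta>)"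
      using stiff by (simp add: rk_comb_def stiffly_accurate_def)
    then show ?case
      using elim by (simp add: imex_update_def operator_at_mach)
  qed
  have same: "conserved P Unew0 k = conserved P (U0 s) k"
    if "\<And>S S0. near_state P S S0 \<Longrightarrow> mat_tendsto r c (\<lambda>\<delta>. conserved P (S \<delta>) k) (conserved P S0 k)" for r c k
    by (rule mat_tendsto_unique[OF that[OF nn] mat_tendsto_cong[OF that[OF near_states(3)[OF s]] eq]])
  have Us: "uniform_density P (U0 s) r0" using all_stages_incompressible[OF s] by (simp add: incompressible_stage_def)
  show u: "uniform_density P Unew0 r0"
    using same[OF conserved_limit(1)] Us by (simp add: uniform_density_def)
  have r0: "r0 \<noteq> 0" using Us by (simp add: uniform_density_def)
  have cancel: "A = B" if "r0 \<cdot>\<^sub>m A = r0 \<cdot>\<^sub>m B" for A B :: "real mat"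
  proof -
    have "A = (1 / r0) \<cdot>\<^sub>m (r0 \<cdot>\<^sub>m A)" using r0 by (intro eq_matI) auto
    also have "\<dots> = B" unfolding that using r0 by (intro eq_matI) auto
    finally show ?thesis .
  qed
  show "velx Unew0 = velx (U0 s)" "vely Unew0 = vely (U0 s)" "conc Unew0 = conc (U0 s)"
    using same[OF conserved_limit(2)] same[OF conserved_limit(3)] same[OF conserved_limit(4)]
    unfolding conserved_uniform[OF u v] conserved_uniform[OF Us valid_limits(3)[OF s]]
    by (blast intro: cancel)+
qed

lemma limit_stage_equations:
  assumes c0: "limit_coefficient C c0" and l: "l \<in> {1..s}"
  defines "Kx \<equiv> \<lambda>j. limit_Kx (P\<lparr>cp1 := c0\<rparr>) r0 (Ut0 j) (U0 j) ((1 / r0) \<cdot>\<^sub>m pres_first_order P (U0 j) (U1 j))"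
    and "Ky \<equiv> \<lambda>j. limit_Ky (P\<lparr>cp1 := c0\<rparr>) r0 (Ut0 j) (U0 j) ((1 / r0) \<cdot>\<^sub>m pres_first_order P (U0 j) (U1 j))"
    and "J \<equiv> \<lambda>j. limit_J (P\<lparr>cp1 := c0\<rparr>) r0 (Ut0 j) (U0 j)"
  shows "velx (Ut0 l) = rk_comb (velx Unow0) dt0 (aE l) {1..<l} Kx"
    "vely (Ut0 l) = rk_comb (vely Unow0) dt0 (aE l) {1..<l} Ky"
    "conc (Ut0 l) = rk_comb (conc Unow0) dt0 (aE l) {1..<l} J"
    "velx (U0 l) = rk_comb (velx Unow0) dt0 (aI l) {1..l} Kx"
    "vely (U0 l) = rk_comb (vely Unow0) dt0 (aI l) {1..l} Ky"
    "conc (U0 l) = rk_comb (conc Unow0) dt0 (aI l) {1..l} J"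
proof -
  have r0: "r0 \<noteq> 0" using prep by (simp add: uniform_density_def)
  have inc: "uniform_density P (Ut0 l) r0" "uniform_density P (U0 l) r0"
    using all_stages_incompressible[OF l] by (auto simp: incompressible_stage_def)
  have sub: "j \<in> {1..s}" if "j \<in> {1..<l} \<or> j \<in> {1..l}" for j using that l by auto
  have il: "mat_tendsto (cells P - 1) (cells P) (increment MomX j) (r0 \<cdot>\<^sub>m Kx j)"
    "mat_tendsto (cells P) (cells P - 1) (increment MomY j) (r0 \<cdot>\<^sub>m Ky j)"
    "mat_tendsto (cells P) (cells P) (increment Conc j) (r0 \<cdot>\<^sub>m J j)"
    "Kx j \<in> carrier_mat (cells P - 1) (cells P)"
    "Ky j \<in> carrier_mat (cells P) (cells P - 1)"
    "J j \<in> carrier_mat (cells P) (cells P)" if "j \<in> {1..<l} \<or> j \<in> {1..l}" for j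
    unfolding Kx_def Ky_def J_def by (rule increment_limits[OF c0 sub[OF that]])+
  have carr: "velx S \<in> carrier_mat (cells P - 1) (cells P)" "vely S \<in> carrier_mat (cells P) (cells P - 1)"
    "conc S \<in> carrier_mat (cells P) (cells P)" if "valid_state P S" for S
    using that by (auto simp: valid_state_def)
  note cN = conserved_uniform[OF prep valid_limits(1)]
  note ce = conserved_uniform[OF inc(1) valid_limits(2)[OF l]] and ci = conserved_uniform[OF inc(2) valid_limits(3)[OF l]]
  show "velx (Ut0 l) = rk_comb (velx Unow0) dt0 (aE l) {1..<l} Kx"
    by (rule rk_comb_cancel[OF r0 carr(1)[OF valid_limits(2)[OF l]] carr(1)[OF valid_limits(1)] il(4)
        explicit_stage_limit[OF l conserved_limit(2) il(1), unfolded cN ce]]) auto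
  show "vely (Ut0 l) = rk_comb (vely Unow0) dt0 (aE l) {1..<l} Ky"
    by (rule rk_comb_cancel[OF r0 carr(2)[OF valid_limits(2)[OF l]] carr(2)[OF valid_limits(1)] il(5)
        explicit_stage_limit[OF l conserved_limit(3) il(2), unfolded cN ce]]) auto
  show "conc (Ut0 l) = rk_comb (conc Unow0) dt0 (aE l) {1..<l} J"
    by (rule rk_comb_cancel[OF r0 carr(3)[OF valid_limits(2)[OF l]] carr(3)[OF valid_limits(1)] il(6)
        explicit_stage_limit[OF l conserved_limit(4) il(3), unfolded cN ce]]) auto
  show "velx (U0 l) = rk_comb (velx Unow0) dt0 (aI l) {1..l} Kx"
    by (rule rk_comb_cancel[OF r0 carr(1)[OF valid_limits(3)[OF l]] carr(1)[OF valid_limits(1)] il(4)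
        implicit_stage_limit[OF l conserved_limit(2) il(1), unfolded cN ci]]) auto
  show "vely (U0 l) = rk_comb (vely Unow0) dt0 (aI l) {1..l} Ky"
    by (rule rk_comb_cancel[OF r0 carr(2)[OF valid_limits(3)[OF l]] carr(2)[OF valid_limits(1)] il(5)
        implicit_stage_limit[OF l conserved_limit(3) il(2), unfolded cN ci]]) auto
  show "conc (U0 l) = rk_comb (conc Unow0) dt0 (aI l) {1..l} J"
    by (rule rk_comb_cancel[OF r0 carr(3)[OF valid_limits(3)[OF l]] carr(3)[OF valid_limits(1)] il(6)
        implicit_stage_limit[OF l conserved_limit(4) il(3), unfolded cN ci]]) auto
qed

end

theorem theorem1:
  fixes P :: params
    and C dt :: "real \<Rightarrow> real"
    and dt0 :: real
    and s :: nat
    and aE aI :: "nat \<Rightarrow> nat \<Rightarrow> real"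
    and bE bI :: "nat \<Rightarrow> real"
    and Unow Unew :: "real \<Rightarrow> state"
    and Ut U :: "real \<Rightarrow> nat \<Rightarrow> state"
    and Unow0 Unow1 Unew0 Unew1 :: state
    and Ut0 Ut1 U0 U1 :: "nat \<Rightarrow> state"
  assumes "valid_params P"
    and "\<forall>\<^sub>F \<delta> in at_right 0. 0 < C \<delta>"
    and "C \<in> o[at_right 0](\<lambda>\<delta>. cp2 (at_mach P C \<delta>))"
    and "imex_pair s aE aI bE bI"
    and "stiffly_accurate s aI bI"
    and "(dt \<longlongrightarrow> dt0) (at_right 0)"
    and "0 < dt0"
    and "\<forall>\<^sub>F \<delta> in at_right 0. valid_state P (Unow \<delta>) \<and> pos_dens P (Unow \<delta>) \<and>
           (\<forall>l\<in>{1..s}. valid_state P (Ut \<delta> l) \<and> pos_dens P (Ut \<delta> l) \<and>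
                        valid_state P (U \<delta> l) \<and> pos_dens P (U \<delta> l))"
    and "\<forall>\<^sub>F \<delta> in at_right 0. imex_stages (at_mach P C \<delta>) s aE aI (dt \<delta>) (Unow \<delta>) (Ut \<delta>) (U \<delta>)"
    and "admits_expansion P Unow Unow0 Unow1"
    and "\<forall>l\<in>{1..s}. admits_expansion P (\<lambda>\<delta>. Ut \<delta> l) (Ut0 l) (Ut1 l)"
    and "\<forall>l\<in>{1..s}. admits_expansion P (\<lambda>\<delta>. U \<delta> l) (U0 l) (U1 l)"
    and "pos_dens P Unow0"
    and "\<forall>l\<in>{1..s}. pos_dens P (Ut0 l) \<and> pos_dens P (U0 l)"
    and "well_prepared P Unow0"
  shows "(\<forall>l\<in>{1..s}. well_prepared P (U0 l)) \<and>
    ((\<forall>\<^sub>F \<delta> in at_right 0. valid_state P (Unew \<delta>) \<and>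
        imex_update (at_mach P C \<delta>) s bI (dt \<delta>) (Unow \<delta>) (Ut \<delta>) (U \<delta>) (Unew \<delta>)) \<and>
     admits_expansion P Unew Unew0 Unew1 \<longrightarrow>
       well_prepared P Unew0 \<and>
       asymptotic_preserving P C s aE aI dt0 Unow0 Ut0 U0
         (\<lambda>l. pres_first_order P (U0 l) (U1 l)) Unew0)"
proof -
  have C: "low_mach C" by (rule low_mach_if_smallo) (use assms in auto)
  have valid: "\<forall>\<^sub>F \<delta> in at_right 0. valid_state P (Unow \<delta>)"
    "\<forall>l\<in>{1..s}. \<forall>\<^sub>F \<delta> in at_right 0. valid_state P (Ut \<delta> l)"
    "\<forall>l\<in>{1..s}. \<forall>\<^sub>F \<delta> in at_right 0. valid_state P (U \<delta> l)"
    using assms(8) by (auto elim: eventually_mono)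
  have pos: "\<forall>l\<in>{1..s}. pos_dens P (U0 l)" using assms(14) by simp
  have s: "s \<in> {1..s}" using assms(4) by (auto simp: imex_pair_def)
  define r0 where "r0 = dens Unow0 $$ (0, 0)"
  have vN: "valid_state P Unow0"
    using admits_expansion_near[OF assms(10) valid(1)] by (simp add: near_state_def)
  have prep: "uniform_density P Unow0 r0"
    using assms(15) well_prepared_iff[OF assms(1) vN assms(13)] by (simp add: r0_def)
  note scheme = assms(1) C assms(4,6,7) valid assms(9-12) pos prep
  note inc = all_stages_incompressible[OF scheme, unfolded incompressible_stage_def]
  have n: "0 < cells P" using assms(1) by (simp add: valid_params_def)
  have r: "dens S $$ (0, 0) = r0" if "uniform_density P S r0" for S
    using that n by (simp add: uniform_density_def const_mat_def)
  have wp: "well_prepared P S" if "valid_state P S" "uniform_density P S r0"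
    "divh P (velx S) (vely S) = 0\<^sub>m (cells P) (cells P)" for S
  proof -
    have "pos_dens P S" using that(2) by (simp add: uniform_density_def pos_dens_def const_mat_def)
    from well_prepared_iff[OF assms(1) that(1) this] show ?thesis using that r[OF that(2)] by simp
  qed
  have first: "\<forall>l\<in>{1..s}. well_prepared P (U0 l)"
    using inc valid_limits(3)[OF scheme] by (blast intro: wp)
  obtain c0 where c0: "limit_coefficient C c0" and c0_lim: "\<forall>c. (C \<longlongrightarrow> c) (at_right 0) \<longrightarrow> c0 = c"
    using limit_coefficient_exists C unfolding low_mach_def by blast
  have second: "well_prepared P Unew0 \<and>
       asymptotic_preserving P C s aE aI dt0 Unow0 Ut0 U0 (\<lambda>l. pres_first_order P (U0 l) (U1 l)) Unew0"
    if ev: "\<forall>\<^sub>F \<delta> in at_right 0. valid_state P (Unew \<delta>) \<and>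
        imex_update (at_mach P C \<delta>) s bI (dt \<delta>) (Unow \<delta>) (Ut \<delta>) (U \<delta>) (Unew \<delta>)"
      and ex: "admits_expansion P Unew Unew0 Unew1"
  proof -
    have new: "\<forall>\<^sub>F \<delta> in at_right 0. valid_state P (Unew \<delta>)"
      "\<forall>\<^sub>F \<delta> in at_right 0. imex_update (at_mach P C \<delta>) s bI (dt \<delta>) (Unow \<delta>) (Ut \<delta>) (U \<delta>) (Unew \<delta>)"
      using ev by (auto elim: eventually_mono)
    note upd = update_limit[OF scheme assms(5) new ex]
    have "well_prepared P Unew0"
      by (rule wp[OF upd(2,1)]) (use inc[OF s] upd in simp)
    moreover have "limit_scheme (P\<lparr>cp1 := c0\<rparr>) s aE aI dt0 r0 Unow0 Ut0 U0
        (\<lambda>j. (1 / r0) \<cdot>\<^sub>m pres_first_order P (U0 j) (U1 j)) Unew0"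
      unfolding limit_scheme_def Let_def cells_cp1 operator_cp1
      using inc upd prep limit_stage_equations[OF scheme c0] by (simp add: uniform_density_def)
    ultimately show ?thesis
      unfolding asymptotic_preserving_def Let_def r0_def[symmetric]
      using stability_independent c0 c0_lim by (auto simp: limit_coefficient_def)
  qed
  from first second show ?thesis by blast
qed

end
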